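(* Let $K$ be an algebraically closed field. The generic border subrank of tensors in $(K^n)^{\otimes 3}$ is at least $\lfloor \sqrt{4n} \rfloor - 3$, and hence, for $n$ sufficiently large, strictly greater than the generic subrank of tensors in $(K^n)^{\otimes 3}$.
   Context: Let $V_1,V_2,V_3$ be finite-dimensional $K$-vector spaces. For a nonnegative integer $r$, let $e_1,\ldots,e_r$ be the standard basis of $K^r$; the $r$-th unit tensor is $I_r := \sum_{i=1}^r e_i^{\otimes 3} \in (K^r)^{\otimes 3}$. The subrank of a tensor $T \in V_1 \otimes V_2 \otimes V_3$ is the maximal $r$ for which there exist linear maps $\phi_i : V_i \to K^r$, $i=1,2,3$, such that $(\phi_1 \otimes \phi_2 \otimes \phi_3)T = I_r$. The border subrank of $T$ is the maximal $r$ for which $I_r$ lies in the Zariski closure (in $(K^r)^{\otimes 3}$) of the set $\{(\phi_1 \otimes \phi_2 \otimes \phi_3)T \mid \phi_i \in \mathrm{Hom}(V_i,K^r),\ i=1,2,3\}$. For each $r$, the set of tensors of subrank precisely $r$ and the set of tensors of border subrank precisely $r$ are constructible. The generic subrank (respectively, generic border subrank) of tensors in $V_1 \otimes V_2 \otimes V_3$ is the unique $r$ for which the set of tensors of subrank (respectively, border subrank) precisely $r$ is Zariski dense in $V_1 \otimes V_2 \otimes V_3$. *)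

theory Defs
  imports Complex_Main "Jordan_Normal_Form.Matrix" "HOL-Computational_Algebra.Polynomial"
begin

section \<open>Zariski topology\<close>

text \<open>
  Polynomial functions on the affine space of families indexed by \<open>'i\<close>. Each polynomial involves
  only finitely many coordinates.
\<close>

inductive polynomial_fun :: "(('i \<Rightarrow> 'a::comm_ring_1) \<Rightarrow> 'a) \<Rightarrow> bool" where
  const: "polynomial_fun (\<lambda>x. c)"
| coord: "polynomial_fun (\<lambda>x. x i)"
| add: "polynomial_fun p \<Longrightarrow> polynomial_fun q \<Longrightarrow> polynomial_fun (\<lambda>x. p x + q x)"
| mult: "polynomial_fun p \<Longrightarrow> polynomial_fun q \<Longrightarrow> polynomial_fun (\<lambda>x. p x * q x)"

definition zariski_closed :: "('i \<Rightarrow> 'a::comm_ring_1) set \<Rightarrow> bool" where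
  "zariski_closed C \<longleftrightarrow> (\<exists>P. (\<forall>p\<in>P. polynomial_fun p) \<and> C = {x. \<forall>p\<in>P. p x = 0})"

abbreviation zariski_closure :: "('i \<Rightarrow> 'a::comm_ring_1) set \<Rightarrow> ('i \<Rightarrow> 'a) set" where
  "zariski_closure S \<equiv> zariski_closed hull S"

definition zariski_dense_in :: "('i \<Rightarrow> 'a::comm_ring_1) set \<Rightarrow> ('i \<Rightarrow> 'a) set \<Rightarrow> bool" where
  "zariski_dense_in X S \<longleftrightarrow> S \<subseteq> X \<and> X \<subseteq> zariski_closure S"

section \<open>Tensors of order three\<close>

text \<open>
  A tensor is given by its coordinates in the standard basis, extended by zero outside the index
  range. So \<open>tensors n1 n2 n3\<close>, which stands for the tensor product of the spaces \<open>K^n1\<close>, \<open>K^n2\<close>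
  and \<open>K^n3\<close>, is a coordinate subspace of the space of all families. It is itself Zariski closed
  there, and restricting polynomial functions to it gives exactly the polynomials in the
  \<open>n1 * n2 * n3\<close> coordinates; hence closures of its subsets, taken in the space of all families,
  are their usual Zariski closures.
\<close>

type_synonym 'a tensor = "nat \<times> nat \<times> nat \<Rightarrow> 'a"

definition tensors :: "nat \<Rightarrow> nat \<Rightarrow> nat \<Rightarrow> 'a::zero tensor set" where
  "tensors n1 n2 n3 = {T. \<forall>i j k. \<not> (i < n1 \<and> j < n2 \<and> k < n3) \<longrightarrow> T (i, j, k) = 0}"

definition unit_tensor :: "nat \<Rightarrow> 'a::zero_neq_one tensor" where
  "unit_tensor r = (\<lambda>(i, j, k). if i = j \<and> j = k \<and> i < r then 1 else 0)"

text \<open>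
  The tensor product of the linear maps with matrices \<open>A\<close>, \<open>B\<close>, \<open>C\<close>, applied to a tensor in
  \<open>tensors (dim_col A) (dim_col B) (dim_col C)\<close>.
\<close>

definition tensor_map :: "'a::comm_semiring_0 mat \<Rightarrow> 'a mat \<Rightarrow> 'a mat \<Rightarrow> 'a tensor \<Rightarrow> 'a tensor" where
  "tensor_map A B C T = (\<lambda>(a, b, c).
     if a < dim_row A \<and> b < dim_row B \<and> c < dim_row C
     then \<Sum>i<dim_col A. \<Sum>j<dim_col B. \<Sum>k<dim_col C.
            A $$ (a, i) * B $$ (b, j) * C $$ (c, k) * T (i, j, k)
     else 0)"

definition restrictions :: "nat \<Rightarrow> nat \<Rightarrow> nat \<Rightarrow> nat \<Rightarrow> 'a::comm_semiring_0 tensor \<Rightarrow> 'a tensor set" where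
  "restrictions n1 n2 n3 r T =
     {tensor_map A B C T | A B C.
        A \<in> carrier_mat r n1 \<and> B \<in> carrier_mat r n2 \<and> C \<in> carrier_mat r n3}"

section \<open>Subrank and border subrank\<close>

text \<open>
  The sets of admissible \<open>r\<close> below contain 0 and are bounded by the minimum of \<open>n1\<close>, \<open>n2\<close>, \<open>n3\<close>
  (compare flattening ranks), so \<open>GREATEST\<close> denotes their maximum.
\<close>

definition subrank :: "nat \<Rightarrow> nat \<Rightarrow> nat \<Rightarrow> 'a::field tensor \<Rightarrow> nat" where
  "subrank n1 n2 n3 T = (GREATEST r. unit_tensor r \<in> restrictions n1 n2 n3 r T)"

definition border_subrank :: "nat \<Rightarrow> nat \<Rightarrow> nat \<Rightarrow> 'a::field tensor \<Rightarrow> nat" where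
  "border_subrank n1 n2 n3 T =
     (GREATEST r. unit_tensor r \<in> zariski_closure (restrictions n1 n2 n3 r T))"

text \<open>The type argument specifies the ground field.\<close>

definition generic_subrank :: "'a::field itself \<Rightarrow> nat \<Rightarrow> nat \<Rightarrow> nat \<Rightarrow> nat" where
  "generic_subrank _ n1 n2 n3 =
     (THE r. zariski_dense_in (tensors n1 n2 n3)
               {T \<in> tensors n1 n2 n3. subrank n1 n2 n3 (T :: 'a tensor) = r})"

definition generic_border_subrank :: "'a::field itself \<Rightarrow> nat \<Rightarrow> nat \<Rightarrow> nat \<Rightarrow> nat" where
  "generic_border_subrank _ n1 n2 n3 =
     (THE r. zariski_dense_in (tensors n1 n2 n3)
               {T \<in> tensors n1 n2 n3. border_subrank n1 n2 n3 (T :: 'a tensor) = r})"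

end

(*
Let r be about 2 sqrt n. Fixing the third linear map to be a coordinate projection, the rows
a_0, b_0, a_1, b_1, ... of the first two maps can be chosen in this order so that the image S of a
generic tensor satisfies S(i,j,k) = [i = j = k] whenever i, j <= k: each row has to solve at most
(r + 1)^2 / 4 <= n linear equations. The one-parameter group with weights 2^i, 2^j, -2^(k+1) then
degenerates S to the unit tensor. For the subrank, normalizing minors of the three maps shows that
tensors of subrank at least r form a family with n^3 - r^3 + 3 r n parameters, so r^2 <= 3 n
generically.

That the generic values exist is a statement about constructibility. For the subrank it is quantifier
elimination over algebraically closed fields. For the border subrank, a Groebner basis of the ideal of
the graph of the map (A, B, C) |-> (A, B, C)T, computed over the polynomials in T and with respect to
an elimination order, specializes to almost all T, and hence so do the equations of the closure of
the image.
*)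
theory Submission
  imports Defs "HOL-Library.Poly_Mapping" "HOL-Library.Countable" "Jordan_Normal_Form.Determinant"
begin

section \<open>Generic properties\<close>

text \<open>The closure of the image over one tensor T is defined by equations of unbounded degree,
  which may jump at special T; so quantifier elimination settles the subrank but not the border
  subrank. Both are reduced to a dichotomy: a property is \<open>decided\<close> if it or its
  negation holds on a nonempty principal open set. It passes through Boolean combinations and, among
  finitely many possible values, singles out one generic value.

  In the lower bound the rows are polynomial functions of T that solve their linear systems
  identically in T, so one tensor at which the diagonal entries do not vanish is enough. That
  tensor, \<open>seed\<close>, must make all the systems independent at once. Giving each equation a
  private coordinate amounts to colouring intervals so that any two with a common point get
  different colours. This follows from (r + 3)^2 <= 4 n and explains the constant 3. For large n the
  comparison is 2 > sqrt 3.\<close>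

lemma polynomial_fun_uminus: "polynomial_fun p \<Longrightarrow> polynomial_fun (\<lambda>x. - p x)"
  using polynomial_fun.mult[OF polynomial_fun.const[of "-1"], of p] by simp

lemma polynomial_fun_diff:
  "polynomial_fun p \<Longrightarrow> polynomial_fun q \<Longrightarrow> polynomial_fun (\<lambda>x. p x - q x)"
  using polynomial_fun.add[OF _ polynomial_fun_uminus, of p q] by simp

lemma polynomial_fun_sum:
  "(\<And>i. i \<in> S \<Longrightarrow> polynomial_fun (f i)) \<Longrightarrow> polynomial_fun (\<lambda>x. \<Sum>i\<in>S. f i x)"
  by (induction S rule: infinite_finite_induct) (auto intro: polynomial_fun.intros)

lemma polynomial_fun_prod:
  "(\<And>i. i \<in> S \<Longrightarrow> polynomial_fun (f i)) \<Longrightarrow> polynomial_fun (\<lambda>x. \<Prod>i\<in>S. f i x)"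
  by (induction S rule: infinite_finite_induct) (auto intro: polynomial_fun.intros)

lemma polynomial_fun_power: "polynomial_fun p \<Longrightarrow> polynomial_fun (\<lambda>x. p x ^ k)"
  by (induction k) (auto intro: polynomial_fun.intros)

lemma polynomial_fun_if:
  "(b \<Longrightarrow> polynomial_fun p) \<Longrightarrow> (\<not> b \<Longrightarrow> polynomial_fun q) \<Longrightarrow>
   polynomial_fun (\<lambda>x. if b then p x else q x)"
  by (cases b) simp_all

lemmas polynomial_fun_intros = polynomial_fun.intros polynomial_fun_uminus polynomial_fun_diff
  polynomial_fun_sum polynomial_fun_prod polynomial_fun_power polynomial_fun_if

lemma polynomial_fun_compose:
  assumes "polynomial_fun p" "\<And>i. polynomial_fun (\<phi> i)"
  shows "polynomial_fun (\<lambda>x. p (\<lambda>i. \<phi> i x))"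
  using assms(1) by induction (auto intro: polynomial_fun.intros assms(2))

text \<open>Reduces questions about polynomial functions of arbitrarily many coordinates to roots of
  one univariate polynomial. The curves in question are lines between two points and the
  degeneration to the unit tensor.\<close>

lemma polynomial_fun_curve:
  assumes "polynomial_fun p"
  shows "\<exists>P. \<forall>t. p (\<lambda>i. poly (\<gamma> i) t) = poly P t"
  using assms
proof induction
  case (const c)
  show ?case by (rule exI[of _ "[:c:]"]) simp
next
  case (coord i)
  show ?case by (rule exI[of _ "\<gamma> i"]) simp
next
  case (add p q)
  then show ?case by (metis poly_add)
next
  case (mult p q)
  then show ?case by (metis poly_mult)
qed

text \<open>A closed set is an intersection of zero sets of single polynomials, so the hull can be
  tested one polynomial at a time.\<close>

lemma mem_zariski_closure_iff:
  "y \<in> zariski_closure S \<longleftrightarrow> (\<forall>p. polynomial_fun p \<longrightarrow> (\<forall>x\<in>S. p x = 0) \<longrightarrow> p y = 0)"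
proof
  assume y: "y \<in> zariski_closure S"
  show "\<forall>p. polynomial_fun p \<longrightarrow> (\<forall>x\<in>S. p x = 0) \<longrightarrow> p y = 0"
  proof (intro allI impI)
    fix p :: "('a \<Rightarrow> 'b) \<Rightarrow> 'b" assume p: "polynomial_fun p" "\<forall>x\<in>S. p x = 0"
    have "zariski_closed {x. p x = 0}"
      unfolding zariski_closed_def using p(1) by (intro exI[of _ "{p}"]) auto
    then have "zariski_closure S \<subseteq> {x. p x = 0}"
      by (rule hull_minimal[rotated]) (use p(2) in auto)
    then show "p y = 0" using y by auto
  qed
next
  assume y: "\<forall>p. polynomial_fun p \<longrightarrow> (\<forall>x\<in>S. p x = 0) \<longrightarrow> p y = 0"
  show "y \<in> zariski_closure S"
    unfolding hull_def
  proof safe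
    fix C assume C: "zariski_closed C" "S \<subseteq> C"
    then obtain P where "\<forall>p\<in>P. polynomial_fun p" "C = {x. \<forall>p\<in>P. p x = 0}"
      unfolding zariski_closed_def by auto
    then show "y \<in> C" using C(2) y by (auto simp: subset_iff)
  qed
qed

text \<open>Over a finite field, 1 plus the product of all X - a takes the value 1 everywhere and so
  has no root.\<close>

lemma infinite_UNIV_alg_closed: "infinite (UNIV :: 'a::alg_closed_field set)"
proof
  assume fin: "finite (UNIV :: 'a set)"
  define p :: "'a poly" where "p = (\<Prod>a\<in>UNIV. [:-a, 1:]) + 1"
  have "degree (\<Prod>a\<in>(UNIV::'a set). [:-a, 1:]) = card (UNIV :: 'a set)"
    by (subst degree_prod_eq_sum_degree) auto
  moreover have "card (UNIV :: 'a set) > 0"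
    using fin by (simp add: card_gt_0_iff)
  ultimately have "degree p > 0"
    unfolding p_def by (subst degree_add_eq_left) auto
  then obtain x where "poly p x = 0"
    using alg_closed_imp_poly_has_root by blast
  moreover have "(\<Prod>a\<in>UNIV. x - a) = 0"
    using fin by (intro prod_zero) auto
  ultimately show False
    by (simp add: p_def poly_prod)
qed

text \<open>Truth on a nonempty principal open set in the space of all families. Over an infinite
  field two such sets always meet, so finitely many generic properties can be combined.\<close>

definition generically :: "(('i \<Rightarrow> 'a::comm_ring_1) \<Rightarrow> bool) \<Rightarrow> bool" where
  "generically P \<longleftrightarrow> (\<exists>h. polynomial_fun h \<and> (\<exists>x. h x \<noteq> 0) \<and> (\<forall>x. h x \<noteq> 0 \<longrightarrow> P x))"

text \<open>Constructible properties satisfy this dichotomy because affine space is irreducible. It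
  is what the existence of a generic value requires, and for membership in a closure it is proved
  directly.\<close>

definition decided :: "(('i \<Rightarrow> 'a::comm_ring_1) \<Rightarrow> bool) \<Rightarrow> bool" where
  "decided P \<longleftrightarrow> generically P \<or> generically (\<lambda>x. \<not> P x)"

lemma generically_mono: "generically P \<Longrightarrow> (\<And>x. P x \<Longrightarrow> Q x) \<Longrightarrow> generically Q"
  unfolding generically_def by blast

lemma generically_True: "(\<And>x. P x) \<Longrightarrow> generically P"
  unfolding generically_def by (intro exI[of _ "\<lambda>_. 1"]) (auto intro: polynomial_fun.intros)

text \<open>On the line from x to y, p is nonzero at t = 0 and q at t = 1, so their product has
  finitely many roots there. The conclusion keeps the explicit point on the line because such a
  point stays in every linear subspace that contains x and y, for instance the space of
  tensors.\<close>

lemma polynomial_fun_common_nonzero: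
  fixes p q :: "('i \<Rightarrow> 'a::field) \<Rightarrow> 'a"
  assumes inf: "infinite (UNIV :: 'a set)"
    and p: "polynomial_fun p" "p x \<noteq> 0" and q: "polynomial_fun q" "q y \<noteq> 0"
  shows "\<exists>t. p (\<lambda>i. x i + t * (y i - x i)) \<noteq> 0 \<and> q (\<lambda>i. x i + t * (y i - x i)) \<noteq> 0"
proof -
  define \<gamma> where "\<gamma> = (\<lambda>i. [:x i, y i - x i:])"
  obtain P where P: "\<And>t. p (\<lambda>i. poly (\<gamma> i) t) = poly P t"
    using polynomial_fun_curve[OF p(1)] by blast
  obtain Q where Q: "\<And>t. q (\<lambda>i. poly (\<gamma> i) t) = poly Q t"
    using polynomial_fun_curve[OF q(1)] by blast
  have "P \<noteq> 0" using P[of 0] p(2) by (auto simp: \<gamma>_def)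
  moreover have "Q \<noteq> 0" using Q[of 1] q(2) by (auto simp: \<gamma>_def)
  ultimately have "finite {t. poly (P * Q) t = 0}"
    by (intro poly_roots_finite) auto
  then obtain t where "poly (P * Q) t \<noteq> 0"
    using inf by (metis (mono_tags, lifting) ex_new_if_finite mem_Collect_eq)
  then show ?thesis
    using P[of t] Q[of t] by (intro exI[of _ t]) (auto simp: \<gamma>_def)
qed

lemma polynomial_fun_mult_nonzero:
  fixes p q :: "('i \<Rightarrow> 'a::field) \<Rightarrow> 'a"
  assumes "infinite (UNIV :: 'a set)"
    and "polynomial_fun p" "\<exists>x. p x \<noteq> 0" "polynomial_fun q" "\<exists>x. q x \<noteq> 0"
  shows "\<exists>x. p x * q x \<noteq> 0"
  using polynomial_fun_common_nonzero[OF assms(1,2) _ assms(4)] assms(3,5) by (metis mult_eq_0_iff)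

lemma polynomial_fun_prod_nonzero:
  fixes p :: "'b \<Rightarrow> ('i \<Rightarrow> 'a::field) \<Rightarrow> 'a"
  assumes "infinite (UNIV :: 'a set)" "finite S"
    and "\<And>i. i \<in> S \<Longrightarrow> polynomial_fun (p i)" "\<And>i. i \<in> S \<Longrightarrow> \<exists>x. p i x \<noteq> 0"
  shows "\<exists>x. (\<Prod>i\<in>S. p i x) \<noteq> 0"
  using assms(2-4)
proof (induction S rule: finite_induct)
  case (insert i S)
  then have "\<exists>x. p i x * (\<Prod>j\<in>S. p j x) \<noteq> 0"
    by (intro polynomial_fun_mult_nonzero[OF assms(1)] polynomial_fun_prod) auto
  then show ?case using insert by simp
qed auto

lemma generically_ball:
  fixes P :: "'b \<Rightarrow> ('i \<Rightarrow> 'a::field) \<Rightarrow> bool"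
  assumes "infinite (UNIV :: 'a set)" "finite S" "\<And>i. i \<in> S \<Longrightarrow> generically (P i)"
  shows "generically (\<lambda>x. \<forall>i\<in>S. P i x)"
proof -
  have "\<forall>i\<in>S. \<exists>h. polynomial_fun h \<and> (\<exists>x. h x \<noteq> 0) \<and> (\<forall>x. h x \<noteq> 0 \<longrightarrow> P i x)"
    using assms(3) unfolding generically_def by auto
  then obtain h where h: "\<And>i. i \<in> S \<Longrightarrow> polynomial_fun (h i)"
    "\<And>i. i \<in> S \<Longrightarrow> \<exists>x. h i x \<noteq> 0" "\<And>i x. i \<in> S \<Longrightarrow> h i x \<noteq> 0 \<Longrightarrow> P i x"
    by metis
  have "\<exists>x. (\<Prod>i\<in>S. h i x) \<noteq> 0"
    by (rule polynomial_fun_prod_nonzero) (use assms h in auto)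
  then show ?thesis
    unfolding generically_def using assms(2) h
    by (intro exI[of _ "\<lambda>x. \<Prod>i\<in>S. h i x"]) (auto intro: polynomial_fun_intros)
qed

lemma generically_conj:
  fixes P :: "('i \<Rightarrow> 'a::field) \<Rightarrow> bool"
  assumes "infinite (UNIV :: 'a set)" "generically P" "generically Q"
  shows "generically (\<lambda>x. P x \<and> Q x)"
proof -
  have "generically (\<lambda>x. \<forall>b\<in>UNIV. (if b then P else Q) x)"
    using assms(2,3) by (intro generically_ball[OF assms(1)]) auto
  then show ?thesis by (rule generically_mono) (auto simp: all_bool_eq UNIV_bool)
qed

lemma generically_witness: "generically P \<Longrightarrow> \<exists>x. P x"
  unfolding generically_def by blast

lemma decided_not: "decided P \<Longrightarrow> decided (\<lambda>x. \<not> P x)"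
  unfolding decided_def by auto

lemma decided_conj:
  fixes P :: "('i \<Rightarrow> 'a::field) \<Rightarrow> bool"
  assumes "infinite (UNIV :: 'a set)" "decided P" "decided Q"
  shows "decided (\<lambda>x. P x \<and> Q x)"
proof (cases "generically P \<and> generically Q")
  case True
  then show ?thesis using generically_conj[OF assms(1)] by (auto simp: decided_def)
next
  case False
  then have "generically (\<lambda>x. \<not> P x) \<or> generically (\<lambda>x. \<not> Q x)"
    using assms by (auto simp: decided_def)
  then have "generically (\<lambda>x. \<not> (P x \<and> Q x))"
    by (auto elim!: generically_mono)
  then show ?thesis by (auto simp: decided_def)
qed

lemma decided_ball:
  fixes P :: "'b \<Rightarrow> ('i \<Rightarrow> 'a::field) \<Rightarrow> bool"
  assumes inf: "infinite (UNIV :: 'a set)" and "finite S" "\<And>i. i \<in> S \<Longrightarrow> decided (P i)"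
  shows "decided (\<lambda>x. \<forall>i\<in>S. P i x)"
  using assms(2,3)
proof (induction S rule: finite_induct)
  case empty
  then show ?case by (auto simp: decided_def intro: generically_True)
next
  case (insert i S)
  then have "decided (\<lambda>x. P i x \<and> (\<forall>j\<in>S. P j x))" by (intro decided_conj[OF inf]) auto
  then show ?case by simp
qed

section \<open>Constructible properties and quantifier elimination\<close>

inductive constructible :: "(('i \<Rightarrow> 'a::field) \<Rightarrow> bool) \<Rightarrow> bool" where
  zero: "polynomial_fun p \<Longrightarrow> constructible (\<lambda>x. p x = 0)"
| neg: "constructible P \<Longrightarrow> constructible (\<lambda>x. \<not> P x)"
| conj: "constructible P \<Longrightarrow> constructible Q \<Longrightarrow> constructible (\<lambda>x. P x \<and> Q x)"

lemma constructible_disj: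
  "constructible P \<Longrightarrow> constructible Q \<Longrightarrow> constructible (\<lambda>x. P x \<or> Q x)"
  using constructible.neg[OF constructible.conj[OF constructible.neg constructible.neg], of P Q]
  by simp

lemma constructible_const: "constructible (\<lambda>_ :: 'i \<Rightarrow> 'a::field. b)"
proof -
  have "constructible (\<lambda>_ :: 'i \<Rightarrow> 'a. (if b then 0 else 1 :: 'a) = 0)"
    by (rule constructible.zero) (rule polynomial_fun.const)
  then show ?thesis by (cases b) auto
qed

lemma constructible_ball:
  "finite S \<Longrightarrow> (\<And>i. i \<in> S \<Longrightarrow> constructible (P i)) \<Longrightarrow> constructible (\<lambda>x. \<forall>i\<in>S. P i x)"
  by (induction S rule: finite_induct) (auto intro: constructible_const constructible.conj)

lemma constructible_bex:
  "finite S \<Longrightarrow> (\<And>i. i \<in> S \<Longrightarrow> constructible (P i)) \<Longrightarrow> constructible (\<lambda>x. \<exists>i\<in>S. P i x)"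
  by (induction S rule: finite_induct) (auto intro: constructible_const constructible_disj)

lemma constructible_compose:
  assumes "constructible P" "\<And>i. polynomial_fun (\<phi> i)"
  shows "constructible (\<lambda>x. P (\<lambda>i. \<phi> i x))"
  using assms(1)
  by induction (auto intro: constructible.intros polynomial_fun_compose[OF _ assms(2)])

lemma constructible_decided:
  fixes P :: "('i \<Rightarrow> 'a::field) \<Rightarrow> bool"
  assumes inf: "infinite (UNIV :: 'a set)" and "constructible P"
  shows "decided P"
  using assms(2)
proof induction
  case (zero p)
  show ?case
  proof (cases "\<exists>x. p x \<noteq> 0")
    case True
    then have "generically (\<lambda>x. p x \<noteq> 0)" using zero by (auto simp: generically_def)
    then show ?thesis by (simp add: decided_def)
  next
    case False
    then have "generically (\<lambda>x. p x = 0)" by (intro generically_True) auto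
    then show ?thesis by (simp add: decided_def)
  qed
next
  case (neg P)
  then show ?case by (rule_tac decided_not)
next
  case (conj P Q)
  then show ?case by (intro decided_conj[OF inf])
qed

section \<open>Univariate polynomials with parameters, and their pseudo-division\<close>

definition poly_family :: "nat \<Rightarrow> (('i \<Rightarrow> 'a::comm_ring_1) \<Rightarrow> 'a poly) \<Rightarrow> bool" where
  "poly_family d F \<longleftrightarrow> (\<forall>n. polynomial_fun (\<lambda>x. coeff (F x) n)) \<and> (\<forall>x n. n \<ge> d \<longrightarrow> coeff (F x) n = 0)"

lemma poly_family_mono: "poly_family d F \<Longrightarrow> d \<le> e \<Longrightarrow> poly_family e F"
  by (auto simp: poly_family_def)

lemma poly_family_add:
  "poly_family d F \<Longrightarrow> poly_family d G \<Longrightarrow> poly_family d (\<lambda>x. F x + G x)"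
  by (auto simp: poly_family_def intro: polynomial_fun_intros)

lemma poly_family_mult:
  assumes "poly_family d F" "poly_family e G"
  shows "poly_family (d + e) (\<lambda>x. F x * G x)"
  unfolding poly_family_def
proof (intro conjI allI impI)
  fix n
  show "polynomial_fun (\<lambda>x. coeff (F x * G x) n)"
    unfolding coeff_mult using assms by (auto simp: poly_family_def intro!: polynomial_fun_intros)
next
  fix x n assume n: "d + e \<le> n"
  have "coeff (F x) i * coeff (G x) (n - i) = 0" for i
    using assms n by (cases "i < d") (auto simp: poly_family_def)
  then show "coeff (F x * G x) n = 0" by (simp add: coeff_mult)
qed

lemma poly_family_const: "poly_family 1 (\<lambda>x. [:c:])"
  by (auto simp: poly_family_def coeff_pCons intro!: polynomial_fun_intros split: nat.split)

lemma poly_family_power: "poly_family d F \<Longrightarrow> \<exists>e. poly_family e (\<lambda>x. F x ^ k)"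
proof (induction k)
  case 0
  then show ?case using poly_family_const[of 1] by (auto simp flip: one_pCons)
next
  case (Suc k)
  then show ?case using poly_family_mult by fastforce
qed

lemma poly_family_remove_top:
  assumes "poly_family (Suc d) F"
  shows "poly_family d (\<lambda>x. F x - monom (coeff (F x) d) d)"
  using assms by (auto simp: poly_family_def coeff_diff not_less_eq_eq
      intro!: polynomial_fun_intros dest: le_antisym)

text \<open>One step of pseudo-division. The top coefficients are only polynomial functions of x, so
  they are cross multiplied instead of divided by. The degree bounds are strict and formal:
  \<open>coeff (F x) d\<close> may vanish at particular x, which the later case distinctions have to
  test.\<close>

lemma poly_family_reduce:
  assumes F: "poly_family (Suc d) F" and G: "poly_family (Suc e) G" and "d \<le> e"
  shows "poly_family e (\<lambda>x. smult (coeff (F x) d) (G x) - smult (coeff (G x) e) (monom 1 (e - d) * F x))"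
  unfolding poly_family_def
proof (intro conjI allI impI)
  fix n
  show "polynomial_fun (\<lambda>x. coeff (smult (coeff (F x) d) (G x) -
      smult (coeff (G x) e) (monom 1 (e - d) * F x)) n)"
    using F G by (auto simp: poly_family_def coeff_monom_mult intro!: polynomial_fun_intros)
next
  fix x n assume n: "e \<le> n"
  have "coeff (F x) (n - (e - d)) = 0" "coeff (G x) n = 0" if "n \<noteq> e"
    using F G n that \<open>d \<le> e\<close> by (auto simp: poly_family_def)
  then show "coeff (smult (coeff (F x) d) (G x) -
      smult (coeff (G x) e) (monom 1 (e - d) * F x)) n = 0"
    using n \<open>d \<le> e\<close> by (cases "n = e") (auto simp: coeff_monom_mult)
qed

lemma polynomial_fun_upd:
  fixes p :: "('i \<Rightarrow> 'a::comm_ring_1) \<Rightarrow> 'a"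
  assumes "polynomial_fun p"
  shows "\<exists>d F. poly_family d F \<and> (\<forall>x t. p (x(i := t)) = poly (F x) t)"
  using assms
proof induction
  case (const c)
  then show ?case
    using poly_family_const[of c] by (intro exI[of _ 1] exI[of _ "\<lambda>_. [:c:]"]) auto
next
  case (coord j)
  show ?case
  proof (cases "j = i")
    case True
    then show ?thesis
      by (intro exI[of _ 2] exI[of _ "\<lambda>_. [:0, 1:]"])
        (auto simp: poly_family_def coeff_pCons intro!: polynomial_fun_intros split: nat.split)
  next
    case False
    have "polynomial_fun (\<lambda>x. coeff [:x j :: 'a:] n)" for n
      by (cases n) (auto intro: polynomial_fun_intros)
    then show ?thesis
      using False by (intro exI[of _ 1] exI[of _ "\<lambda>x. [:x j:]"])
        (auto simp: poly_family_def coeff_pCons split: nat.split)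
  qed
next
  case (add p q)
  then obtain d F e G where FG: "poly_family d F" "poly_family e G"
    "\<And>x t. p (x(i := t)) = poly (F x) t" "\<And>x t. q (x(i := t)) = poly (G x) t" by blast
  have "poly_family (max d e) (\<lambda>x. F x + G x)"
    using FG by (intro poly_family_add) (auto elim: poly_family_mono)
  then show ?case using FG by (metis poly_add)
next
  case (mult p q)
  then show ?case using poly_family_mult by (metis poly_mult)
qed

text \<open>Where the leading coefficient of F is nonzero, a pseudo-division step preserves
  divisibility by F and lowers the formal degree of G. Once that degree is below the degree of F,
  divisibility means that G vanishes coefficientwise.\<close>

lemma constructible_dvd:
  fixes F :: "('i \<Rightarrow> 'a::field) \<Rightarrow> 'a poly"
  assumes F: "poly_family (Suc d) F" and "poly_family e G"
  shows "constructible (\<lambda>x. coeff (F x) d \<noteq> 0 \<and> F x dvd G x)"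
  using assms(2)
proof (induction e arbitrary: G)
  case 0
  then have "G x = 0" for x by (intro poly_eqI) (auto simp: poly_family_def)
  then show ?case
    using F by (auto simp: poly_family_def intro!: constructible.intros)
next
  case (Suc e)
  have deg: "degree (F x) = d" if "coeff (F x) d \<noteq> 0" for x
    using F that by (intro antisym degree_le le_degree) (auto simp: poly_family_def Suc_le_eq)
  show ?case
  proof (cases "d \<le> e")
    case True
    define G' where "G' = (\<lambda>x. smult (coeff (F x) d) (G x) - smult (coeff (G x) e) (monom 1 (e - d) * F x))"
    have "F x dvd G x \<longleftrightarrow> F x dvd G' x" if "coeff (F x) d \<noteq> 0" for x
    proof -
      have "F x dvd smult (coeff (G x) e) (monom 1 (e - d) * F x)"
        by (intro dvd_smult dvd_triv_right)
      then have "F x dvd G' x \<longleftrightarrow> F x dvd smult (coeff (F x) d) (G x)"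
        unfolding G'_def by (metis dvd_diff_right_iff dvd_diff dvd_add diff_add_cancel)
      then show ?thesis using that by (simp add: dvd_smult_iff)
    qed
    then have "(\<lambda>x. coeff (F x) d \<noteq> 0 \<and> F x dvd G x) = (\<lambda>x. coeff (F x) d \<noteq> 0 \<and> F x dvd G' x)"
      by auto
    then show ?thesis
      using Suc.IH[of G'] poly_family_reduce[OF F Suc.prems True] by (simp add: G'_def)
  next
    case False
    have "F x dvd G x \<longleftrightarrow> (\<forall>n\<in>{..e}. coeff (G x) n = 0)" if "coeff (F x) d \<noteq> 0" for x
    proof
      assume dvd: "F x dvd G x"
      have "degree (G x) \<le> e"
        using Suc.prems by (intro degree_le) (auto simp: poly_family_def Suc_le_eq)
      then have "degree (G x) < degree (F x)" using deg[OF that] False by simp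
      then have "G x = 0" using dvd by (meson dvd_imp_degree_le not_le)
      then show "\<forall>n\<in>{..e}. coeff (G x) n = 0" by simp
    next
      assume *: "\<forall>n\<in>{..e}. coeff (G x) n = 0"
      have "coeff (G x) n = 0" for n
        using * Suc.prems by (cases "n \<le> e") (auto simp: poly_family_def)
      then have "G x = 0" by (intro poly_eqI) simp
      then show "F x dvd G x" by simp
    qed
    then have "(\<lambda>x. coeff (F x) d \<noteq> 0 \<and> F x dvd G x) =
        (\<lambda>x. coeff (F x) d \<noteq> 0 \<and> (\<forall>n\<in>{..e}. coeff (G x) n = 0))"
      by auto
    moreover have "constructible (\<lambda>x. coeff (F x) d \<noteq> 0 \<and> (\<forall>n\<in>{..e}. coeff (G x) n = 0))"
      using F Suc.prems by (auto simp: poly_family_def intro!: constructible.intros constructible_ball)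
    ultimately show ?thesis by simp
  qed
qed

text \<open>Here p is a product of \<open>degree p\<close> linear factors up to a constant. If every
  root of p is a root of q, each factor divides q, and one copy of q is spent on each. This turns a
  statement about roots into one about divisibility.\<close>

lemma dvd_power_iff_common_roots:
  fixes p q :: "'a::alg_closed_field poly"
  assumes "p \<noteq> 0"
  shows "p dvd q ^ degree p \<longleftrightarrow> (\<forall>t. poly p t = 0 \<longrightarrow> poly q t = 0)"
proof
  assume dvd: "p dvd q ^ degree p"
  show "\<forall>t. poly p t = 0 \<longrightarrow> poly q t = 0"
  proof (intro allI impI)
    fix t assume t: "poly p t = 0"
    then have "poly (q ^ degree p) t = 0" using dvd by (metis poly_mult dvdE mult_zero_left)
    then show "poly q t = 0" by simp
  qed
next
  assume "\<forall>t. poly p t = 0 \<longrightarrow> poly q t = 0"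
  then show "p dvd q ^ degree p"
    using assms
  proof (induction "degree p" arbitrary: p)
    case 0
    then show ?case by (metis is_unit_iff_degree one_dvd unit_imp_dvd)
  next
    case (Suc d)
    then obtain a where a: "poly p a = 0" using alg_closed_imp_poly_has_root[of p] by auto
    then obtain p1 where p1: "p = [:- a, 1:] * p1"
      by (auto simp: poly_eq_0_iff_dvd elim!: dvdE)
    have "p1 \<noteq> 0" using p1 Suc.prems by auto
    then have "degree p = Suc (degree p1)"
      unfolding p1 by (subst degree_mult_eq) auto
    then have "p1 dvd q ^ d"
      using Suc.hyps(1)[of p1] Suc.hyps(2) Suc.prems \<open>p1 \<noteq> 0\<close> by (simp add: p1)
    moreover have "[:- a, 1:] dvd q" using a Suc.prems by (simp add: poly_eq_0_iff_dvd)
    ultimately have "[:- a, 1:] * p1 dvd q * q ^ d" by (intro mult_dvd_mono)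
    then show ?case using Suc(2) p1 by (metis power_Suc)
  qed
qed

text \<open>Where the top coefficient of F is nonzero, solvability fails exactly if F divides the
  power of G whose exponent is the degree of F. Where it vanishes, the formal degree drops and the
  induction applies.\<close>

lemma constructible_single:
  fixes F :: "('i \<Rightarrow> 'a::alg_closed_field) \<Rightarrow> 'a poly"
  assumes "poly_family d F" and G: "poly_family e G"
  shows "constructible (\<lambda>x. \<exists>t. poly (F x) t = 0 \<and> poly (G x) t \<noteq> 0)"
  using assms(1)
proof (induction d arbitrary: F)
  case 0
  then have F: "F x = 0" for x by (intro poly_eqI) (auto simp: poly_family_def)
  \<comment> \<open>The zero polynomial F imposes no condition on t, and over an infinite field a
    value of t with G nonzero exists exactly if G is not the zero polynomial.\<close>
  have "(\<exists>t. poly (G x) t \<noteq> 0) \<longleftrightarrow> (\<exists>n\<in>{..<e}. coeff (G x) n \<noteq> 0)" for x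
  proof -
    have "(\<exists>t. poly (G x) t \<noteq> 0) \<longleftrightarrow> G x \<noteq> 0"
      using infinite_UNIV_alg_closed poly_roots_finite[of "G x"]
      by (cases "\<forall>t. poly (G x) t = 0") auto
    also have "\<dots> \<longleftrightarrow> (\<exists>n. coeff (G x) n \<noteq> 0)" by (metis coeff_0 poly_eqI)
    also have "\<dots> \<longleftrightarrow> (\<exists>n\<in>{..<e}. coeff (G x) n \<noteq> 0)"
      using G by (metis lessThan_iff not_le poly_family_def)
    finally show ?thesis .
  qed
  moreover have "constructible (\<lambda>x. \<exists>n\<in>{..<e}. coeff (G x) n \<noteq> 0)"
    using G by (auto simp: poly_family_def intro!: constructible.intros constructible_bex)
  ultimately show ?case by (simp add: F)
next
  case (Suc d)
  define F' where "F' = (\<lambda>x. F x - monom (coeff (F x) d) d)"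
  obtain e' where G': "poly_family e' (\<lambda>x. G x ^ d)"
    using poly_family_power[OF G] by blast
  have "(\<exists>t. poly (F x) t = 0 \<and> poly (G x) t \<noteq> 0) \<longleftrightarrow> \<not> F x dvd G x ^ d"
    if "coeff (F x) d \<noteq> 0" for x
  proof -
    have "degree (F x) = d"
      using Suc.prems that by (intro antisym degree_le le_degree) (auto simp: poly_family_def Suc_le_eq)
    then show ?thesis using dvd_power_iff_common_roots[of "F x" "G x"] that by auto
  qed
  moreover have "F x = F' x" if "coeff (F x) d = 0" for x using that by (simp add: F'_def)
  ultimately have "(\<exists>t. poly (F x) t = 0 \<and> poly (G x) t \<noteq> 0) \<longleftrightarrow>
      coeff (F x) d = 0 \<and> (\<exists>t. poly (F' x) t = 0 \<and> poly (G x) t \<noteq> 0) \<or>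
      coeff (F x) d \<noteq> 0 \<and> \<not> (coeff (F x) d \<noteq> 0 \<and> F x dvd G x ^ d)" for x
    by (cases "coeff (F x) d = 0") auto
  moreover have "constructible (\<lambda>x.
      coeff (F x) d = 0 \<and> (\<exists>t. poly (F' x) t = 0 \<and> poly (G x) t \<noteq> 0) \<or>
      coeff (F x) d \<noteq> 0 \<and> \<not> (coeff (F x) d \<noteq> 0 \<and> F x dvd G x ^ d))"
  proof -
    have "constructible (\<lambda>x. coeff (F x) d = 0)"
      using Suc.prems by (auto simp: poly_family_def intro: constructible.zero)
    moreover have "constructible (\<lambda>x. \<exists>t. poly (F' x) t = 0 \<and> poly (G x) t \<noteq> 0)"
      unfolding F'_def by (intro Suc.IH poly_family_remove_top Suc.prems)
    ultimately show ?thesis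
      by (intro constructible_disj constructible.conj)
        (auto intro: constructible.neg constructible.neg[OF constructible_dvd[OF Suc.prems G']]
          simp del: de_Morgan_conj simp_thms)
  qed
  ultimately show ?case by presburger
qed

text \<open>Euclid's algorithm on the equations, branching on whether the top coefficient of the one
  of smaller formal degree vanishes. The measure counts the equations as well as their formal
  degrees, so that dropping an equation of bound 0, which is trivial, also decreases it. It stops
  when at most one equation is left.\<close>

lemma constructible_system:
  fixes G :: "('i \<Rightarrow> 'a::alg_closed_field) \<Rightarrow> 'a poly"
  assumes "\<forall>(d, F)\<in>set L. poly_family d F" and G: "poly_family e G"
  shows "constructible (\<lambda>x. \<exists>t. (\<forall>(d, F)\<in>set L. poly (F x) t = 0) \<and> poly (G x) t \<noteq> 0)"
  using assms(1)
proof (induction "sum_list (map fst L) + length L" arbitrary: L rule: less_induct)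
  case less
  define sol where
    "sol = (\<lambda>L :: (nat \<times> (('i \<Rightarrow> 'a) \<Rightarrow> 'a poly)) list. \<lambda>x. \<exists>t. (\<forall>(d, F)\<in>set L. poly (F x) t = 0) \<and> poly (G x) t \<noteq> 0)"
  have IH: "constructible (sol L')"
    if "sum_list (map fst L') + length L' < sum_list (map fst L) + length L"
      "\<forall>(d, F)\<in>set L'. poly_family d F" for L'
    using less.hyps[OF that] by (simp add: sol_def)
  have step: "constructible (sol ((d1, F1) # (d2, F2) # R))"
    if fam: "poly_family d1 F1" "poly_family d2 F2" "\<forall>(d, F)\<in>set R. poly_family d F" and "d1 \<le> d2"
      and size: "sum_list (map fst L) + length L = d1 + d2 + sum_list (map fst R) + length R + 2"
    for d1 F1 d2 F2 R
  proof (cases d1)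
    case 0
    then have "F1 x = 0" for x using fam(1) by (intro poly_eqI) (auto simp: poly_family_def)
    then have "sol ((d1, F1) # (d2, F2) # R) = sol ((d2, F2) # R)" by (simp add: sol_def)
    then show ?thesis using IH[of "(d2, F2) # R"] fam size by simp
  next
    case (Suc d)
    then obtain k where k: "d2 = Suc k" "d \<le> k" using \<open>d1 \<le> d2\<close> by (cases d2) auto
    define F1' where "F1' = (\<lambda>x. F1 x - monom (coeff (F1 x) d) d)"
    define F2' where
      "F2' = (\<lambda>x. smult (coeff (F1 x) d) (F2 x) - smult (coeff (F2 x) k) (monom 1 (k - d) * F1 x))"
    have "constructible (sol ((d, F1') # (d2, F2) # R))"
      by (rule IH) (use fam size Suc in \<open>auto simp: F1'_def intro: poly_family_remove_top\<close>)
    moreover have "constructible (sol ((d1, F1) # (k, F2') # R))"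
      by (rule IH) (use fam size Suc k in \<open>auto simp: F2'_def intro: poly_family_reduce\<close>)
    moreover have "constructible (\<lambda>x. coeff (F1 x) d = 0)"
      using fam(1) by (auto simp: poly_family_def intro: constructible.zero)
    ultimately have "constructible (\<lambda>x. coeff (F1 x) d = 0 \<and> sol ((d, F1') # (d2, F2) # R) x \<or>
        coeff (F1 x) d \<noteq> 0 \<and> sol ((d1, F1) # (k, F2') # R) x)"
      by (intro constructible_disj constructible.conj constructible.neg)
    moreover have "sol ((d1, F1) # (d2, F2) # R) x \<longleftrightarrow>
        coeff (F1 x) d = 0 \<and> sol ((d, F1') # (d2, F2) # R) x \<or>
        coeff (F1 x) d \<noteq> 0 \<and> sol ((d1, F1) # (k, F2') # R) x" for x
    proof (cases "coeff (F1 x) d = 0")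
      case True
      then show ?thesis by (simp add: sol_def F1'_def)
    next
      case False
      then have "poly (F1 x) t = 0 \<Longrightarrow> poly (F2' x) t = 0 \<longleftrightarrow> poly (F2 x) t = 0" for t
        by (simp add: F2'_def)
      then show ?thesis using False by (auto simp: sol_def)
    qed
    ultimately show ?thesis by presburger
  qed
  have "constructible (sol L)"
  proof (cases L)
    case Nil
    have "poly_family 0 (\<lambda>_ :: 'i \<Rightarrow> 'a. 0)" by (auto simp: poly_family_def intro: polynomial_fun.const)
    from constructible_single[OF this G] show ?thesis by (simp add: Nil sol_def)
  next
    case (Cons a L')
    obtain d1 F1 where a: "a = (d1, F1)" by force
    show ?thesis
    proof (cases L')
      case Nil
      then show ?thesis using constructible_single[OF _ G] less.prems Cons a by (simp add: sol_def)
    next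
      case (Cons b R)
      obtain d2 F2 where b: "b = (d2, F2)" by force
      have L: "L = (d1, F1) # (d2, F2) # R" using \<open>L = a # L'\<close> Cons a b by simp
      show ?thesis
      proof (cases "d1 \<le> d2")
        case True
        then show ?thesis using step[of d1 F1 d2 F2 R] less.prems L by simp
      next
        case False
        then have "constructible (sol ((d2, F2) # (d1, F1) # R))"
          using less.prems L by (intro step) auto
        moreover have "sol L = sol ((d2, F2) # (d1, F1) # R)"
          by (auto simp: sol_def L fun_eq_iff)
        ultimately show ?thesis by simp
      qed
    qed
  qed
  then show ?case by (simp add: sol_def)
qed

text \<open>Disjunctive normal form with respect to one variable \<open>t\<close> over the parameters \<open>x\<close>.\<close>

definition basic :: "(('i \<Rightarrow> 'a::comm_ring_1) \<Rightarrow> 'a \<Rightarrow> bool) \<Rightarrow> bool" where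
  "basic Q \<longleftrightarrow> (\<exists>D. finite D \<and>
     (\<forall>(L, e, G)\<in>D. (\<forall>(d, F)\<in>set L. poly_family d F) \<and> poly_family e G) \<and>
     (\<forall>x t. Q x t \<longleftrightarrow> (\<exists>(L, e, G)\<in>D. (\<forall>(d, F)\<in>set L. poly (F x) t = 0) \<and> poly (G x) t \<noteq> 0)))"

lemma basic_disj:
  assumes "basic Q" "basic Q'"
  shows "basic (\<lambda>x t. Q x t \<or> Q' x t)"
proof -
  obtain D where D: "finite D"
     "\<forall>(L, e, G)\<in>D. (\<forall>(d, F)\<in>set L. poly_family d F) \<and> poly_family e G"
     "\<And>x t. Q x t \<longleftrightarrow> (\<exists>(L, e, G)\<in>D. (\<forall>(d, F)\<in>set L. poly (F x) t = 0) \<and> poly (G x) t \<noteq> 0)"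
    using assms(1) unfolding basic_def by blast
  obtain D' where D': "finite D'"
     "\<forall>(L, e, G)\<in>D'. (\<forall>(d, F)\<in>set L. poly_family d F) \<and> poly_family e G"
     "\<And>x t. Q' x t \<longleftrightarrow> (\<exists>(L, e, G)\<in>D'. (\<forall>(d, F)\<in>set L. poly (F x) t = 0) \<and> poly (G x) t \<noteq> 0)"
    using assms(2) unfolding basic_def by blast
  show ?thesis
    unfolding basic_def
    by (rule exI[of _ "D \<union> D'"]) (use D D' in \<open>simp add: ball_Un bex_Un\<close>)
qed

lemma basic_conj:
  fixes Q :: "('i \<Rightarrow> 'a::field) \<Rightarrow> 'a \<Rightarrow> bool"
  assumes "basic Q" "basic Q'"
  shows "basic (\<lambda>x t. Q x t \<and> Q' x t)"
proof -
  obtain D where D: "finite D"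
     "\<forall>(L, e, G)\<in>D. (\<forall>(d, F)\<in>set L. poly_family d F) \<and> poly_family e G"
     "\<And>x t. Q x t \<longleftrightarrow> (\<exists>(L, e, G)\<in>D. (\<forall>(d, F)\<in>set L. poly (F x) t = 0) \<and> poly (G x) t \<noteq> 0)"
    using assms(1) unfolding basic_def by blast
  obtain D' where D': "finite D'"
     "\<forall>(L, e, G)\<in>D'. (\<forall>(d, F)\<in>set L. poly_family d F) \<and> poly_family e G"
     "\<And>x t. Q' x t \<longleftrightarrow> (\<exists>(L, e, G)\<in>D'. (\<forall>(d, F)\<in>set L. poly (F x) t = 0) \<and> poly (G x) t \<noteq> 0)"
    using assms(2) unfolding basic_def by blast
  \<comment> \<open>Equations are collected in one list, while inequations are multiplied: over a
    field both factors are nonzero exactly if the product is. Hence one inequation per disjunct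
    suffices.\<close>
  define both where "both = (\<lambda>(L, e :: nat, G) (L', e', G').
    (L @ L' :: (nat \<times> (('i \<Rightarrow> 'a) \<Rightarrow> 'a poly)) list, e + e', \<lambda>x :: 'i \<Rightarrow> 'a. G x * G' x :: 'a poly))"
  show ?thesis
    unfolding basic_def
  proof (intro exI[of _ "(\<lambda>(c, c'). both c c') ` (D \<times> D')"] conjI allI)
    show "finite ((\<lambda>(c, c'). both c c') ` (D \<times> D'))" using D D' by simp
    show "\<forall>(L, e, G)\<in>(\<lambda>(c, c'). both c c') ` (D \<times> D').
        (\<forall>(d, F)\<in>set L. poly_family d F) \<and> poly_family e G"
    proof (intro ballI)
      fix c assume "c \<in> (\<lambda>(c, c'). both c c') ` (D \<times> D')"
      then obtain L e G L' e' G' where *: "(L, e, G) \<in> D" "(L', e', G') \<in> D'"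
        "c = both (L, e, G) (L', e', G')" by auto
      then show "case c of (L, e, G) \<Rightarrow> (\<forall>(d, F)\<in>set L. poly_family d F) \<and> poly_family e G"
        using bspec[OF D(2) *(1)] bspec[OF D'(2) *(2)]
        by (auto simp: both_def intro: poly_family_mult)
    qed
    fix x t
    show "(Q x t \<and> Q' x t) \<longleftrightarrow> (\<exists>(L, e, G)\<in>(\<lambda>(c, c'). both c c') ` (D \<times> D').
        (\<forall>(d, F)\<in>set L. poly (F x) t = 0) \<and> poly (G x) t \<noteq> 0)"
      unfolding D(3) D'(3) by (simp add: both_def split_beta ball_Un bex_simps) blast
  qed
qed

text \<open>P and its negation are treated together, so that the case of a negation merely swaps the
  two claims and no normal form has to be negated.\<close>

lemma basic_constructible:
  fixes P :: "('i \<Rightarrow> 'a::field) \<Rightarrow> bool"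
  assumes "constructible P"
  shows "basic (\<lambda>x t. P (x(i := t))) \<and> basic (\<lambda>x t. \<not> P (x(i := t)))"
  using assms
proof induction
  case (zero p)
  obtain d F where F: "poly_family d F" "\<And>x t. p (x(i := t)) = poly (F x) t"
    using polynomial_fun_upd[OF zero] by blast
  have one: "poly_family 1 (\<lambda>_ :: 'i \<Rightarrow> 'a. 1)"
    using poly_family_const[of 1] by (simp flip: one_pCons)
  have "basic (\<lambda>x t. p (x(i := t)) = 0)"
    unfolding basic_def by (rule exI[of _ "{([(d, F)], 1, \<lambda>_. 1)}"]) (use F one in simp)
  moreover have "basic (\<lambda>x t. p (x(i := t)) \<noteq> 0)"
    unfolding basic_def by (rule exI[of _ "{([], d, F)}"]) (use F in simp)
  ultimately show ?case by blast
next
  case (neg P)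
  then show ?case by simp
next
  case (conj P Q)
  then have "basic (\<lambda>x t. P (x(i := t)) \<and> Q (x(i := t)))"
    "basic (\<lambda>x t. \<not> P (x(i := t)) \<or> \<not> Q (x(i := t)))"
    using basic_conj basic_disj by blast+
  then show ?case by (simp only: de_Morgan_conj simp_thms)
qed

text \<open>The existential quantifier distributes over the disjuncts of the normal form, and each
  disjunct is a system of equations with one inequation.\<close>

lemma constructible_ex:
  fixes P :: "('i \<Rightarrow> 'a::alg_closed_field) \<Rightarrow> bool"
  assumes "constructible P"
  shows "constructible (\<lambda>x. \<exists>t. P (x(i := t)))"
proof -
  obtain D where D: "finite D"
     "\<forall>(L, e, G)\<in>D. (\<forall>(d, F)\<in>set L. poly_family d F) \<and> poly_family e G"
     "\<And>x t. P (x(i := t)) \<longleftrightarrow> (\<exists>(L, e, G)\<in>D. (\<forall>(d, F)\<in>set L. poly (F x) t = 0) \<and> poly (G x) t \<noteq> 0)"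
    using conjunct1[OF basic_constructible[OF assms, of i]] unfolding basic_def by blast
  have "constructible (\<lambda>x. \<exists>c\<in>D. \<exists>t. (\<forall>(d, F)\<in>set (fst c). poly (F x) t = 0) \<and> poly (snd (snd c) x) t \<noteq> 0)"
  proof (rule constructible_bex[OF D(1)])
    fix c assume c: "c \<in> D"
    obtain L e G where "c = (L, e, G)" using prod_cases3 by blast
    then show "constructible (\<lambda>x. \<exists>t. (\<forall>(d, F)\<in>set (fst c). poly (F x) t = 0) \<and> poly (snd (snd c) x) t \<noteq> 0)"
      using constructible_system[of L e G] bspec[OF D(2) c] by auto
  qed
  moreover have "(\<exists>t. P (x(i := t))) \<longleftrightarrow>
    (\<exists>c\<in>D. \<exists>t. (\<forall>(d, F)\<in>set (fst c). poly (F x) t = 0) \<and> poly (snd (snd c) x) t \<noteq> 0)" for x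
    unfolding D(3) by (auto simp: split_beta)
  ultimately show ?thesis by presburger
qed

lemma constructible_ex_finite:
  fixes P :: "('i \<Rightarrow> 'a::alg_closed_field) \<Rightarrow> bool"
  assumes "finite I" "constructible P"
  shows "constructible (\<lambda>x. \<exists>y. P (\<lambda>i. if i \<in> I then y i else x i))"
  using assms(1)
proof (induction I rule: finite_induct)
  case empty
  then show ?case using assms(2) by simp
next
  case (insert i I)
  have "(\<exists>y. P (\<lambda>j. if j \<in> insert i I then y j else x j)) \<longleftrightarrow>
      (\<exists>t y. P (\<lambda>j. if j \<in> I then y j else (x(i := t)) j))" for x
  proof
    assume "\<exists>y. P (\<lambda>j. if j \<in> insert i I then y j else x j)"
    then obtain y where y: "P (\<lambda>j. if j \<in> insert i I then y j else x j)" by blast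
    have "(\<lambda>j. if j \<in> insert i I then y j else x j) = (\<lambda>j. if j \<in> I then y j else (x(i := y i)) j)"
      by auto
    then show "\<exists>t y. P (\<lambda>j. if j \<in> I then y j else (x(i := t)) j)" using y by metis
  next
    assume "\<exists>t y. P (\<lambda>j. if j \<in> I then y j else (x(i := t)) j)"
    then obtain t y where ty: "P (\<lambda>j. if j \<in> I then y j else (x(i := t)) j)" by blast
    have "(\<lambda>j. if j \<in> I then y j else (x(i := t)) j) =
        (\<lambda>j. if j \<in> insert i I then (y(i := t)) j else x j)"
      using insert by auto
    then show "\<exists>y. P (\<lambda>j. if j \<in> insert i I then y j else x j)" using ty by metis
  qed
  then show ?case using constructible_ex[OF insert.IH, of i] by presburger
qed

section \<open>Monomials\<close>

abbreviation "lookup \<equiv> Poly_Mapping.lookup"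
abbreviation "keys \<equiv> Poly_Mapping.keys"

definition mon :: "('p \<Rightarrow>\<^sub>0 nat) \<Rightarrow> ('p \<Rightarrow> 'a::comm_ring_1) \<Rightarrow> 'a" where
  "mon m x = (\<Prod>i\<in>keys m. x i ^ lookup m i)"

lemma mon_eq: "finite P \<Longrightarrow> keys m \<subseteq> P \<Longrightarrow> mon m x = (\<Prod>i\<in>P. x i ^ lookup m i)"
  unfolding mon_def by (rule prod.mono_neutral_left) (auto simp: in_keys_iff)

lemma mon_add: "mon (m + m') x = mon m x * mon m' x"
proof -
  let ?P = "keys m \<union> keys m'"
  have "keys (m + m') \<subseteq> ?P" by (rule keys_add)
  then show ?thesis
    by (simp add: mon_eq[of ?P] lookup_add power_add prod.distrib)
qed

lemma mon_single: "mon (Poly_Mapping.single i k) x = x i ^ k"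
  by (simp add: mon_eq[of "{i}"])

lemma mon_cong: "(\<And>i. i \<in> keys m \<Longrightarrow> x i = y i) \<Longrightarrow> mon m x = mon m y"
  unfolding mon_def by (auto intro: prod.cong)

lemma polynomial_fun_mon:
  "(\<And>i. polynomial_fun (\<lambda>x. f i x)) \<Longrightarrow> polynomial_fun (\<lambda>x. mon m (\<lambda>i. f i x))"
  unfolding mon_def by (intro polynomial_fun_intros)

text \<open>Each exponent is bounded separately, instead of the total degree. This gives the set a
  product structure, from which one variable can be split off, and its exact size.\<close>

definition box :: "'p set \<Rightarrow> nat \<Rightarrow> ('p \<Rightarrow>\<^sub>0 nat) set" where
  "box P d = {m. keys m \<subseteq> P \<and> (\<forall>i. lookup m i \<le> d)}"

lemma box_empty: "box {} d = {0}"
  by (auto simp: box_def)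

lemma bij_betw_box_insert:
  assumes "i \<notin> P"
  shows "bij_betw (\<lambda>(k, m). m + Poly_Mapping.single i k) ({..d} \<times> box P d) (box (insert i P) d)"
proof (rule bij_betwI[where g = "\<lambda>m. (lookup m i, Poly_Mapping.update i 0 m)"])
  show "(\<lambda>(k, m). m + Poly_Mapping.single i k) \<in> {..d} \<times> box P d \<rightarrow> box (insert i P) d"
  proof safe
    fix k m assume "m \<in> box P d" "k \<le> d"
    moreover from this have "lookup m i = 0" using assms by (auto simp: box_def in_keys_iff)
    ultimately show "m + Poly_Mapping.single i k \<in> box (insert i P) d"
      by (auto simp: box_def lookup_add lookup_single when_def in_keys_iff subset_iff split: if_splits)
  qed
  show "(\<lambda>m. (lookup m i, Poly_Mapping.update i 0 m)) \<in> box (insert i P) d \<rightarrow> {..d} \<times> box P d"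
    by (auto simp: box_def lookup_update in_keys_iff subset_iff split: if_splits) metis
next
  fix km assume "km \<in> {..d} \<times> box P d"
  then obtain k m where km: "km = (k, m)" "m \<in> box P d" by auto
  have "lookup m i = 0" using km assms by (auto simp: box_def in_keys_iff)
  moreover have "Poly_Mapping.update i 0 (m + Poly_Mapping.single i k) = m"
    by (rule poly_mapping_eqI)
      (use \<open>lookup m i = 0\<close> in \<open>auto simp: lookup_update lookup_add lookup_single when_def\<close>)
  ultimately show "(\<lambda>m. (lookup m i, Poly_Mapping.update i 0 m)) ((\<lambda>(k, m). m + Poly_Mapping.single i k) km) = km"
    by (simp add: km lookup_add)
next
  fix m assume "m \<in> box (insert i P) d"
  show "(\<lambda>(k, m). m + Poly_Mapping.single i k) (lookup m i, Poly_Mapping.update i 0 m) = m"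
    by (auto intro!: poly_mapping_eqI simp: lookup_update lookup_add lookup_single when_def)
qed

lemma finite_card_box:
  assumes "finite P"
  shows "finite (box P d) \<and> card (box P d) = Suc d ^ card P"
  using assms
proof (induction P rule: finite_induct)
  case empty
  then show ?case by (simp add: box_empty)
next
  case (insert i P)
  note bij = bij_betw_box_insert[OF insert.hyps(2), of d]
  show ?case
    using bij_betw_finite[OF bij] bij_betw_same_card[OF bij] insert
    by (simp add: card_cartesian_product)
qed

lemmas finite_box = conjunct1[OF finite_card_box]
lemmas card_box = conjunct2[OF finite_card_box]

lemma box_mono: "d \<le> e \<Longrightarrow> box P d \<subseteq> box P e"
  by (auto simp: box_def intro: order_trans)

lemma box_add: "m \<in> box P d \<Longrightarrow> m' \<in> box P e \<Longrightarrow> m + m' \<in> box P (d + e)"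
  using keys_add[of m m'] by (auto simp: box_def lookup_add intro: add_mono)

text \<open>For fixed values of the other variables the sum is a univariate polynomial in x i with
  infinitely many roots. Its coefficients therefore vanish for all those values, and they are sums
  of the same kind with one variable less.\<close>

lemma mon_independent:
  fixes c :: "('p \<Rightarrow>\<^sub>0 nat) \<Rightarrow> 'a::field"
  assumes inf: "infinite (UNIV :: 'a set)" and "finite P"
    and "\<And>x. (\<Sum>m\<in>box P d. c m * mon m x) = 0" "m \<in> box P d"
  shows "c m = 0"
  using assms(2-)
proof (induction P arbitrary: c m rule: finite_induct)
  case empty
  from empty(1)[of undefined] empty(2) show ?case by (simp add: box_empty mon_def)
next
  case (insert i P)
  have z: "(\<Sum>m\<in>box P d. c (m + Poly_Mapping.single i k) * mon m x) = 0" if "k \<le> d" for k x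
  proof -
    define p where "p = (\<Sum>k\<le>d. monom (\<Sum>m\<in>box P d. c (m + Poly_Mapping.single i k) * mon m x) k)"
    have "poly p t = 0" for t
    proof -
      have "0 = (\<Sum>m\<in>box (insert i P) d. c m * mon m (x(i := t)))" using insert.prems(1) by simp
      also have "\<dots> = (\<Sum>(k, m)\<in>{..d} \<times> box P d.
          c (m + Poly_Mapping.single i k) * mon (m + Poly_Mapping.single i k) (x(i := t)))"
        by (subst sum.reindex_bij_betw[OF bij_betw_box_insert[OF insert.hyps(2)], symmetric])
          (simp add: split_beta)
      also have "\<dots> = (\<Sum>(k, m)\<in>{..d} \<times> box P d. c (m + Poly_Mapping.single i k) * mon m x * t ^ k)"
      proof (rule sum.cong)
        fix km assume "km \<in> {..d} \<times> box P d"
        then obtain k m where km: "km = (k, m)" "keys m \<subseteq> P" by (auto simp: box_def)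
        then have "mon m (x(i := t)) = mon m x" using insert.hyps(2) by (intro mon_cong) auto
        then show "(case km of (k, m) \<Rightarrow> c (m + Poly_Mapping.single i k) * mon (m + Poly_Mapping.single i k) (x(i := t))) =
            (case km of (k, m) \<Rightarrow> c (m + Poly_Mapping.single i k) * mon m x * t ^ k)"
          by (simp add: km mon_add mon_single)
      qed simp
      also have "\<dots> = poly p t"
        by (simp add: p_def poly_sum poly_monom sum.cartesian_product sum_distrib_right)
      finally show ?thesis by simp
    qed
    then have "p = 0" using inf poly_roots_finite[of p] by auto
    moreover have "coeff p k = (\<Sum>m\<in>box P d. c (m + Poly_Mapping.single i k) * mon m x)"
      using that by (simp add: p_def coeff_sum sum.delta')
    ultimately show ?thesis by simp
  qed
  obtain k m' where "m = m' + Poly_Mapping.single i k" "k \<le> d" "m' \<in> box P d"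
    using insert.prems(2) bij_betw_imp_surj_on[OF bij_betw_box_insert[OF insert.hyps(2), of d]]
    by force
  then show ?case using insert.IH[OF z] by simp
qed

section \<open>Polynomials in x whose coefficients are polynomial functions of a parameter T\<close>

definition expands ::
  "'p set \<Rightarrow> nat \<Rightarrow> (('i \<Rightarrow> 'a::comm_ring_1) \<Rightarrow> ('p \<Rightarrow> 'a) \<Rightarrow> 'a) \<Rightarrow> bool" where
  "expands P d F \<longleftrightarrow> (\<exists>c. (\<forall>m. polynomial_fun (c m)) \<and>
     (\<forall>T x. F T x = (\<Sum>m\<in>box P d. c m T * mon m x)))"

lemma expands_term:
  assumes "finite P" "m \<in> box P d" "polynomial_fun a"
  shows "expands P d (\<lambda>T x. a T * mon m x)"
proof -
  have "a T * mon m x = (\<Sum>m'\<in>box P d. (if m' = m then a T else 0) * mon m' x)" for T x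
    using assms finite_box[OF assms(1), of d] by (simp add: if_distrib[of "\<lambda>z. z * _"] sum.delta cong: if_cong)
  then show ?thesis
    unfolding expands_def using assms(3)
    by (intro exI[of _ "\<lambda>m' T. if m' = m then a T else 0"]) (auto intro: polynomial_fun_intros)
qed

lemma expands_zero: "expands P d (\<lambda>T x. 0)"
  unfolding expands_def by (intro exI[of _ "\<lambda>_ _. 0"]) (auto intro: polynomial_fun.intros)

lemma expands_add:
  assumes "expands P d F" "expands P d G"
  shows "expands P d (\<lambda>T x. F T x + G T x)"
proof -
  obtain b c where "\<forall>m. polynomial_fun (b m)" "\<forall>T x. F T x = (\<Sum>m\<in>box P d. b m T * mon m x)"
    "\<forall>m. polynomial_fun (c m)" "\<forall>T x. G T x = (\<Sum>m\<in>box P d. c m T * mon m x)"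
    using assms unfolding expands_def by blast
  then show ?thesis
    unfolding expands_def
    by (intro exI[of _ "\<lambda>m T. b m T + c m T"])
      (auto intro: polynomial_fun_intros simp: ring_distribs sum.distrib)
qed

lemma expands_sum:
  "(\<And>s. s \<in> S \<Longrightarrow> expands P d (F s)) \<Longrightarrow> expands P d (\<lambda>T x. \<Sum>s\<in>S. F s T x)"
  by (induction S rule: infinite_finite_induct) (auto intro: expands_zero expands_add)

lemma expands_mult:
  assumes P: "finite P" and "expands P d F" "expands P e G"
  shows "expands P (d + e) (\<lambda>T x. F T x * G T x)"
proof -
  obtain b c where *: "\<forall>m. polynomial_fun (b m)" "\<forall>T x. F T x = (\<Sum>m\<in>box P d. b m T * mon m x)"
    "\<forall>m. polynomial_fun (c m)" "\<forall>T x. G T x = (\<Sum>m\<in>box P e. c m T * mon m x)"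
    using assms unfolding expands_def by blast
  have "F T x * G T x = (\<Sum>m\<in>box P d. \<Sum>m'\<in>box P e. (b m T * c m' T) * mon (m + m') x)" for T x
    by (simp add: * sum_product mon_add mult_ac)
  moreover have "expands P (d + e) (\<lambda>T x. \<Sum>m\<in>box P d. \<Sum>m'\<in>box P e. (b m T * c m' T) * mon (m + m') x)"
    using * by (intro expands_sum expands_term P box_add) (auto intro: polynomial_fun_intros)
  ultimately show ?thesis by presburger
qed

lemma expands_mono:
  assumes P: "finite P" and "expands P d F" "d \<le> e"
  shows "expands P e F"
proof -
  obtain c where *: "\<forall>m. polynomial_fun (c m)" "\<forall>T x. F T x = (\<Sum>m\<in>box P d. c m T * mon m x)"
    using assms unfolding expands_def by blast
  have "expands P e (\<lambda>T x. \<Sum>m\<in>box P d. c m T * mon m x)"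
    using * box_mono[OF \<open>d \<le> e\<close>, of P] by (intro expands_sum expands_term P) auto
  then show ?thesis using *(2) by presburger
qed

lemma expands_const:
  assumes "finite P" "polynomial_fun a"
  shows "expands P d (\<lambda>T x. a T)"
proof -
  have "expands P d (\<lambda>T x. a T * mon 0 x)"
    by (rule expands_term) (use assms in \<open>auto simp: box_def\<close>)
  then show ?thesis by (simp add: mon_def)
qed

lemma polynomial_fun_expands:
  fixes F :: "('i + 'p \<Rightarrow> 'a::comm_ring_1) \<Rightarrow> 'a"
  assumes P: "finite P" and "polynomial_fun F"
  shows "\<exists>d. expands P d (\<lambda>T x. F (case_sum T (\<lambda>p. if p \<in> P then x p else 0)))"
  using assms(2)
proof induction
  case (const c)
  then show ?case by (intro exI[of _ 0] expands_const P polynomial_fun.const)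
next
  case (coord k)
  show ?case
  proof (cases k)
    case (Inl i)
    then show ?thesis using expands_const[OF P polynomial_fun.coord, of 0 i] by auto
  next
    case (Inr p)
    show ?thesis
    proof (cases "p \<in> P")
      case True
      have "expands P 1 (\<lambda>T x. 1 * mon (Poly_Mapping.single p 1) x)"
        using True by (intro expands_term P polynomial_fun.const) (auto simp: box_def lookup_single when_def)
      then show ?thesis using True Inr by (auto simp: mon_single)
    next
      case False
      then show ?thesis using Inr expands_zero by auto
    qed
  qed
next
  case (add F G)
  then obtain d e where
    d: "expands P d (\<lambda>T x. F (case_sum T (\<lambda>p. if p \<in> P then x p else 0)))" and
    e: "expands P e (\<lambda>T x. G (case_sum T (\<lambda>p. if p \<in> P then x p else 0)))" by blast
  show ?case
    by (intro exI[of _ "max d e"] expands_add expands_mono[OF P d] expands_mono[OF P e]) auto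
next
  case (mult F G)
  then show ?case using expands_mult[OF P] by fast
qed

section \<open>Specialization of leading monomials\<close>

text \<open>The leading monomial over the ring of coefficient functions: its coefficient is nonzero
  as a function of the parameter but may vanish at particular points. That is exactly what can go
  wrong under specialization.\<close>

definition leads :: "('m::linorder \<Rightarrow> 'x \<Rightarrow> 'a::zero) \<Rightarrow> 'm \<Rightarrow> bool" where
  "leads f m \<longleftrightarrow> (\<exists>x. f m x \<noteq> 0) \<and> (\<forall>m'>m. \<forall>x. f m' x = 0)"

lemma leads_exists:
  assumes "finite {m. \<exists>x. f m x \<noteq> 0}" "f m x \<noteq> 0"
  shows "\<exists>M\<ge>m. leads f M"
proof -
  let ?S = "{m. \<exists>x. f m x \<noteq> 0}"
  have ne: "?S \<noteq> {}" using assms(2) by auto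
  have "Max ?S \<in> ?S" using Max_in[OF assms(1) ne] .
  moreover have "\<forall>m'>Max ?S. \<forall>x. f m' x = 0"
    using Max_ge[OF assms(1)] by (metis (mono_tags, lifting) mem_Collect_eq not_le)
  moreover have "m \<le> Max ?S" using assms by (intro Max_ge) auto
  ultimately show ?thesis unfolding leads_def by blast
qed

text \<open>
  Let \<open>N\<close> be a module of polynomials whose coefficients depend on a parameter \<open>x\<close>, such that every
  leading monomial of \<open>N\<close> is attained with the same leading coefficient \<open>h\<close>. At a point \<open>x0\<close> where
  \<open>h\<close> does not vanish, specialization creates no new leading monomials: an element whose leading
  coefficient vanishes at \<open>x0\<close> can be reduced without changing its value at \<open>x0\<close> up to a factor.
\<close>

locale leading_module =
  fixes N :: "('m::linorder \<Rightarrow> 'x \<Rightarrow> 'a::field) set" and R :: "('x \<Rightarrow> 'a) set"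
    and D :: "'m set" and h :: "'x \<Rightarrow> 'a"
  assumes finite_support: "f \<in> N \<Longrightarrow> finite {m. \<exists>x. f m x \<noteq> 0}"
    and support: "f \<in> N \<Longrightarrow> f m x \<noteq> 0 \<Longrightarrow> m \<in> D"
    and coeffs: "f \<in> N \<Longrightarrow> f m \<in> R"
    and const: "(\<lambda>_. c) \<in> R"
    and h: "h \<in> R"
    and comb: "f \<in> N \<Longrightarrow> g \<in> N \<Longrightarrow> a \<in> R \<Longrightarrow> b \<in> R \<Longrightarrow> (\<lambda>m x. a x * f m x - b x * g m x) \<in> N"
    and wf: "wf {(m, m'). m < m' \<and> m \<in> D \<and> m' \<in> D}"
    and lead: "f \<in> N \<Longrightarrow> leads f m \<Longrightarrow> \<exists>g\<in>N. leads g m \<and> g m = h"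
begin

lemma leads_mem: "f \<in> N \<Longrightarrow> leads f m \<Longrightarrow> m \<in> D"
  using support unfolding leads_def by blast

lemma lead_specialize:
  assumes h0: "h x0 \<noteq> 0" and "f \<in> N" "f m x0 \<noteq> 0" "\<And>m'. m' > m \<Longrightarrow> f m' x0 = 0"
  shows "\<exists>g\<in>N. leads g m \<and> g m = h"
proof -
  obtain M where "leads f M" using leads_exists[OF finite_support] assms(2,3) by blast
  then show ?thesis
    using assms(2-4)
  proof (induction M arbitrary: f rule: wf_induct_rule[OF wf])
    case (1 M)
    show ?case
    proof (cases "m = M")
      case True
      then show ?thesis using lead 1 by blast
    next
      case False
      have "m \<le> M" using 1(2,4) unfolding leads_def by (metis not_le)
      then have "m < M" using False by simp
      obtain g where g: "g \<in> N" "leads g M" "g M = h" using lead[OF 1(3,2)] by blast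
      define f' where "f' = (\<lambda>m x. h x * f m x - f M x * g m x)"
      have f': "f' \<in> N" unfolding f'_def using 1(3) g(1) by (intro comb h coeffs)
      have "f M x0 = 0" using 1(5) \<open>m < M\<close> by blast
      then have val: "f' m' x0 = h x0 * f m' x0" for m' by (simp add: f'_def)
      have top: "f' m' x = 0" if "M \<le> m'" for m' x
        using that 1(2) g by (cases "m' = M") (auto simp: f'_def leads_def)
      have "f' m x0 \<noteq> 0" using val h0 1(4) by simp
      then obtain M' where M': "leads f' M'" using leads_exists[OF finite_support[OF f']] by blast
      then have "M' < M" using top unfolding leads_def by (metis not_le)
      then have "(M', M) \<in> {(m, m'). m < m' \<and> m \<in> D \<and> m' \<in> D}"
        using leads_mem M' f' 1(2,3) by blast
      then show ?thesis
        by (rule 1(1)[OF _ M' f' \<open>f' m x0 \<noteq> 0\<close>]) (use val 1(5) in simp)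
    qed
  qed
qed

text \<open>Elimination survives specialization: if the value of f at \<open>x0\<close> involves
  only monomials of Y, it is a linear combination of values at \<open>x0\<close> of elements of N
  supported entirely in Y. This is the division algorithm at \<open>x0\<close>. The leading monomial
  of the value lies in Y and, by \<open>lead_specialize\<close>, is attained by some g in N; since Y
  is closed downwards, all of g lies in Y, and subtracting a multiple of g lowers the leading
  monomial. E is any property that such combinations preserve.\<close>

lemma specialize_induct:
  assumes h0: "h x0 \<noteq> 0" and f: "f \<in> N" "\<And>m. f m x0 \<noteq> 0 \<Longrightarrow> m \<in> Y"
    and Y: "\<And>m m'. m \<in> Y \<Longrightarrow> m' < m \<Longrightarrow> m' \<in> D \<Longrightarrow> m' \<in> Y"
    and E0: "E (\<lambda>_. 0)"
    and E1: "\<And>u g c. E u \<Longrightarrow> g \<in> N \<Longrightarrow> (\<And>m x. g m x \<noteq> 0 \<Longrightarrow> m \<in> Y) \<Longrightarrow> E (\<lambda>m. u m + c * g m x0)"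
  shows "E (\<lambda>m. f m x0)"
proof (cases "\<exists>m. f m x0 \<noteq> 0")
  case False
  then show ?thesis using E0 by simp
next
  case True
  have ex: "\<exists>m. f m x0 \<noteq> 0 \<and> (\<forall>m'>m. f m' x0 = 0)" if "f \<in> N" "f m x0 \<noteq> 0" for f m
    using leads_exists[of "\<lambda>m (_::unit). f m x0" m "()"] that
      finite_subset[OF _ finite_support[OF that(1)], of "{m. f m x0 \<noteq> 0}"]
    by (auto simp: leads_def)
  obtain m where m: "f m x0 \<noteq> 0" "\<And>m'. m' > m \<Longrightarrow> f m' x0 = 0" using ex[OF f(1)] True by blast
  show ?thesis
    using m f
  proof (induction m arbitrary: f rule: wf_induct_rule[OF wf])
    case (1 m)
    obtain g where g: "g \<in> N" "leads g m" "g m = h" using lead_specialize[OF h0 1(4,2,3)] by blast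
    define c where "c = f m x0 / h x0"
    define f' where "f' = (\<lambda>m x. 1 * f m x - c * g m x)"
    have f': "f' \<in> N" unfolding f'_def using 1(4) g(1) by (intro comb const)
    have "m \<in> Y" using 1(2,5) by blast
    have gY: "m' \<in> Y" if "g m' x \<noteq> 0" for m' x
    proof -
      have "\<not> m < m'" using that g(2) by (auto simp: leads_def)
      then show ?thesis using Y[OF \<open>m \<in> Y\<close>, of m'] support[OF g(1) that] \<open>m \<in> Y\<close>
        by (cases "m' = m") auto
    qed
    have top: "f' m' x0 = 0" if "m \<le> m'" for m'
      using that 1(3) g h0 by (cases "m' = m") (auto simp: f'_def leads_def c_def)
    have f'Y: "m' \<in> Y" if "f' m' x0 \<noteq> 0" for m'
      using that 1(5)[of m'] gY[of m' x0] by (cases "f m' x0 = 0") (auto simp: f'_def)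
    have "E (\<lambda>m. f' m x0)"
    proof (cases "\<exists>m. f' m x0 \<noteq> 0")
      case False
      then show ?thesis using E0 by simp
    next
      case True
      then obtain m' where m': "f' m' x0 \<noteq> 0" "\<And>m''. m'' > m' \<Longrightarrow> f' m'' x0 = 0"
        using ex[OF f'] by blast
      then have "m' < m" using top by (metis not_le)
      then have "(m', m) \<in> {(m, m'). m < m' \<and> m \<in> D \<and> m' \<in> D}"
        using support m'(1) f' 1(2,4) by blast
      then show ?thesis by (rule 1(1)[OF _ m' f' f'Y])
    qed
    then have "E (\<lambda>m. f' m x0 + c * g m x0)" by (rule E1) (use g(1) gY in auto)
    then show ?case by (simp add: f'_def)
  qed
qed

end

text \<open>Forget the exponent of i and take finitely many elements B of L that are minimal in the
  remaining exponents. With K bounding the exponent of i in B, monomials whose exponent of i is at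
  least K are dominated by B. Each of the finitely many layers with exponent k < K gets a basis of
  its own.\<close>

lemma dickson:
  assumes "finite P" "L \<subseteq> {m :: 'p \<Rightarrow>\<^sub>0 nat. keys m \<subseteq> P}"
  shows "\<exists>B. finite B \<and> B \<subseteq> L \<and> (\<forall>m\<in>L. \<exists>b\<in>B. \<forall>i. lookup b i \<le> lookup m i)"
  using assms
proof (induction P arbitrary: L rule: finite_induct)
  case empty
  then have "L \<subseteq> {0}" by auto
  then show ?case by (intro exI[of _ L]) (auto intro: finite_subset)
next
  case (insert i P)
  define pr where "pr = (\<lambda>m :: 'p \<Rightarrow>\<^sub>0 nat. Poly_Mapping.update i 0 m)"
  have pr: "lookup (pr m) j = (if j = i then 0 else lookup m j)" for m j
    by (simp add: pr_def lookup_update)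
  have base: "\<exists>B. finite B \<and> B \<subseteq> L' \<and> (\<forall>m\<in>L'. \<exists>b\<in>B. \<forall>j. lookup (pr b) j \<le> lookup (pr m) j)"
    if "L' \<subseteq> L" for L'
  proof -
    have "keys (pr m) \<subseteq> P" if "m \<in> L'" for m
    proof -
      have "keys m \<subseteq> insert i P" using that insert.prems \<open>L' \<subseteq> L\<close> by blast
      then show ?thesis by (auto simp: in_keys_iff pr subset_iff)
    qed
    then have "pr ` L' \<subseteq> {m. keys m \<subseteq> P}" by auto
    from insert.IH[OF this] obtain B where B: "finite B" "B \<subseteq> pr ` L'"
      "\<forall>m\<in>pr ` L'. \<exists>b\<in>B. \<forall>i. lookup b i \<le> lookup m i" by blast
    obtain C where "C \<subseteq> L'" "finite C" "B = pr ` C" using finite_subset_image[OF B(1,2)] by blast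
    then show ?thesis using B(3) by (intro exI[of _ C]) auto
  qed
  from base[of L] obtain B where B: "finite B" "B \<subseteq> L"
    "\<forall>m\<in>L. \<exists>b\<in>B. \<forall>j. lookup (pr b) j \<le> lookup (pr m) j" by blast
  define K where "K = (\<Sum>b\<in>B. lookup b i)"
  have K: "lookup b i \<le> K" if "b \<in> B" for b
    unfolding K_def using that B(1) by (intro member_le_sum) auto
  have "\<forall>k. \<exists>B. finite B \<and> B \<subseteq> {m\<in>L. lookup m i = k} \<and>
      (\<forall>m\<in>{m\<in>L. lookup m i = k}. \<exists>b\<in>B. \<forall>j. lookup (pr b) j \<le> lookup (pr m) j)"
    by (intro allI base) auto
  from choice[OF this] obtain C where "\<forall>k. finite (C k) \<and> C k \<subseteq> {m\<in>L. lookup m i = k} \<and>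
      (\<forall>m\<in>{m\<in>L. lookup m i = k}. \<exists>b\<in>C k. \<forall>j. lookup (pr b) j \<le> lookup (pr m) j)" ..
  then have C: "\<And>k. finite (C k)" "\<And>k. C k \<subseteq> {m\<in>L. lookup m i = k}"
    "\<And>k. \<forall>m\<in>{m\<in>L. lookup m i = k}. \<exists>b\<in>C k. \<forall>j. lookup (pr b) j \<le> lookup (pr m) j"
    by simp_all
  show ?case
  proof (intro exI[of _ "B \<union> (\<Union>k<K. C k)"] conjI ballI)
    show "finite (B \<union> (\<Union>k<K. C k))" using B(1) C(1) by auto
    show "B \<union> (\<Union>k<K. C k) \<subseteq> L" using B(2) C(2) by blast
    fix m assume m: "m \<in> L"
    show "\<exists>b\<in>B \<union> (\<Union>k<K. C k). \<forall>j. lookup b j \<le> lookup m j"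
    proof (cases "lookup m i < K")
      case True
      then obtain b where b: "b \<in> C (lookup m i)" "\<forall>j. lookup (pr b) j \<le> lookup (pr m) j"
        using C(3)[of "lookup m i"] m by blast
      have "lookup b i = lookup m i" using C(2) b(1) by blast
      then have "\<forall>j. lookup b j \<le> lookup m j" using b(2) by (metis pr order_refl)
      then show ?thesis using b(1) True by blast
    next
      case False
      obtain b where b: "b \<in> B" "\<forall>j. lookup (pr b) j \<le> lookup (pr m) j" using B(3) m by blast
      have "lookup b i \<le> lookup m i" using K[OF b(1)] False by simp
      then have "\<forall>j. lookup b j \<le> lookup m j" using b(2) by (metis pr)
      then show ?thesis using b(1) by blast
    qed
  qed
qed

text \<open>The order is lexicographic with the smallest index most significant, so variables of
  small index are the ones it eliminates.\<close>

lemma less_poly_mapping_iff: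
  "(m :: 'p::linorder \<Rightarrow>\<^sub>0 nat) < m' \<longleftrightarrow>
     (\<exists>k. lookup m k < lookup m' k \<and> (\<forall>k'<k. lookup m k' = lookup m' k'))"
  by (simp add: less_poly_mapping.rep_eq less_fun_def)

text \<open>On n variables this is the lexicographic order on lists of length n. The bound on the
  variables is essential: the single variables of index 0, 1, 2, ... form an infinite descending
  chain.\<close>

lemma wf_monomials:
  "wf {(m, m' :: nat \<Rightarrow>\<^sub>0 nat). m < m' \<and> m \<in> {m. keys m \<subseteq> {..<n}} \<and> m' \<in> {m. keys m \<subseteq> {..<n}}}"
proof (rule wf_subset)
  let ?l = "\<lambda>m :: nat \<Rightarrow>\<^sub>0 nat. map (lookup m) [0..<n]"
  show "wf (inv_image (lex less_than) ?l)" by (intro wf_inv_image wf_lex wf_less_than)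
  show "{(m, m'). m < m' \<and> m \<in> {m. keys m \<subseteq> {..<n}} \<and> m' \<in> {m. keys m \<subseteq> {..<n}}}
      \<subseteq> inv_image (lex less_than) ?l"
  proof safe
    fix m m' :: "nat \<Rightarrow>\<^sub>0 nat"
    assume "m < m'" "keys m' \<subseteq> {..<n}"
    then obtain k where k: "lookup m k < lookup m' k" "\<forall>k'<k. lookup m k' = lookup m' k'"
      by (auto simp: less_poly_mapping_iff)
    then have "k \<in> keys m'" by (auto simp: in_keys_iff)
    then have "k < n" using \<open>keys m' \<subseteq> {..<n}\<close> by auto
    then have "[0..<n] = [0..<k] @ k # [Suc k..<n]"
      by (metis append_Cons le_add1 less_imp_add_positive upt_add_eq_append upt_conv_Cons zero_le less_imp_le_nat le_add_diff_inverse)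
    then have "?l m = map (lookup m') [0..<k] @ lookup m k # map (lookup m) [Suc k..<n]"
      "?l m' = map (lookup m') [0..<k] @ lookup m' k # map (lookup m') [Suc k..<n]"
      using k(2) by simp_all
    then show "(m, m') \<in> inv_image (lex less_than) ?l"
      using k(1) unfolding in_inv_image lex_conv by fastforce
  qed
qed

section \<open>Closures of images in families\<close>

text \<open>
  The ideal of the graph of \<open>x \<mapsto> \<phi> (T, x)\<close>, as a module over the polynomials in \<open>T\<close>. The variables
  are \<open>x\<close> (indices below \<open>N\<close>) followed by the coordinates of the target (indices from \<open>N\<close> on), so the
  lexicographic order eliminates \<open>x\<close>.
\<close>

locale image_family =
  fixes \<phi> :: "'j \<Rightarrow> ('i + nat \<Rightarrow> 'a::field) \<Rightarrow> 'a" and N M :: nat and J :: "'j set"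
    and e :: "nat \<Rightarrow> 'j" and y0 :: "'j \<Rightarrow> 'a"
  assumes inf: "infinite (UNIV :: 'a set)"
    and poly_\<phi>: "\<And>j. polynomial_fun (\<phi> j)"
    and dep_\<phi>: "\<And>j T x. \<phi> j (case_sum T x) = \<phi> j (case_sum T (\<lambda>p. if p < N then x p else 0))"
    and e: "bij_betw e {..<M} J"
    and off_\<phi>: "\<And>j z. j \<notin> J \<Longrightarrow> \<phi> j z = 0"
    and off_y0: "\<And>j. j \<notin> J \<Longrightarrow> y0 j = 0"
begin

definition im :: "('i \<Rightarrow> 'a) \<Rightarrow> ('j \<Rightarrow> 'a) set" where
  "im T = {(\<lambda>j. \<phi> j (case_sum T x)) | x. True}"

definition v :: "('i \<Rightarrow> 'a) \<Rightarrow> (nat \<Rightarrow> 'a) \<Rightarrow> nat \<Rightarrow> 'a" where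
  "v T x = (\<lambda>i. if i < N then x i else \<phi> (e (i - N)) (case_sum T x))"

text \<open>The first N entries are placeholders: the relations that get evaluated at this point
  involve only monomials of \<open>Y\<close>.\<close>

definition v0 :: "nat \<Rightarrow> 'a" where
  "v0 = (\<lambda>i. if i < N then 0 else y0 (e (i - N)))"

definition D :: "(nat \<Rightarrow>\<^sub>0 nat) set" where
  "D = {m. keys m \<subseteq> {..<N + M}}"

definition Y :: "(nat \<Rightarrow>\<^sub>0 nat) set" where
  "Y = {m \<in> D. \<forall>i<N. lookup m i = 0}"

definition graph :: "((nat \<Rightarrow>\<^sub>0 nat) \<Rightarrow> ('i \<Rightarrow> 'a) \<Rightarrow> 'a) set" where
  "graph = {g. (\<forall>m. polynomial_fun (g m)) \<and>
     (\<exists>S. finite S \<and> S \<subseteq> D \<and> (\<forall>m T. m \<notin> S \<longrightarrow> g m T = 0) \<and>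
       (\<forall>T x. (\<Sum>m\<in>S. g m T * mon m (v T x)) = 0))}"

lemma graphI:
  assumes "\<And>m. polynomial_fun (g m)" "finite S" "S \<subseteq> D" "\<And>m T. m \<notin> S \<Longrightarrow> g m T = 0"
    "\<And>T x. (\<Sum>m\<in>S. g m T * mon m (v T x)) = 0"
  shows "g \<in> graph"
  using assms unfolding graph_def by blast

lemma sum_superset:
  fixes g :: "(nat \<Rightarrow>\<^sub>0 nat) \<Rightarrow> 'a"
  assumes "finite S'" "S \<subseteq> S'" "\<And>m. m \<notin> S \<Longrightarrow> g m = 0"
  shows "(\<Sum>m\<in>S'. g m * mon m z) = (\<Sum>m\<in>S. g m * mon m z)"
  using assms by (intro sum.mono_neutral_right) auto

lemma graph_comb:
  assumes f: "f \<in> graph" and g: "g \<in> graph" and ab: "polynomial_fun a" "polynomial_fun b"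
  shows "(\<lambda>m x. a x * f m x - b x * g m x) \<in> graph"
proof -
  obtain S where S: "finite S" "S \<subseteq> D" "\<And>m T. m \<notin> S \<Longrightarrow> f m T = 0"
    "\<And>T x. (\<Sum>m\<in>S. f m T * mon m (v T x)) = 0" using f unfolding graph_def by blast
  obtain S' where S': "finite S'" "S' \<subseteq> D" "\<And>m T. m \<notin> S' \<Longrightarrow> g m T = 0"
    "\<And>T x. (\<Sum>m\<in>S'. g m T * mon m (v T x)) = 0" using g unfolding graph_def by blast
  show ?thesis
  proof (rule graphI[of _ "S \<union> S'"])
    show "polynomial_fun (\<lambda>x. a x * f m x - b x * g m x)" for m
      using f g ab by (intro polynomial_fun_intros) (auto simp: graph_def)
    fix T x
    have "(\<Sum>m\<in>S \<union> S'. (a T * f m T - b T * g m T) * mon m (v T x)) =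
        a T * (\<Sum>m\<in>S \<union> S'. f m T * mon m (v T x)) - b T * (\<Sum>m\<in>S \<union> S'. g m T * mon m (v T x))"
      by (simp add: sum_distrib_left sum_subtractf ring_distribs mult_ac)
    also have "(\<Sum>m\<in>S \<union> S'. f m T * mon m (v T x)) = (\<Sum>m\<in>S. f m T * mon m (v T x))"
      by (rule sum_superset) (use S S' in auto)
    also have "(\<Sum>m\<in>S \<union> S'. g m T * mon m (v T x)) = (\<Sum>m\<in>S'. g m T * mon m (v T x))"
      by (rule sum_superset) (use S S' in auto)
    finally show "(\<Sum>m\<in>S \<union> S'. (a T * f m T - b T * g m T) * mon m (v T x)) = 0"
      using S S' by simp
  qed (use S S' in auto)
qed

lemma graph_shift:
  assumes g: "g \<in> graph" and s: "s \<in> D" and lead: "leads g b"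
  shows "\<exists>g'\<in>graph. leads g' (b + s) \<and> g' (b + s) = g b"
proof -
  obtain S where S: "finite S" "S \<subseteq> D" "\<And>m T. m \<notin> S \<Longrightarrow> g m T = 0"
    "\<And>T x. (\<Sum>m\<in>S. g m T * mon m (v T x)) = 0" using g unfolding graph_def by blast
  \<comment> \<open>Subtraction of exponents truncates at 0, so it inverts the shift by s only on
    multiples of s; elsewhere the coefficient is 0.\<close>
  define g' where "g' = (\<lambda>m. if m \<in> range (\<lambda>m'. m' + s) then g (m - s) else (\<lambda>_. 0))"
  have g': "g' (m + s) = g m" for m by (simp add: g'_def)
  have "g' \<in> graph"
  proof (rule graphI[of _ "(\<lambda>m. m + s) ` S"])
    show "polynomial_fun (g' m)" for m
      using g by (auto simp: g'_def graph_def intro: polynomial_fun.const)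
    show "finite ((\<lambda>m. m + s) ` S)" using S by simp
    show "(\<lambda>m. m + s) ` S \<subseteq> D"
    proof safe
      fix m assume "m \<in> S"
      then have "keys m \<union> keys s \<subseteq> {..<N + M}" using S(2) s by (auto simp: D_def)
      then show "m + s \<in> D" using keys_add[of m s] by (auto simp: D_def)
    qed
    show "g' m T = 0" if m: "m \<notin> (\<lambda>m. m + s) ` S" for m T
    proof (cases "m \<in> range (\<lambda>m'. m' + s)")
      case True
      then obtain m' where m': "m = m' + s" by blast
      then have "m' \<notin> S" using m by blast
      then show ?thesis using S(3) by (simp add: m' g')
    qed (simp add: g'_def)
    fix T x
    have "(\<Sum>m\<in>(\<lambda>m. m + s) ` S. g' m T * mon m (v T x)) = (\<Sum>m\<in>S. g m T * mon m (v T x) * mon s (v T x))"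
      by (subst sum.reindex) (simp_all add: inj_on_def g' mon_add mult.assoc)
    also have "\<dots> = (\<Sum>m\<in>S. g m T * mon m (v T x)) * mon s (v T x)"
      by (rule sum_distrib_right[symmetric])
    also have "\<dots> = 0" by (simp only: S(4) mult_zero_left)
    finally show "(\<Sum>m\<in>(\<lambda>m. m + s) ` S. g' m T * mon m (v T x)) = 0" .
  qed
  moreover have "leads g' (b + s)"
    unfolding leads_def
  proof (intro conjI allI impI)
    show "\<exists>x. g' (b + s) x \<noteq> 0" using lead by (simp add: g' leads_def)
    fix m' x assume m': "b + s < m'"
    show "g' m' x = 0"
    proof (cases "m' \<in> range (\<lambda>m'. m' + s)")
      case True
      then obtain m'' where "m' = m'' + s" by blast
      then show ?thesis using m' lead by (simp add: g' leads_def)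
    qed (simp add: g'_def)
  qed
  ultimately show ?thesis using g' by blast
qed

text \<open>By Dickson's lemma every leading monomial is a multiple of one of finitely many b,
  attained by chosen relations \<open>f b\<close>. Shifting \<open>f b\<close> attains any multiple
  of b with the same leading coefficient, and multiplying by the other chosen leading coefficients
  turns it into their product h.\<close>

lemma common_leading_coeff:
  "\<exists>h. polynomial_fun h \<and> (\<exists>T. h T \<noteq> 0) \<and> (\<forall>f m. f \<in> graph \<longrightarrow> leads f m \<longrightarrow> (\<exists>g\<in>graph. leads g m \<and> g m = h))"
proof -
  define L where "L = {m. \<exists>f\<in>graph. leads f m}"
  have graph_D: "m \<in> D" if "f \<in> graph" "leads f m" for f m
    using that unfolding graph_def leads_def by blast
  have "L \<subseteq> {m. keys m \<subseteq> {..<N + M}}" using graph_D by (auto simp: L_def D_def)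
  from dickson[OF _ this] obtain B where B: "finite B" "B \<subseteq> L"
    "\<forall>m\<in>L. \<exists>b\<in>B. \<forall>i. lookup b i \<le> lookup m i" by auto
  have "\<forall>b\<in>B. \<exists>f\<in>graph. leads f b" using B(2) by (auto simp: L_def)
  then obtain f where f: "\<And>b. b \<in> B \<Longrightarrow> f b \<in> graph" "\<And>b. b \<in> B \<Longrightarrow> leads (f b) b" by metis
  have pf: "polynomial_fun (f b b)" if "b \<in> B" for b using f(1)[OF that] by (simp add: graph_def)
  define h where "h = (\<lambda>T. \<Prod>b\<in>B. f b b T)"
  have h: "polynomial_fun h" unfolding h_def using pf by (intro polynomial_fun_intros)
  have h_nz: "\<exists>T. h T \<noteq> 0"
    unfolding h_def
  proof (rule polynomial_fun_prod_nonzero[OF inf B(1)])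
    show "\<exists>x. f b b x \<noteq> 0" if "b \<in> B" for b
      using f(2)[OF that] unfolding leads_def by blast
  qed (use pf in auto)
  moreover have "\<exists>g\<in>graph. leads g m \<and> g m = h" if "f' \<in> graph" "leads f' m" for f' m
  proof -
    have "m \<in> L" using that by (auto simp: L_def)
    then obtain b where b: "b \<in> B" "\<forall>i. lookup b i \<le> lookup m i" using B(3) by blast
    define s where "s = m - b"
    have m: "m = b + s"
      by (rule poly_mapping_eqI) (use b(2) in \<open>simp add: s_def lookup_add minus_poly_mapping.rep_eq\<close>)
    have "keys s \<subseteq> keys m" by (auto simp: m in_keys_iff lookup_add)
    then have "s \<in> D" using graph_D[OF that] by (auto simp: D_def)
    from graph_shift[OF f(1)[OF b(1)] this f(2)[OF b(1)]]
    obtain g where g: "g \<in> graph" "leads g m" "g m = f b b" by (auto simp: m)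
    define c where "c = (\<lambda>T. \<Prod>b'\<in>B - {b}. f b' b' T)"
    have hc: "h = (\<lambda>T. c T * f b b T)"
      using B(1) b(1) by (simp add: h_def c_def prod.remove mult.commute)
    let ?g = "\<lambda>m T. c T * g m T - 0 * g m T"
    have "polynomial_fun c" unfolding c_def using pf by (intro polynomial_fun_intros) auto
    then have "?g \<in> graph" by (intro graph_comb g polynomial_fun.const)
    moreover have "?g m = h" by (simp add: hc g(3))
    moreover have "leads ?g m"
      using g(2) h_nz \<open>?g m = h\<close> unfolding leads_def by (metis mult_zero_right diff_zero)
    ultimately show ?thesis by blast
  qed
  ultimately show ?thesis using h by blast
qed

text \<open>Elimination property of the order: the first index at which a smaller monomial differs
  has a smaller exponent there, so it cannot be one of the first N, where the exponents are already
  0.\<close>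

lemma Y_down: "m \<in> Y \<Longrightarrow> m' < m \<Longrightarrow> m' \<in> D \<Longrightarrow> m' \<in> Y"
proof -
  assume m: "m \<in> Y" "m' < m" "m' \<in> D"
  obtain k where k: "lookup m' k < lookup m k" "\<forall>k'<k. lookup m' k' = lookup m k'"
    using m(2) unfolding less_poly_mapping_iff by blast
  have "\<not> k < N" using k(1) m(1) by (auto simp: Y_def)
  then have "lookup m' i = 0" if "i < N" for i
    using that k(2) m(1) by (auto simp: Y_def)
  then show ?thesis using m(3) by (simp add: Y_def)
qed

text \<open>A polynomial f on the target is expanded twice: along the graph in monomials of x with
  coefficients depending on T, and below in monomials of the target with constant coefficients. The
  difference of the two expansions vanishes on the graph.\<close>

lemma phi_expands:
  assumes "polynomial_fun f"
  shows "\<exists>d b. (\<forall>m. polynomial_fun (b m)) \<and>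
    (\<forall>T x. f (\<lambda>j. \<phi> j (case_sum T x)) = (\<Sum>m\<in>box {..<N} d. b m T * mon m x))"
proof -
  have "polynomial_fun (\<lambda>z. f (\<lambda>j. \<phi> j z))"
    by (intro polynomial_fun_compose[OF assms] poly_\<phi>)
  from polynomial_fun_expands[OF _ this, of "{..<N}"]
  show ?thesis by (auto simp: expands_def simp flip: dep_\<phi>)
qed

lemma target_expands:
  fixes f :: "('j \<Rightarrow> 'a) \<Rightarrow> 'a"
  assumes "polynomial_fun f"
  shows "\<exists>d c. \<forall>z. f (\<lambda>j. if j \<in> J then z (N + inv_into {..<M} e j) else 0) =
    (\<Sum>m\<in>box {N..<N + M} d. c m * mon m z)"
proof -
  define F where "F = (\<lambda>z :: 'i + nat \<Rightarrow> 'a. f (\<lambda>j. if j \<in> J then z (Inr (N + inv_into {..<M} e j)) else 0))"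
  have F: "polynomial_fun F"
    unfolding F_def by (intro polynomial_fun_compose[OF assms] polynomial_fun_intros)
  have idx: "inv_into {..<M} e j < M" if "j \<in> J" for j
    using that e by (metis bij_betw_imp_surj_on inv_into_into lessThan_iff)
  obtain d c where c: "\<And>T x. F (case_sum T (\<lambda>p. if p \<in> {N..<N + M} then x p else 0)) =
      (\<Sum>m\<in>box {N..<N + M} d. c m T * mon m x)"
    using polynomial_fun_expands[OF _ F, of "{N..<N + M}"] unfolding expands_def by auto
  have "f (\<lambda>j. if j \<in> J then z (N + inv_into {..<M} e j) else 0) =
    (\<Sum>m\<in>box {N..<N + M} d. c m (\<lambda>_. 0) * mon m z)" for z
  proof -
    have "F (case_sum (\<lambda>_. 0) (\<lambda>p. if p \<in> {N..<N + M} then z p else 0)) =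
        f (\<lambda>j. if j \<in> J then z (N + inv_into {..<M} e j) else 0)"
      unfolding F_def using idx by (intro arg_cong[of _ _ f]) auto
    then show ?thesis using c[of "\<lambda>_. 0" z] by simp
  qed
  then show ?thesis by (intro exI[of _ d] exI[of _ "\<lambda>m. c m (\<lambda>_. 0)"]) simp
qed

lemma v_target: "(\<lambda>j. if j \<in> J then v T x (N + inv_into {..<M} e j) else 0) = (\<lambda>j. \<phi> j (case_sum T x))"
  using bij_betw_inv_into_right[OF e] by (auto simp: v_def off_\<phi>)

lemma v0_target: "(\<lambda>j. if j \<in> J then v0 (N + inv_into {..<M} e j) else 0) = y0"
  using bij_betw_inv_into_right[OF e] by (auto simp: v0_def off_y0)

lemma box_x_D: "box {..<N} d \<subseteq> D"
  by (force simp: box_def D_def)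

lemma box_y_Y: "box {N..<N + M} d \<subseteq> Y"
  by (auto simp: box_def Y_def D_def in_keys_iff subset_iff)

text \<open>The polynomial f(y) - f(phi(T, x)) vanishes on the graph, and adding f(phi(T0, x)),
  which is zero for all x, keeps this. At T = T0 the two parts in x cancel and f(y) is left. So each
  equation of a single image is the specialization of a relation of the whole family.\<close>

lemma graph_of_vanishing:
  assumes f: "polynomial_fun f" and van: "\<And>y. y \<in> im T0 \<Longrightarrow> f y = 0"
  shows "\<exists>g\<in>graph. \<exists>S. finite S \<and> S \<subseteq> Y \<and> (\<forall>m. m \<notin> S \<longrightarrow> g m T0 = 0) \<and>
    f y0 = (\<Sum>m\<in>S. g m T0 * mon m v0)"
proof -
  obtain d b where b: "\<And>m. polynomial_fun (b m)"
    "\<And>T x. f (\<lambda>j. \<phi> j (case_sum T x)) = (\<Sum>m\<in>box {..<N} d. b m T * mon m x)"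
    using phi_expands[OF f] by blast
  obtain d' c where c: "\<And>z. f (\<lambda>j. if j \<in> J then z (N + inv_into {..<M} e j) else 0) =
    (\<Sum>m\<in>box {N..<N + M} d'. c m * mon m z)" using target_expands[OF f] by blast
  define X where "X = box {..<N} d"
  define Z where "Z = box {N..<N + M} d'"
  have fin: "finite X" "finite Z" by (auto simp: X_def Z_def finite_box)
  \<comment> \<open>Subtracting the value at \<open>T0\<close> makes the part involving \<open>x\<close> vanish at \<open>T0\<close> coefficientwise.\<close>
  define g where "g = (\<lambda>m T. (if m \<in> Z then c m else 0) - (if m \<in> X then b m T - b m T0 else 0))"
  have "g \<in> graph"
  proof (rule graphI[of _ "X \<union> Z"])
    show "polynomial_fun (g m)" for m
      unfolding g_def by (intro polynomial_fun_intros b)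
    show "X \<union> Z \<subseteq> D"
      using box_x_D[of d] box_y_Y[of d'] by (auto simp: X_def Z_def Y_def)
    fix T x
    have "(\<Sum>m\<in>X \<union> Z. g m T * mon m (v T x)) =
        (\<Sum>m\<in>X \<union> Z. (if m \<in> Z then c m else 0) * mon m (v T x)) -
        (\<Sum>m\<in>X \<union> Z. (if m \<in> X then b m T - b m T0 else 0) * mon m (v T x))"
      by (simp add: g_def left_diff_distrib sum_subtractf)
    also have "(\<Sum>m\<in>X \<union> Z. (if m \<in> Z then c m else 0) * mon m (v T x)) =
        (\<Sum>m\<in>Z. (if m \<in> Z then c m else 0) * mon m (v T x))"
      by (rule sum_superset) (use fin in auto)
    also have "\<dots> = f (\<lambda>j. \<phi> j (case_sum T x))"
      unfolding v_target[symmetric] c by (simp add: Z_def)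
    also have "(\<Sum>m\<in>X \<union> Z. (if m \<in> X then b m T - b m T0 else 0) * mon m (v T x)) =
        (\<Sum>m\<in>X. (if m \<in> X then b m T - b m T0 else 0) * mon m (v T x))"
      by (rule sum_superset) (use fin in auto)
    also have "\<dots> = (\<Sum>m\<in>X. (b m T - b m T0) * mon m x)"
    proof (rule sum.cong)
      fix m assume "m \<in> X"
      then have "mon m (v T x) = mon m x"
        by (intro mon_cong) (auto simp: X_def box_def v_def)
      then show "(if m \<in> X then b m T - b m T0 else 0) * mon m (v T x) = (b m T - b m T0) * mon m x"
        using \<open>m \<in> X\<close> by simp
    qed simp
    also have "\<dots> = f (\<lambda>j. \<phi> j (case_sum T x)) - f (\<lambda>j. \<phi> j (case_sum T0 x))"
      by (simp add: b(2) X_def left_diff_distrib sum_subtractf)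
    also have "f (\<lambda>j. \<phi> j (case_sum T0 x)) = 0"
      by (rule van) (auto simp: im_def)
    finally show "(\<Sum>m\<in>X \<union> Z. g m T * mon m (v T x)) = 0" by simp
  qed (use fin in \<open>auto simp: g_def\<close>)
  moreover have g0: "g m T0 = (if m \<in> Z then c m else 0)" for m
    by (simp add: g_def)
  moreover have "f y0 = (\<Sum>m\<in>Z. g m T0 * mon m v0)"
    using c[of v0] unfolding g0 by (simp add: v0_target Z_def)
  ultimately show ?thesis
    using fin box_y_Y[of d'] by (intro bexI[of _ g] exI[of _ Z]) (auto simp: Z_def)
qed

text \<open>If some relation in the target variables alone is nonzero at \<open>y0\<close> for one
  T, its value at \<open>y0\<close> is a nonzero polynomial in T, and wherever this does not vanish
  the relation separates \<open>y0\<close> from the image. Otherwise all such relations vanish at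
  \<open>y0\<close> for every T. Then, where the common leading coefficient h is nonzero, every
  equation of the image is a combination of specializations of such relations and vanishes at
  \<open>y0\<close> too.\<close>

lemma decided_closure: "decided (\<lambda>T. y0 \<in> zariski_closure (im T))"
proof (cases "\<exists>g\<in>graph. \<exists>S T. finite S \<and> S \<subseteq> Y \<and> (\<forall>m T. m \<notin> S \<longrightarrow> g m T = 0) \<and>
    (\<Sum>m\<in>S. g m T * mon m v0) \<noteq> 0")
  case True
  then obtain g S T1 where g: "g \<in> graph" "finite S" "S \<subseteq> Y" "\<And>m T. m \<notin> S \<Longrightarrow> g m T = 0"
    "(\<Sum>m\<in>S. g m T1 * mon m v0) \<noteq> 0" by blast
  define h where "h = (\<lambda>T. \<Sum>m\<in>S. g m T * mon m v0)"
  have "polynomial_fun h"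
    unfolding h_def using g(1) by (intro polynomial_fun_intros) (auto simp: graph_def)
  moreover have "y0 \<notin> zariski_closure (im T)" if "h T \<noteq> 0" for T
  proof -
    define q where "q = (\<lambda>y :: 'j \<Rightarrow> 'a. \<Sum>m\<in>S. g m T * mon m (\<lambda>i. if i < N then 0 else y (e (i - N))))"
    have "polynomial_fun q"
      unfolding q_def by (intro polynomial_fun_intros polynomial_fun_mon)
    moreover have "q y0 \<noteq> 0" using that by (simp add: h_def q_def v0_def)
    moreover have "q y = 0" if y_im: "y \<in> im T" for y
    proof -
      obtain x where y: "y = (\<lambda>j. \<phi> j (case_sum T x))" using y_im by (auto simp: im_def)
      obtain S' where S': "finite S'" "\<And>m T. m \<notin> S' \<Longrightarrow> g m T = 0"
        "\<And>T x. (\<Sum>m\<in>S'. g m T * mon m (v T x)) = 0" using g(1) unfolding graph_def by blast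
      have "q y = (\<Sum>m\<in>S. g m T * mon m (v T x))"
        unfolding q_def
      proof (intro sum.cong refl arg_cong2[of _ _ _ _ "(*)"] mon_cong)
        fix m i assume "m \<in> S" "i \<in> keys m"
        then have "\<not> i < N" using g(3) by (auto simp: Y_def in_keys_iff)
        then show "(if i < N then 0 else y (e (i - N))) = v T x i" by (simp add: y v_def)
      qed
      also have "\<dots> = (\<Sum>m\<in>S \<union> S'. g m T * mon m (v T x))"
        by (rule sum_superset[symmetric]) (use g S' in auto)
      also have "\<dots> = (\<Sum>m\<in>S'. g m T * mon m (v T x))"
        by (rule sum_superset) (use g S' in auto)
      finally show ?thesis using S'(3) by simp
    qed
    ultimately show ?thesis unfolding mem_zariski_closure_iff by blast
  qed
  ultimately have "generically (\<lambda>T. y0 \<notin> zariski_closure (im T))"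
    unfolding generically_def using g(5) by (intro exI[of _ h]) (auto simp: h_def)
  then show ?thesis by (simp add: decided_def)
next
  case False
  obtain h where hh: "polynomial_fun h" "\<exists>T. h T \<noteq> 0"
    "\<And>f m. f \<in> graph \<Longrightarrow> leads f m \<Longrightarrow> \<exists>g\<in>graph. leads g m \<and> g m = h"
    using common_leading_coeff by blast
  interpret leading_module graph "{a. polynomial_fun a}" D h
  proof
    show "finite {m. \<exists>x. f m x \<noteq> 0}" if f: "f \<in> graph" for f
    proof -
      obtain S where "finite S" "\<forall>m T. m \<notin> S \<longrightarrow> f m T = 0" using f unfolding graph_def by blast
      then show ?thesis by (auto intro!: rev_finite_subset[of S])
    qed
    show "m \<in> D" if "f \<in> graph" "f m x \<noteq> 0" for f m x
      using that unfolding graph_def by blast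
    show "f m \<in> {a. polynomial_fun a}" if "f \<in> graph" for f m
      using that by (simp add: graph_def)
    show "wf {(m, m'). m < m' \<and> m \<in> D \<and> m' \<in> D}" unfolding D_def by (rule wf_monomials)
    show "(\<lambda>_. c) \<in> {a. polynomial_fun a}" for c by (simp add: polynomial_fun.const)
    show "h \<in> {a. polynomial_fun a}" using hh(1) by simp
    show "(\<lambda>m x. a x * f m x - b x * g m x) \<in> graph"
      if "f \<in> graph" "g \<in> graph" "a \<in> {a. polynomial_fun a}" "b \<in> {a. polynomial_fun a}" for f g a b
      using graph_comb that by simp
    show "\<exists>g\<in>graph. leads g m \<and> g m = h" if "f \<in> graph" "leads f m" for f m
      using hh(3) that .
  qed
  have "y0 \<in> zariski_closure (im T0)" if "h T0 \<noteq> 0" for T0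
    unfolding mem_zariski_closure_iff
  proof (intro allI impI)
    fix f :: "('j \<Rightarrow> 'a) \<Rightarrow> 'a" assume "polynomial_fun f" "\<forall>y\<in>im T0. f y = 0"
    then obtain g S where g: "g \<in> graph" "finite S" "S \<subseteq> Y" "\<And>m. m \<notin> S \<Longrightarrow> g m T0 = 0"
      "f y0 = (\<Sum>m\<in>S. g m T0 * mon m v0)" using graph_of_vanishing[of f T0] by blast
    define E where "E = (\<lambda>u :: (nat \<Rightarrow>\<^sub>0 nat) \<Rightarrow> 'a. \<exists>S. finite S \<and> (\<forall>m. m \<notin> S \<longrightarrow> u m = 0) \<and> (\<Sum>m\<in>S. u m * mon m v0) = 0)"
    have "E (\<lambda>m. g m T0)"
    proof (rule specialize_induct[OF that g(1), where Y = Y])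
      show "m \<in> Y" if "g m T0 \<noteq> 0" for m using that g by blast
      show "m' \<in> Y" if "m \<in> Y" "m' < m" "m' \<in> D" for m m' using Y_down that by blast
      show "E (\<lambda>_. 0)" unfolding E_def by (intro exI[of _ "{}"]) auto
      fix u f c assume u: "E u" and f: "f \<in> graph" "\<And>m x. f m x \<noteq> 0 \<Longrightarrow> m \<in> Y"
      obtain S where S: "finite S" "\<And>m. m \<notin> S \<Longrightarrow> u m = 0" "(\<Sum>m\<in>S. u m * mon m v0) = 0"
        using u unfolding E_def by blast
      define S' where "S' = {m. \<exists>x. f m x \<noteq> 0}"
      have S': "finite S'" "\<And>m T. m \<notin> S' \<Longrightarrow> f m T = 0" "S' \<subseteq> Y"
        using finite_support[OF f(1)] f(2) by (auto simp: S'_def)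
      then have f0: "(\<Sum>m\<in>S'. f m T0 * mon m v0) = 0" using False f(1) by blast
      have "(\<Sum>m\<in>S \<union> S'. (u m + c * f m T0) * mon m v0) =
          (\<Sum>m\<in>S \<union> S'. u m * mon m v0) + c * (\<Sum>m\<in>S \<union> S'. f m T0 * mon m v0)"
        by (simp add: sum_distrib_left sum.distrib ring_distribs mult_ac)
      also have "(\<Sum>m\<in>S \<union> S'. u m * mon m v0) = (\<Sum>m\<in>S. u m * mon m v0)"
        by (rule sum_superset) (use S S' in auto)
      also have "(\<Sum>m\<in>S \<union> S'. f m T0 * mon m v0) = (\<Sum>m\<in>S'. f m T0 * mon m v0)"
        by (rule sum_superset) (use S S' in auto)
      finally show "E (\<lambda>m. u m + c * f m T0)"
        unfolding E_def using S S' f0 by (intro exI[of _ "S \<union> S'"]) auto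
    qed
    then obtain S' where S': "finite S'" "\<And>m. m \<notin> S' \<Longrightarrow> g m T0 = 0" "(\<Sum>m\<in>S'. g m T0 * mon m v0) = 0"
      unfolding E_def by blast
    have "(\<Sum>m\<in>S. g m T0 * mon m v0) = (\<Sum>m\<in>S \<union> S'. g m T0 * mon m v0)"
      by (rule sum_superset[symmetric]) (use g S' in auto)
    also have "\<dots> = (\<Sum>m\<in>S'. g m T0 * mon m v0)"
      by (rule sum_superset) (use g S' in auto)
    finally show "f y0 = 0" using S'(3) g(5) by simp
  qed
  then have "generically (\<lambda>T. y0 \<in> zariski_closure (im T))"
    unfolding generically_def using hh by (intro exI[of _ h]) auto
  then show ?thesis by (simp add: decided_def)
qed

end

section \<open>The lower bound for the border subrank\<close>

text \<open>Solves the linear system by polynomials in T, with the solution at \<open>T0\<close>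
  prescribed up to a factor. For one more equation l, take solutions b and b' of the earlier ones
  that specialize to w and to u, and cross multiply so that the values of l on them cancel. At
  \<open>T0\<close> equation l vanishes on w but not on u, so the direction w survives. The vectors
  u express that the equations are independent at \<open>T0\<close>.\<close>

lemma kernel_section:
  fixes v :: "'l \<Rightarrow> nat \<Rightarrow> ('i \<Rightarrow> 'a::field) \<Rightarrow> 'a"
  assumes "finite L" and "\<And>l i. l \<in> L \<Longrightarrow> polynomial_fun (v l i)"
    and "\<And>l. l \<in> L \<Longrightarrow> \<exists>u. (\<Sum>i<n. v l i T0 * u i) \<noteq> 0 \<and> (\<forall>l'\<in>L. l' \<noteq> l \<longrightarrow> (\<Sum>i<n. v l' i T0 * u i) = 0)"
    and "\<And>l. l \<in> L \<Longrightarrow> (\<Sum>i<n. v l i T0 * w i) = 0"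
  shows "\<exists>b c. (\<forall>i. polynomial_fun (b i)) \<and> (\<forall>l\<in>L. \<forall>T. (\<Sum>i<n. v l i T * b i T) = 0) \<and>
    c \<noteq> 0 \<and> (\<forall>i<n. b i T0 = c * w i)"
  using assms
proof (induction L arbitrary: w rule: finite_induct)
  case empty
  then show ?case
    by (intro exI[of _ "\<lambda>i T. w i"] exI[of _ 1]) (auto intro: polynomial_fun.const)
next
  case (insert l L)
  have IH: "\<exists>b c. (\<forall>i. polynomial_fun (b i)) \<and> (\<forall>l\<in>L. \<forall>T. (\<Sum>i<n. v l i T * b i T) = 0) \<and>
      c \<noteq> 0 \<and> (\<forall>i<n. b i T0 = c * w i)"
    if "\<And>l. l \<in> L \<Longrightarrow> (\<Sum>i<n. v l i T0 * w i) = 0" for w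
  proof (rule insert.IH)
    show "\<exists>u. (\<Sum>i<n. v l i T0 * u i) \<noteq> 0 \<and> (\<forall>l'\<in>L. l' \<noteq> l \<longrightarrow> (\<Sum>i<n. v l' i T0 * u i) = 0)"
      if "l \<in> L" for l using insert.prems(2)[of l] that by blast
  qed (use insert.prems(1) that in auto)
  obtain u where u: "(\<Sum>i<n. v l i T0 * u i) \<noteq> 0" "\<And>l'. l' \<in> L \<Longrightarrow> (\<Sum>i<n. v l' i T0 * u i) = 0"
    using insert.prems(2)[of l] insert.hyps(2) by (metis insertI1 insertI2)
  from IH[of w, OF insert.prems(3)[OF insertI2]]
  obtain b c where b: "\<And>i. polynomial_fun (b i)" "\<And>l T. l \<in> L \<Longrightarrow> (\<Sum>i<n. v l i T * b i T) = 0"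
    "c \<noteq> 0" "\<And>i. i < n \<Longrightarrow> b i T0 = c * w i"
    by blast
  from IH[of u, OF u(2)]
  obtain b' c' where b': "\<And>i. polynomial_fun (b' i)" "\<And>l T. l \<in> L \<Longrightarrow> (\<Sum>i<n. v l i T * b' i T) = 0"
    "c' \<noteq> 0" "\<And>i. i < n \<Longrightarrow> b' i T0 = c' * u i"
    by blast
  define \<beta> where "\<beta> = (\<lambda>T. \<Sum>i<n. v l i T * b i T)"
  define \<beta>' where "\<beta>' = (\<lambda>T. \<Sum>i<n. v l i T * b' i T)"
  define d where "d = (\<lambda>i T. \<beta>' T * b i T - \<beta> T * b' i T)"
  have "polynomial_fun (d i)" for i
    unfolding d_def \<beta>_def \<beta>'_def using b(1) b'(1) insert.prems(1)
    by (intro polynomial_fun_intros) auto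
  moreover have d_sum: "(\<Sum>i<n. v k i T * d i T) =
      \<beta>' T * (\<Sum>i<n. v k i T * b i T) - \<beta> T * (\<Sum>i<n. v k i T * b' i T)" for k T
    by (simp add: d_def sum_distrib_left sum_subtractf algebra_simps)
  have "(\<Sum>i<n. v k i T * d i T) = 0" if "k \<in> insert l L" for k T
  proof (cases "k = l")
    case True
    then show ?thesis unfolding d_sum by (simp add: \<beta>_def \<beta>'_def)
  next
    case False
    then show ?thesis using that b(2) b'(2) unfolding d_sum by simp
  qed
  moreover have "\<beta>' T0 * c \<noteq> 0"
  proof -
    have "\<beta>' T0 = c' * (\<Sum>i<n. v l i T0 * u i)"
      by (simp add: \<beta>'_def b'(4) sum_distrib_left mult_ac)
    then show ?thesis using u(1) b(3) b'(3) by simp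
  qed
  moreover have "d i T0 = (\<beta>' T0 * c) * w i" if "i < n" for i
  proof -
    have "\<beta> T0 = c * (\<Sum>i<n. v l i T0 * w i)"
      by (simp add: \<beta>_def b(4) sum_distrib_left mult_ac)
    then have "\<beta> T0 = 0" using insert.prems(3) by simp
    then show ?thesis using b(4)[OF that] by (simp add: d_def)
  qed
  ultimately show ?case by blast
qed

text \<open>Bounds the number of colours. Passing from r to r + 2, the first and last terms
  contribute 2 and each of the r middle terms grows by 1.\<close>

lemma sum_min_le: "4 * (\<Sum>l<r. min (Suc l) (r - l)) \<le> (r + 1)\<^sup>2"
proof (induction r rule: induct_nat_012)
  case (ge2 r)
  have "(\<Sum>l<Suc (Suc r). min (Suc l) (Suc (Suc r) - l)) =
      2 + (\<Sum>l<r. min (Suc (Suc l)) (Suc r - l))"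
    by (simp add: sum.lessThan_Suc_shift[of _ "Suc r"] del: sum.lessThan_Suc) simp
  also have "(\<Sum>l<r. min (Suc (Suc l)) (Suc r - l)) = (\<Sum>l<r. 1 + min (Suc l) (r - l))"
    by (intro sum.cong) auto
  also have "\<dots> = r + (\<Sum>l<r. min (Suc l) (r - l))" unfolding sum.distrib by simp
  finally show ?case using ge2 by (simp add: power2_eq_square)
qed (auto simp: power2_eq_square)

text \<open>
  The colours are pairs of a length \<open>l\<close> and a residue modulo \<open>l\<close>: two intervals \<open>[i, k]\<close> of the same
  length with a common point have starting points that differ modulo the length.
\<close>

lemma interval_coloring:
  fixes r m :: nat
  assumes "(r + 1)\<^sup>2 \<le> 4 * m"
  shows "\<exists>c. (\<forall>i k. i \<le> k \<longrightarrow> k < r \<longrightarrow> c i k < m) \<and>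
    (\<forall>j i k i' k'. i \<le> j \<longrightarrow> j \<le> k \<longrightarrow> k < r \<longrightarrow> i' \<le> j \<longrightarrow> j \<le> k' \<longrightarrow> k' < r \<longrightarrow>
       c i k = c i' k' \<longrightarrow> i = i' \<and> k = (k'::nat))"
proof -
  \<comment> \<open>Here l is k - i, one less than the number of points. There are r - l such
    intervals and \<open>Suc l\<close> residues, hence the minimum.\<close>
  define Col where "Col = (SIGMA l:{..<r}. {..<min (Suc l) (r - l)})"
  have "card Col \<le> m"
    using sum_min_le[of r] assms by (simp add: Col_def)
  then have "card Col \<le> card {..<m}" by simp
  then obtain f where f: "f ` Col \<subseteq> {..<m}" "inj_on f Col"
    using card_le_inj[of Col "{..<m}"] by (auto simp: Col_def)
  define g where "g = (\<lambda>i k :: nat. (k - i, i mod Suc (k - i)))"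
  have g: "g i k \<in> Col" if "i \<le> k" "k < r" for i k
  proof -
    have "i mod Suc (k - i) \<le> i" by simp
    moreover have "i < r - (k - i)" using that by linarith
    ultimately have "i mod Suc (k - i) < r - (k - i)" by linarith
    then show ?thesis using that by (auto simp: g_def Col_def)
  qed
  have inj: "i \<le> i'"
    if "i \<le> j" "j \<le> k" "i' \<le> j" "j \<le> k'" "g i k = g i' k'" for i j k i' k'
  proof (rule ccontr)
    assume "\<not> i \<le> i'"
    moreover have "k - i = k' - i'" "i mod Suc (k - i) = i' mod Suc (k - i)"
      using that by (auto simp: g_def)
    ultimately have "Suc (k - i) dvd i - i'" by (simp add: mod_eq_dvd_iff_nat)
    moreover have "0 < i - i'" using \<open>\<not> i \<le> i'\<close> by simp
    ultimately have "Suc (k - i) \<le> i - i'" by (rule dvd_imp_le)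
    then show False using that \<open>k - i = k' - i'\<close> by linarith
  qed
  show ?thesis
  proof (intro exI[of _ "\<lambda>i k. f (g i k)"] conjI allI impI)
    show "f (g i k) < m" if "i \<le> k" "k < r" for i k using g[OF that] f(1) by auto
    fix j i k i' k' assume *: "i \<le> j" "j \<le> k" "k < r" "i' \<le> j" "j \<le> k'" "k' < r" "f (g i k) = f (g i' k')"
    then have gg: "g i k = g i' k'"
      using inj_onD[OF f(2) *(7)] g[of i k] g[of i' k'] by auto
    then show "i = i'" using inj[of i j k i' k'] inj[of i' j k' i k] * by auto
    then show "k = k'" using gg * by (auto simp: g_def)
  qed
qed

text \<open>Besides the unit tensor there is, for every interval i <= k, an entry in each of the
  first two directions at the private coordinate r + c i k. At this tensor the linear equation
  belonging to the pair (i, k) becomes a nonzero multiple of that coordinate, so equations of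
  different colours are independent.\<close>

definition seed :: "nat \<Rightarrow> (nat \<Rightarrow> nat \<Rightarrow> nat) \<Rightarrow> 'a::zero_neq_one tensor" where
  "seed r c = (\<lambda>(i, j, k). if k < r \<and> (i = k \<and> j = k \<or> i \<le> k \<and> j = r + c i k \<or> j \<le> k \<and> i = r + c j k)
     then 1 else 0)"

definition slice_form :: "nat \<Rightarrow> (nat \<Rightarrow> 'a::comm_ring_1 tensor \<Rightarrow> 'a) \<Rightarrow> (nat \<Rightarrow> 'a tensor \<Rightarrow> 'a) \<Rightarrow> nat \<Rightarrow> 'a tensor \<Rightarrow> 'a" where
  "slice_form n a b k T = (\<Sum>i<n. \<Sum>j<n. a i T * b j T * T (i, j, k))"

lemma slice_form_left: "slice_form n a b k T = (\<Sum>i<n. (\<Sum>j<n. b j T * T (i, j, k)) * a i T)"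
  unfolding slice_form_def by (simp add: sum_distrib_left mult_ac)

lemma slice_form_right: "slice_form n a b k T = (\<Sum>j<n. (\<Sum>i<n. a i T * T (i, j, k)) * b j T)"
  unfolding slice_form_def by (subst sum.swap) (simp add: sum_distrib_left mult_ac)

lemma polynomial_fun_slice_form:
  assumes "\<And>i. polynomial_fun (a i)" "\<And>i. polynomial_fun (b i)"
  shows "polynomial_fun (slice_form n a b k)"
proof -
  have "polynomial_fun (\<lambda>T. \<Sum>i<n. \<Sum>j<n. a i T * b j T * T (i, j, k))"
    by (intro polynomial_fun_intros assms)
  then show ?thesis by (simp add: slice_form_def[abs_def])
qed

text \<open>The state after choosing s pairs of vectors. The vanishing conditions hold identically
  in T, whereas the vectors are prescribed only at \<open>T0\<close>. The diagonal values p = q = k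
  are left free: they are nonzero at the seed and are normalized by division at the end.\<close>

definition triangular :: "nat \<Rightarrow> nat \<Rightarrow> nat \<Rightarrow> 'a::field tensor \<Rightarrow>
    (nat \<Rightarrow> nat \<Rightarrow> 'a tensor \<Rightarrow> 'a) \<Rightarrow> (nat \<Rightarrow> nat \<Rightarrow> 'a tensor \<Rightarrow> 'a) \<Rightarrow> (nat \<Rightarrow> 'a) \<Rightarrow> (nat \<Rightarrow> 'a) \<Rightarrow> bool" where
  "triangular n r s T0 a b \<alpha> \<beta> \<longleftrightarrow>
    (\<forall>p i. polynomial_fun (a p i)) \<and> (\<forall>p i. polynomial_fun (b p i)) \<and>
    (\<forall>p<s. \<alpha> p \<noteq> 0 \<and> \<beta> p \<noteq> 0) \<and>
    (\<forall>p<s. \<forall>i<n. a p i T0 = \<alpha> p * (if i = p then 1 else 0) \<and> b p i T0 = \<beta> p * (if i = p then 1 else 0)) \<and>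
    (\<forall>p<s. \<forall>q<s. \<forall>k<r. p \<le> k \<longrightarrow> q \<le> k \<longrightarrow> \<not> (p = k \<and> q = k) \<longrightarrow> (\<forall>T. slice_form n (a p) (b q) k T = 0))"

text \<open>
  The vectors are chosen in the order \<open>a 0, b 0, a 1, b 1, \<dots>\<close>, so that each of them solves a system
  of at most \<open>(r + 1)\<^sup>2 / 4\<close> linear equations given by its predecessors. The systems are of full
  rank at the seed tensor by the choice of the colouring.
\<close>

lemma triangular_vectors:
  fixes r n :: nat and c :: "nat \<Rightarrow> nat \<Rightarrow> nat"
  defines "T0 \<equiv> seed r c :: 'a::field tensor"
  assumes c: "\<And>i k. i \<le> k \<Longrightarrow> k < r \<Longrightarrow> r + c i k < n"
    and inj: "\<And>j i k i' k'. i \<le> j \<Longrightarrow> j \<le> k \<Longrightarrow> k < r \<Longrightarrow> i' \<le> j \<Longrightarrow> j \<le> k' \<Longrightarrow> k' < r \<Longrightarrow>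
       c i k = c i' k' \<Longrightarrow> i = i' \<and> k = k'"
    and "r \<le> n" "s \<le> r"
  shows "\<exists>a b \<alpha> \<beta>. triangular n r s T0 a b \<alpha> \<beta>"
  using \<open>s \<le> r\<close>
proof (induction s)
  case 0
  show ?case
    unfolding triangular_def
    by (rule exI[of _ "\<lambda>_ _ _. 0"], rule exI[of _ "\<lambda>_ _ _. 0"]) (auto intro: polynomial_fun.const)
next
  case (Suc t)
  from Suc.IH[OF Suc_leD[OF Suc.prems]]
  obtain a b \<alpha> \<beta> where IH: "triangular n r t T0 a b \<alpha> \<beta>" by blast
  have a: "polynomial_fun (a p i)" and b: "polynomial_fun (b p i)" for p i
    using IH by (simp_all add: triangular_def)
  have nz: "\<alpha> p \<noteq> 0 \<and> \<beta> p \<noteq> 0" if "p < t" for p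
    using IH that by (simp add: triangular_def)
  have ab0: "a p i T0 = \<alpha> p * (if i = p then 1 else 0) \<and> b p i T0 = \<beta> p * (if i = p then 1 else 0)"
    if "p < t" "i < n" for p i
    using IH that by (simp add: triangular_def)
  have form: "slice_form n (a p) (b q) k T = 0"
    if "p < t" "q < t" "k < r" "p \<le> k" "q \<le> k" "\<not> (p = k \<and> q = k)" for p q k T
    using IH that by (simp add: triangular_def)
  note a0 = conjunct1[OF ab0] and b0 = conjunct2[OF ab0]
  have t: "t < r" "t < n" using Suc.prems \<open>r \<le> n\<close> by auto
  have unit_left: "(\<Sum>i<n. (x * (if i = p then 1 else 0)) * f i) = x * f p"
    if "p < n" for x p and f :: "nat \<Rightarrow> 'a"
    using that by (simp add: if_distrib[of "\<lambda>z. z * _"] if_distrib[of "\<lambda>z. _ * z"] sum.delta cong: if_cong)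
  have unit_right: "(\<Sum>i<n. f i * (if i = p then 1 else 0)) = f p"
    if "p < n" for p and f :: "nat \<Rightarrow> 'a"
    using that by (simp add: if_distrib[of "\<lambda>z. _ * z"] sum.delta cong: if_cong)
  obtain at1 at0 where at1: "\<And>i. polynomial_fun (at1 i)" "at0 \<noteq> 0"
    "\<And>i. i < n \<Longrightarrow> at1 i T0 = at0 * (if i = t then 1 else 0)"
    "\<And>q k T. q < t \<Longrightarrow> t \<le> k \<Longrightarrow> k < r \<Longrightarrow> slice_form n at1 (b q) k T = 0"
  proof -
    \<comment> \<open>The new vector meets an earlier \<open>b q\<close> in the slices k with t <=
      k. These pairs are intervals [q, k] through the common point t, so their colours differ, and
      the prescribed unit vector at t < r is annihilated by all the equations at the seed.\<close>
    define L where "L = {(q, k). q < t \<and> t \<le> k \<and> k < r}"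
    define v where "v = (\<lambda>(q, k) i T. \<Sum>j<n. b q j T * T (i, j, k))"
    have v0: "v (q, k) i T0 = \<beta> q * (if i = r + c q k then 1 else 0)" if "(q, k) \<in> L" for q k i
    proof -
      have "v (q, k) i T0 = (\<Sum>j<n. (\<beta> q * (if j = q then 1 else 0)) * T0 (i, j, k))"
        using that by (auto simp: v_def L_def b0 intro!: sum.cong)
      also have "\<dots> = \<beta> q * T0 (i, q, k)" using that t by (intro unit_left) (auto simp: L_def)
      also have "T0 (i, q, k) = (if i = r + c q k then 1 else 0)"
        using that t by (auto simp: L_def T0_def seed_def)
      finally show ?thesis .
    qed
    have "finite L" by (rule finite_subset[of _ "{..<t} \<times> {..<r}"]) (auto simp: L_def)
    then have "\<exists>at1 at0. (\<forall>i. polynomial_fun (at1 i)) \<and> (\<forall>l\<in>L. \<forall>T. (\<Sum>i<n. v l i T * at1 i T) = 0) \<and>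
        at0 \<noteq> 0 \<and> (\<forall>i<n. at1 i T0 = at0 * (if i = t then 1 else 0))"
    proof (rule kernel_section)
      show "polynomial_fun (v l i)" for l i
      proof (cases l)
        case (Pair q k)
        have "polynomial_fun (\<lambda>T. \<Sum>j<n. b q j T * T (i, j, k))" by (intro polynomial_fun_intros b)
        then show ?thesis by (simp add: Pair v_def)
      qed
      show "\<exists>u. (\<Sum>i<n. v l i T0 * u i) \<noteq> 0 \<and> (\<forall>l'\<in>L. l' \<noteq> l \<longrightarrow> (\<Sum>i<n. v l' i T0 * u i) = 0)"
        if l: "l \<in> L" for l
      proof -
        obtain q k where qk: "l = (q, k)" "(q, k) \<in> L" using l by (cases l) auto
        then have rc: "r + c q k < n" by (intro c) (auto simp: L_def)
        show ?thesis
        proof (intro exI[of _ "\<lambda>i. if i = r + c q k then 1 else 0"] conjI ballI impI)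
          show "(\<Sum>i<n. v l i T0 * (if i = r + c q k then 1 else 0)) \<noteq> 0"
            unfolding unit_right[OF rc] qk(1) v0[OF qk(2)] using qk(2) nz by (simp add: L_def)
          fix l' assume l': "l' \<in> L" "l' \<noteq> l"
          obtain q' k' where qk': "l' = (q', k')" "(q', k') \<in> L" using l' by (cases l') auto
          have "c q k \<noteq> c q' k'"
            using inj[of q t k q' k'] qk qk' l'(2) by (auto simp: L_def)
          then show "(\<Sum>i<n. v l' i T0 * (if i = r + c q k then 1 else 0)) = 0"
            unfolding unit_right[OF rc] qk'(1) v0[OF qk'(2)] by simp
        qed
      qed
      show "(\<Sum>i<n. v l i T0 * (if i = t then 1 else 0)) = 0" if l: "l \<in> L" for l
      proof -
        obtain q k where qk: "l = (q, k)" "(q, k) \<in> L" using l by (cases l) auto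
        show ?thesis unfolding unit_right[OF t(2)] qk(1) v0[OF qk(2)] using t by simp
      qed
    qed
    then obtain at1 at0 where at1: "\<And>i. polynomial_fun (at1 i)"
      "\<And>l T. l \<in> L \<Longrightarrow> (\<Sum>i<n. v l i T * at1 i T) = 0" "at0 \<noteq> 0"
      "\<And>i. i < n \<Longrightarrow> at1 i T0 = at0 * (if i = t then 1 else 0)" by blast
    show ?thesis
    proof (rule that[OF at1(1,3,4)])
      fix q k T assume "q < t" "t \<le> k" "k < r"
      then show "slice_form n at1 (b q) k T = 0"
        using at1(2)[of "(q, k)" T] by (simp add: L_def v_def slice_form_left)
    qed
  qed
  define a' where "a' = a(t := at1)"
  define \<alpha>' where "\<alpha>' = \<alpha>(t := at0)"
  have a': "polynomial_fun (a' p i)" for p i using a at1(1) by (simp add: a'_def)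
  have a'0: "a' p i T0 = \<alpha>' p * (if i = p then 1 else 0)" "\<alpha>' p \<noteq> 0" if "p \<le> t" "i < n" for p i
    using that a0 at1(2,3) nz by (auto simp: a'_def \<alpha>'_def)
  obtain bt bt0 where bt: "\<And>i. polynomial_fun (bt i)" "bt0 \<noteq> 0"
    "\<And>i. i < n \<Longrightarrow> bt i T0 = bt0 * (if i = t then 1 else 0)"
    "\<And>p k T. p \<le> t \<Longrightarrow> t \<le> k \<Longrightarrow> k < r \<Longrightarrow> \<not> (p = t \<and> k = t) \<Longrightarrow> slice_form n (a' p) bt k T = 0"
  proof -
    \<comment> \<open>Now p = t is included, because the new vector of the first kind is already
      chosen. The pair (t, t) is excluded: it is the diagonal value.\<close>
    define L where "L = {(p, k). p \<le> t \<and> t \<le> k \<and> k < r \<and> \<not> (p = t \<and> k = t)}"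
    define v where "v = (\<lambda>(p, k) j T. \<Sum>i<n. a' p i T * T (i, j, k))"
    have v0: "v (p, k) j T0 = \<alpha>' p * (if j = r + c p k then 1 else 0)" if "(p, k) \<in> L" for p k j
    proof -
      have "v (p, k) j T0 = (\<Sum>i<n. (\<alpha>' p * (if i = p then 1 else 0)) * T0 (i, j, k))"
        using that by (auto simp: v_def L_def a'0 intro!: sum.cong)
      also have "\<dots> = \<alpha>' p * T0 (p, j, k)" using that t by (intro unit_left) (auto simp: L_def)
      also have "T0 (p, j, k) = (if j = r + c p k then 1 else 0)"
        using that t by (auto simp: L_def T0_def seed_def)
      finally show ?thesis .
    qed
    have "finite L" by (rule finite_subset[of _ "{..t} \<times> {..<r}"]) (auto simp: L_def)
    then have "\<exists>bt bt0. (\<forall>i. polynomial_fun (bt i)) \<and> (\<forall>l\<in>L. \<forall>T. (\<Sum>i<n. v l i T * bt i T) = 0) \<and>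
        bt0 \<noteq> 0 \<and> (\<forall>i<n. bt i T0 = bt0 * (if i = t then 1 else 0))"
    proof (rule kernel_section)
      show "polynomial_fun (v l i)" for l i
      proof (cases l)
        case (Pair p k)
        have "polynomial_fun (\<lambda>T. \<Sum>j<n. a' p j T * T (j, i, k))" by (intro polynomial_fun_intros a')
        then show ?thesis by (simp add: Pair v_def)
      qed
      show "\<exists>u. (\<Sum>i<n. v l i T0 * u i) \<noteq> 0 \<and> (\<forall>l'\<in>L. l' \<noteq> l \<longrightarrow> (\<Sum>i<n. v l' i T0 * u i) = 0)"
        if l: "l \<in> L" for l
      proof -
        obtain p k where pk: "l = (p, k)" "(p, k) \<in> L" using l by (cases l) auto
        then have rc: "r + c p k < n" by (intro c) (auto simp: L_def)
        show ?thesis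
        proof (intro exI[of _ "\<lambda>i. if i = r + c p k then 1 else 0"] conjI ballI impI)
          show "(\<Sum>i<n. v l i T0 * (if i = r + c p k then 1 else 0)) \<noteq> 0"
            unfolding unit_right[OF rc] pk(1) v0[OF pk(2)] using pk(2) a'0(2)[OF _ t(2)] by (simp add: L_def)
          fix l' assume l': "l' \<in> L" "l' \<noteq> l"
          obtain p' k' where pk': "l' = (p', k')" "(p', k') \<in> L" using l' by (cases l') auto
          have "c p k \<noteq> c p' k'"
            using inj[of p t k p' k'] pk pk' l'(2) by (auto simp: L_def)
          then show "(\<Sum>i<n. v l' i T0 * (if i = r + c p k then 1 else 0)) = 0"
            unfolding unit_right[OF rc] pk'(1) v0[OF pk'(2)] by simp
        qed
      qed
      show "(\<Sum>i<n. v l i T0 * (if i = t then 1 else 0)) = 0" if l: "l \<in> L" for l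
      proof -
        obtain p k where pk: "l = (p, k)" "(p, k) \<in> L" using l by (cases l) auto
        show ?thesis unfolding unit_right[OF t(2)] pk(1) v0[OF pk(2)] using t by simp
      qed
    qed
    then obtain bt bt0 where bt: "\<And>i. polynomial_fun (bt i)"
      "\<And>l T. l \<in> L \<Longrightarrow> (\<Sum>i<n. v l i T * bt i T) = 0" "bt0 \<noteq> 0"
      "\<And>i. i < n \<Longrightarrow> bt i T0 = bt0 * (if i = t then 1 else 0)" by blast
    show ?thesis
    proof (rule that[OF bt(1,3,4)])
      fix p k T assume "p \<le> t" "t \<le> k" "k < r" "\<not> (p = t \<and> k = t)"
      then show "slice_form n (a' p) bt k T = 0"
        using bt(2)[of "(p, k)" T] by (simp add: L_def v_def slice_form_right)
    qed
  qed
  define b' where "b' = b(t := bt)"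
  define \<beta>' where "\<beta>' = \<beta>(t := bt0)"
  have b': "polynomial_fun (b' p i)" for p i using b bt(1) by (simp add: b'_def)
  have b'0: "b' p i T0 = \<beta>' p * (if i = p then 1 else 0)" "\<beta>' p \<noteq> 0" if "p \<le> t" "i < n" for p i
    using that b0 bt(2,3) nz by (auto simp: b'_def \<beta>'_def)
  have "slice_form n (a' p) (b' q) k T = 0"
    if "p \<le> t" "q \<le> t" "k < r" "p \<le> k" "q \<le> k" "\<not> (p = k \<and> q = k)" for p q k T
  proof (cases "q = t")
    case True
    then have "\<not> (p = t \<and> k = t)" using that by auto
    then show ?thesis using True bt(4)[of p k T] that by (simp add: b'_def)
  next
    case False
    then show ?thesis using that at1(4)[of q k T] form[of p q k T] by (auto simp: a'_def b'_def)
  qed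
  then have "triangular n r (Suc t) T0 a' b' \<alpha>' \<beta>'"
    unfolding triangular_def less_Suc_eq_le
  proof (intro conjI)
    show "\<forall>p\<le>t. \<alpha>' p \<noteq> 0 \<and> \<beta>' p \<noteq> 0" using a'0(2)[OF _ t(2)] b'0(2)[OF _ t(2)] by blast
    show "\<forall>p\<le>t. \<forall>i<n. a' p i T0 = \<alpha>' p * (if i = p then 1 else 0) \<and> b' p i T0 = \<beta>' p * (if i = p then 1 else 0)"
      using a'0(1) b'0(1) by blast
  qed (use a' b' in blast)+
  then show ?case by blast
qed

section \<open>Degeneration of a triangular tensor to the unit tensor\<close>

lemma power_two_add_less: "\<not> (a \<le> c \<and> b \<le> c) \<Longrightarrow> 2 ^ Suc c < 2 ^ a + (2 ^ b :: nat)"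
proof -
  assume "\<not> (a \<le> c \<and> b \<le> c)"
  then have "Suc c \<le> a \<or> Suc c \<le> b" by auto
  then have "(2::nat) ^ Suc c \<le> 2 ^ a \<or> (2::nat) ^ Suc c \<le> 2 ^ b"
    by (auto intro: power_increasing simp del: power_Suc)
  moreover have "(0::nat) < 2 ^ a" "(0::nat) < 2 ^ b" by auto
  ultimately show ?thesis by linarith
qed

text \<open>
  The one-parameter group with weights \<open>2 ^ i\<close>, \<open>2 ^ j\<close>, \<open>- 2 ^ (k + 1)\<close> has nonpositive weight on
  the coordinate \<open>(i, j, k)\<close> exactly if \<open>i\<close> and \<open>j\<close> are at most \<open>k\<close>.
\<close>

lemma degeneration_to_unit_tensor:
  fixes T :: "'a::field tensor"
  assumes inf: "infinite (UNIV :: 'a set)"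
    and ABC: "A \<in> carrier_mat r n" "B \<in> carrier_mat r n" "C \<in> carrier_mat r n"
    and tri: "\<And>p q k. p < r \<Longrightarrow> q < r \<Longrightarrow> k < r \<Longrightarrow> p \<le> k \<Longrightarrow> q \<le> k \<Longrightarrow>
      tensor_map A B C T (p, q, k) = (if p = k \<and> q = k then 1 else 0)"
  shows "unit_tensor r \<in> zariski_closure (restrictions n n n r T)"
  unfolding mem_zariski_closure_iff
proof (intro allI impI)
  fix f :: "'a tensor \<Rightarrow> 'a"
  assume f: "polynomial_fun f" "\<forall>x\<in>restrictions n n n r T. f x = 0"
  define S where "S = tensor_map A B C T"
  \<comment> \<open>The orbit of S with polynomial entries, so that t = 0 makes sense. Where the
    weight is nonpositive, S is 0 except at p = q = k, where the weight is 0 and the entry is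
    constantly 1; elsewhere the exponent is positive and the entry vanishes at t = 0.\<close>
  define \<gamma> where "\<gamma> = (\<lambda>(p, q, k). if p < r \<and> q < r \<and> k < r then
      if p \<le> k \<and> q \<le> k then [:if p = k \<and> q = k then 1 else 0:]
      else monom (S (p, q, k)) (2 ^ p + 2 ^ q - 2 ^ Suc k) else 0)"
  obtain P where P: "\<And>t. f (\<lambda>i. poly (\<gamma> i) t) = poly P t"
    using polynomial_fun_curve[OF f(1)] by blast
  have "poly P t = 0" if t: "t \<noteq> 0" for t
  proof -
    define At where "At = mat r n (\<lambda>(p, i). t ^ (2 ^ p) * A $$ (p, i))"
    define Bt where "Bt = mat r n (\<lambda>(p, i). t ^ (2 ^ p) * B $$ (p, i))"
    define Ct where "Ct = mat r n (\<lambda>(p, i). inverse t ^ (2 ^ Suc p) * C $$ (p, i))"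
    have "(\<lambda>i. poly (\<gamma> i) t) = tensor_map At Bt Ct T"
    proof (rule ext)
      fix x :: "nat \<times> nat \<times> nat"
      obtain p q k where x: "x = (p, q, k)" using prod_cases3 by blast
      show "poly (\<gamma> x) t = tensor_map At Bt Ct T x"
      proof (cases "p < r \<and> q < r \<and> k < r")
        case False
        then show ?thesis by (auto simp: x \<gamma>_def tensor_map_def At_def Bt_def Ct_def)
      next
        case True
        have "tensor_map At Bt Ct T x = t ^ (2 ^ p) * t ^ (2 ^ q) * inverse t ^ (2 ^ Suc k) * S x"
          using True ABC
          by (simp add: x S_def tensor_map_def At_def Bt_def Ct_def sum_distrib_left mult_ac)
        also have "t ^ (2 ^ p) * t ^ (2 ^ q) * inverse t ^ (2 ^ Suc k) =
            t ^ (2 ^ p + 2 ^ q) / t ^ (2 ^ Suc k)"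
          by (simp add: power_add power_inverse divide_inverse)
        finally have eq: "tensor_map At Bt Ct T x = t ^ (2 ^ p + 2 ^ q) / t ^ (2 ^ Suc k) * S x" .
        have "poly (\<gamma> x) t = t ^ (2 ^ p + 2 ^ q) / t ^ (2 ^ Suc k) * S x"
        proof (cases "p \<le> k \<and> q \<le> k")
          case le: True
          then have "S x = (if p = k \<and> q = k then 1 else 0)" using tri True by (simp add: S_def x)
          moreover have "t ^ (2 ^ k + 2 ^ k) / t ^ (2 ^ Suc k) = 1" using t by (simp add: mult_2)
          ultimately show ?thesis using True le by (auto simp: \<gamma>_def x simp del: power_Suc)
        next
          case False
          have "t ^ (2 ^ p + 2 ^ q) / t ^ (2 ^ Suc k) = t ^ (2 ^ p + 2 ^ q - 2 ^ Suc k)"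
            using power_two_add_less[OF False] t by (subst power_diff) (auto simp del: power_Suc)
          then show ?thesis using True False by (auto simp: \<gamma>_def x poly_monom mult.commute)
        qed
        then show ?thesis by (simp only: eq)
      qed
    qed
    moreover have "tensor_map At Bt Ct T \<in> restrictions n n n r T"
      unfolding restrictions_def At_def Bt_def Ct_def
      by (intro CollectI exI conjI, rule refl) auto
    ultimately show ?thesis using f(2) P[of t] by simp
  qed
  then have "UNIV - {0} \<subseteq> {t. poly P t = 0}" by auto
  then have "P = 0"
    using inf poly_roots_finite[of P] by (metis finite_Diff2 finite.emptyI finite_insert finite_subset)
  moreover have "(\<lambda>i. poly (\<gamma> i) 0) = unit_tensor r"
  proof (rule ext)
    fix x :: "nat \<times> nat \<times> nat"
    obtain p q k where x: "x = (p, q, k)" using prod_cases3 by blast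
    have "2 ^ p + 2 ^ q - 2 ^ Suc k \<noteq> (0::nat)" if "\<not> (p \<le> k \<and> q \<le> k)"
      using power_two_add_less[OF that] by linarith
    then show "poly (\<gamma> x) 0 = unit_tensor r x"
      by (auto simp: \<gamma>_def x unit_tensor_def poly_monom simp del: power_Suc)
  qed
  ultimately show "f (unit_tensor r) = 0" using P[of 0] by simp
qed

lemma generically_border_subrank_ge:
  fixes r n :: nat
  assumes inf: "infinite (UNIV :: 'a::field set)" and "r \<le> n" "(r + 1)\<^sup>2 \<le> 4 * (n - r)"
  shows "generically (\<lambda>T :: 'a tensor. unit_tensor r \<in> zariski_closure (restrictions n n n r T))"
proof -
  obtain c where c: "\<And>i k. i \<le> k \<Longrightarrow> k < r \<Longrightarrow> c i k < n - r"
    "\<And>j i k i' k'. i \<le> j \<Longrightarrow> j \<le> k \<Longrightarrow> k < r \<Longrightarrow> i' \<le> j \<Longrightarrow> j \<le> k' \<Longrightarrow> k' < r \<Longrightarrow>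
       c i k = c i' k' \<Longrightarrow> i = i' \<and> k = k'"
    using interval_coloring[OF assms(3)] by metis
  define T0 :: "'a tensor" where "T0 = seed r c"
  have c': "r + c i k < n" if "i \<le> k" "k < r" for i k using c(1)[OF that] by linarith
  have "\<exists>a b \<alpha> \<beta>. triangular n r r T0 a b \<alpha> \<beta>"
    unfolding T0_def by (rule triangular_vectors[OF c' c(2) \<open>r \<le> n\<close> order_refl])
  then obtain a b \<alpha> \<beta> where tri: "triangular n r r T0 a b \<alpha> \<beta>" by blast
  have ab: "polynomial_fun (a p i)" "polynomial_fun (b p i)" for p i
    using tri by (simp_all add: triangular_def)
  have nz: "\<alpha> p \<noteq> 0 \<and> \<beta> p \<noteq> 0" if "p < r" for p
    using tri that by (simp add: triangular_def)
  have ab0: "a p i T0 = \<alpha> p * (if i = p then 1 else 0) \<and> b p i T0 = \<beta> p * (if i = p then 1 else 0)"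
    if "p < r" "i < n" for p i
    using tri that by (simp add: triangular_def)
  have form: "slice_form n (a p) (b q) k T = 0"
    if "p < r" "q < r" "k < r" "p \<le> k" "q \<le> k" "\<not> (p = k \<and> q = k)" for p q k T
    using tri that by (simp add: triangular_def)
  \<comment> \<open>The only open condition on T: the diagonal values, which serve as divisors of
    the rows of the first map, do not vanish.\<close>
  define h where "h = (\<lambda>T. \<Prod>p<r. slice_form n (a p) (b p) p T)"
  have h: "polynomial_fun h"
    unfolding h_def using ab(1,2) by (intro polynomial_fun_intros polynomial_fun_slice_form)
  have "slice_form n (a p) (b p) p T0 = \<alpha> p * \<beta> p" if "p < r" for p
  proof -
    have "p < n" using that \<open>r \<le> n\<close> by simp
    have "slice_form n (a p) (b p) p T0 =
        (\<Sum>i<n. \<Sum>j<n. if j = p then (if i = p then \<alpha> p * \<beta> p * T0 (i, j, p) else 0) else 0)"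
      unfolding slice_form_def using ab0[OF that] by (intro sum.cong refl) auto
    also have "\<dots> = \<alpha> p * \<beta> p * T0 (p, p, p)"
      using \<open>p < n\<close> by (simp add: sum.delta)
    finally show ?thesis using that by (simp add: T0_def seed_def)
  qed
  then have "h T0 \<noteq> 0" using nz by (auto simp: h_def)
  moreover have "unit_tensor r \<in> zariski_closure (restrictions n n n r T)" if hT: "h T \<noteq> 0" for T
  proof -
    define d where "d = (\<lambda>p. slice_form n (a p) (b p) p T)"
    have d: "d p \<noteq> 0" if "p < r" for p using hT that by (auto simp: h_def d_def)
    define A where "A = mat r n (\<lambda>(p, i). a p i T / d p)"
    define B where "B = mat r n (\<lambda>(p, i). b p i T)"
    define C where "C = mat r n (\<lambda>(k, i). if i = k then 1 else 0 :: 'a)"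
    have map: "tensor_map A B C T (p, q, k) = slice_form n (a p) (b q) k T / d p"
      if "p < r" "q < r" "k < r" for p q k
    proof -
      have "k < n" using that \<open>r \<le> n\<close> by simp
      have "tensor_map A B C T (p, q, k) =
          (\<Sum>i<n. \<Sum>j<n. \<Sum>l<n. A $$ (p, i) * B $$ (q, j) * C $$ (k, l) * T (i, j, l))"
        using that by (simp add: tensor_map_def A_def B_def C_def)
      also have "\<dots> = (\<Sum>i<n. \<Sum>j<n. \<Sum>l<n. if l = k then a p i T / d p * b q j T * T (i, j, k) else 0)"
        using that by (intro sum.cong refl) (auto simp: A_def B_def C_def)
      also have "\<dots> = (\<Sum>i<n. \<Sum>j<n. a p i T / d p * b q j T * T (i, j, k))"
        using \<open>k < n\<close> by (simp add: sum.delta)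
      also have "\<dots> = slice_form n (a p) (b q) k T / d p"
        by (simp add: slice_form_def sum_divide_distrib)
      finally show ?thesis .
    qed
    show ?thesis
    proof (rule degeneration_to_unit_tensor[OF inf, of A r n B C])
      show "tensor_map A B C T (p, q, k) = (if p = k \<and> q = k then 1 else 0)"
        if "p < r" "q < r" "k < r" "p \<le> k" "q \<le> k" for p q k
        using map[OF that(1-3)] form[OF that] d[OF that(1)] by (auto simp: d_def)
    qed (auto simp: A_def B_def C_def)
  qed
  ultimately show ?thesis unfolding generically_def using h by blast
qed

section \<open>The upper bound for the subrank\<close>

lemma homogeneous_solution:
  fixes M :: "'m \<Rightarrow> 'k \<Rightarrow> 'a::field"
  assumes "finite B" "finite S" "card B < card S"
  shows "\<exists>c. (\<exists>m\<in>S. c m \<noteq> 0) \<and> (\<forall>k\<in>B. (\<Sum>m\<in>S. c m * M m k) = 0)"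
  using assms
proof (induction B arbitrary: S M rule: finite_induct)
  case empty
  then have "S \<noteq> {}" by auto
  then show ?case by (intro exI[of _ "\<lambda>_. 1"]) auto
next
  case (insert k B)
  show ?case
  proof (cases "\<forall>m\<in>S. M m k = 0")
    case True
    obtain c where "\<exists>m\<in>S. c m \<noteq> 0" "\<forall>k\<in>B. (\<Sum>m\<in>S. c m * M m k) = 0"
      using insert.IH[of S M] insert.prems insert.hyps by auto
    then show ?thesis using True by (intro exI[of _ c]) auto
  next
    case False
    then obtain m0 where m0: "m0 \<in> S" "M m0 k \<noteq> 0" by blast
    define S' where "S' = S - {m0}"
    have S': "finite S'" "S = insert m0 S'" "m0 \<notin> S'" using insert.prems m0 by (auto simp: S'_def)
    then have "card B < card S'" using insert.prems insert.hyps by auto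
    from insert.IH[OF S'(1) this, of "\<lambda>m l. M m l - M m k / M m0 k * M m0 l"]
    obtain c where c: "\<exists>m\<in>S'. c m \<noteq> 0"
      "\<And>l. l \<in> B \<Longrightarrow> (\<Sum>m\<in>S'. c m * (M m l - M m k / M m0 k * M m0 l)) = 0" by blast
    define c' where "c' = c(m0 := - (\<Sum>m\<in>S'. c m * (M m k / M m0 k)))"
    have c'S': "(\<Sum>m\<in>S'. c' m * M m l) = (\<Sum>m\<in>S'. c m * M m l)" for l
      using S'(3) by (intro sum.cong) (auto simp: c'_def)
    have sum: "(\<Sum>m\<in>S. c' m * M m l) = (\<Sum>m\<in>S'. c m * (M m l - M m k / M m0 k * M m0 l))" for l
      unfolding S'(2) sum.insert[OF S'(1,3)] c'S'
      by (simp add: c'_def right_diff_distrib sum_subtractf sum_distrib_right mult.assoc)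
    have "\<exists>m\<in>S. c' m \<noteq> 0" using c(1) S' by (auto simp: c'_def)
    moreover have "(\<Sum>m\<in>S. c' m * M m l) = 0" if "l \<in> insert k B" for l
      using that c(2) m0(2) unfolding sum by auto
    ultimately show ?thesis by blast
  qed
qed

lemma expands_power:
  assumes "finite P" "expands P d F"
  shows "expands P (k * d) (\<lambda>T x. F T x ^ k)"
proof (induction k)
  case 0
  then show ?case using expands_const[OF assms(1) polynomial_fun.const, of 0 1] by simp
next
  case (Suc k)
  then show ?case using expands_mult[OF assms(1,2)] by simp
qed

lemma expands_prod:
  assumes P: "finite P" and "\<And>s. s \<in> S \<Longrightarrow> expands P (d s) (F s)"
  shows "expands P (\<Sum>s\<in>S. d s) (\<lambda>T x. \<Prod>s\<in>S. F s T x)"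
  using assms(2)
proof (induction S rule: infinite_finite_induct)
  case (insert s S)
  then have "expands P (d s + (\<Sum>s\<in>S. d s)) (\<lambda>T x. F s T x * (\<Prod>s\<in>S. F s T x))"
    by (intro expands_mult P) auto
  then show ?case using insert by simp
qed (use expands_const[OF P polynomial_fun.const, of 0 1] in simp_all)

text \<open>
  There are \<open>(D + 1) ^ card Q\<close> monomials of degree at most \<open>D\<close> in each of the coordinates of the
  target, and composing them with the map gives elements of a space whose dimension is
  \<open>O(D ^ card P)\<close>.
\<close>

lemma generically_not_image:
  fixes \<Phi> :: "'i \<Rightarrow> ('p \<Rightarrow> 'a::field) \<Rightarrow> 'a"
  assumes inf: "infinite (UNIV :: 'a set)" and fin: "finite P" "finite Q" and card: "card P < card Q"
    and \<Phi>: "\<And>q. q \<in> Q \<Longrightarrow> polynomial_fun (\<Phi> q)"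
    and dep: "\<And>q x. q \<in> Q \<Longrightarrow> \<Phi> q x = \<Phi> q (\<lambda>p. if p \<in> P then x p else 0)"
  shows "generically (\<lambda>y. \<not> (\<exists>x. \<forall>q\<in>Q. y q = \<Phi> q x))"
proof -
  \<comment> \<open>There are no parameters here; \<open>unit => 'a\<close> serves as a dummy
    parameter space for \<open>expands\<close>.\<close>
  have "\<forall>q\<in>Q. \<exists>d. expands P d (\<lambda>(T :: unit \<Rightarrow> 'a) x. \<Phi> q x)"
  proof
    fix q assume q: "q \<in> Q"
    have "polynomial_fun (\<lambda>z :: unit + 'p \<Rightarrow> 'a. \<Phi> q (\<lambda>p. z (Inr p)))"
      by (intro polynomial_fun_compose[OF \<Phi>[OF q]] polynomial_fun.coord)
    from polynomial_fun_expands[OF fin(1) this]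
    show "\<exists>d. expands P d (\<lambda>(T :: unit \<Rightarrow> 'a) x. \<Phi> q x)" by (simp flip: dep[OF q])
  qed
  then obtain d where d: "\<And>q. q \<in> Q \<Longrightarrow> expands P (d q) (\<lambda>(T :: unit \<Rightarrow> 'a) x. \<Phi> q x)" by metis
  define \<delta> where "\<delta> = (\<Sum>q\<in>Q. d q)"
  have \<delta>: "expands P \<delta> (\<lambda>(T :: unit \<Rightarrow> 'a) x. \<Phi> q x)" if "q \<in> Q" for q
    using that fin(2) by (intro expands_mono[OF fin(1) d]) (auto simp: \<delta>_def intro: member_le_sum)
  \<comment> \<open>Since E + 1 is at most (\<delta> * card Q + 1) * (D + 1), its power with
    exponent card P is at most D * (D + 1) ^ card P by this choice of D. The factor D is beaten by
    the additional factor D + 1 that card Q > card P provides.\<close>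
  define D where "D = (\<delta> * card Q + 1) ^ card P"
  define E where "E = \<delta> * card Q * D"
  have ex: "expands P E (\<lambda>(T :: unit \<Rightarrow> 'a) x. mon m (\<lambda>q. \<Phi> q x))" if "m \<in> box Q D" for m
  proof -
    have m: "keys m \<subseteq> Q" "\<And>q. lookup m q \<le> D" using that by (auto simp: box_def)
    have "expands P (\<Sum>q\<in>Q. lookup m q * \<delta>) (\<lambda>(T :: unit \<Rightarrow> 'a) x. \<Prod>q\<in>Q. \<Phi> q x ^ lookup m q)"
      by (intro expands_prod expands_power fin \<delta>)
    moreover have "(\<Sum>q\<in>Q. lookup m q * \<delta>) \<le> E"
    proof -
      have "(\<Sum>q\<in>Q. lookup m q * \<delta>) \<le> (\<Sum>q\<in>Q. D * \<delta>)"
        by (intro sum_mono mult_right_mono m) auto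
      then show ?thesis by (simp add: E_def mult_ac)
    qed
    ultimately show ?thesis
      using expands_mono[OF fin(1)] by (simp add: mon_eq[OF fin(2) m(1)])
  qed
  have "\<forall>m\<in>box Q D. \<exists>c. \<forall>x. mon m (\<lambda>q. \<Phi> q x) = (\<Sum>k\<in>box P E. c k * mon k x)"
  proof
    fix m assume "m \<in> box Q D"
    from ex[OF this] obtain c where
      "\<forall>(T :: unit \<Rightarrow> 'a) x. mon m (\<lambda>q. \<Phi> q x) = (\<Sum>k\<in>box P E. c k T * mon k x)"
      unfolding expands_def by blast
    then show "\<exists>c. \<forall>x. mon m (\<lambda>q. \<Phi> q x) = (\<Sum>k\<in>box P E. c k * mon k x)"
      by (intro exI[of _ "\<lambda>k. c k undefined"]) simp
  qed
  then obtain M where M: "\<And>m x. m \<in> box Q D \<Longrightarrow> mon m (\<lambda>q. \<Phi> q x) = (\<Sum>k\<in>box P E. M m k * mon k x)"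
    by metis
  have "card (box P E) < card (box Q D)"
  proof -
    have "Suc E \<le> (\<delta> * card Q + 1) * Suc D" by (simp add: E_def)
    then have "Suc E ^ card P \<le> D * Suc D ^ card P"
      unfolding D_def by (metis power_mono power_mult_distrib zero_le)
    also have "\<dots> < Suc D ^ Suc (card P)" by simp
    also have "\<dots> \<le> Suc D ^ card Q" using card by (intro power_increasing) auto
    finally show ?thesis using fin by (simp add: card_box)
  qed
  from homogeneous_solution[OF finite_box[OF fin(1)] finite_box[OF fin(2)] this, of M]
  obtain c where c: "\<exists>m\<in>box Q D. c m \<noteq> 0"
    "\<And>k. k \<in> box P E \<Longrightarrow> (\<Sum>m\<in>box Q D. c m * M m k) = 0" by blast
  define h where "h = (\<lambda>y :: 'i \<Rightarrow> 'a. \<Sum>m\<in>box Q D. c m * mon m y)"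
  have "polynomial_fun h"
    unfolding h_def by (intro polynomial_fun_intros polynomial_fun_mon)
  moreover have "\<exists>y. h y \<noteq> 0"
    using mon_independent[OF inf fin(2), where c = c and d = D] c(1) unfolding h_def by blast
  moreover have "h y = 0" if y: "\<forall>q\<in>Q. y q = \<Phi> q x" for x y
  proof -
    have "h y = (\<Sum>m\<in>box Q D. c m * mon m (\<lambda>q. \<Phi> q x))"
      unfolding h_def
      by (intro sum.cong refl arg_cong2[of _ _ _ _ "(*)"] mon_cong) (use y in \<open>auto simp: box_def\<close>)
    also have "\<dots> = (\<Sum>m\<in>box Q D. \<Sum>k\<in>box P E. c m * M m k * mon k x)"
      by (simp add: M sum_distrib_left mult.assoc)
    also have "\<dots> = (\<Sum>k\<in>box P E. (\<Sum>m\<in>box Q D. c m * M m k) * mon k x)"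
      by (subst sum.swap) (simp add: sum_distrib_right)
    also have "\<dots> = 0" by (simp add: c(2))
    finally show ?thesis .
  qed
  ultimately show ?thesis unfolding generically_def by blast
qed

text \<open>A matrix with a right inverse has an invertible maximal minor, whose inverse is U. Take
  a smallest set I of columns on which a right inverse still exists. More than r columns would be
  linearly dependent and one could be dropped; fewer than r cannot have r independent rows.\<close>

lemma column_selection:
  fixes A :: "nat \<Rightarrow> nat \<Rightarrow> 'a::field"
  assumes AW: "\<And>a b. a < r \<Longrightarrow> b < r \<Longrightarrow> (\<Sum>i<n. A a i * W i b) = (if a = b then 1 else 0)"
  shows "\<exists>\<sigma> U. inj_on \<sigma> {..<r} \<and> \<sigma> ` {..<r} \<subseteq> {..<n} \<and>
    (\<forall>a<r. \<forall>b<r. (\<Sum>s<r. U a s * A s (\<sigma> b)) = (if a = b then 1 else 0))"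
proof -
  define good where "good = (\<lambda>I. I \<subseteq> {..<n} \<and>
    (\<exists>W. \<forall>a<r. \<forall>b<r. (\<Sum>i\<in>I. A a i * W i b) = (if a = b then 1 else 0)))"
  have "good {..<n}" unfolding good_def using AW by blast
  from ex_has_least_nat[of good, OF this, of card]
  obtain I where I: "good I" "\<And>I'. good I' \<Longrightarrow> card I \<le> card I'" by blast
  then obtain W where W: "\<And>a b. a < r \<Longrightarrow> b < r \<Longrightarrow> (\<Sum>i\<in>I. A a i * W i b) = (if a = b then 1 else 0)"
    unfolding good_def by blast
  have In: "I \<subseteq> {..<n}" using I(1) by (simp add: good_def)
  then have fin: "finite I" by (rule finite_subset) simp
  have "card I \<le> r"
  proof (rule ccontr)
    assume "\<not> card I \<le> r"
    then have "card {..<r} < card I" by simp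
    from homogeneous_solution[OF _ fin this, of "\<lambda>i a. A a i"]
    obtain c i0 where c: "i0 \<in> I" "c i0 \<noteq> 0" "\<And>a. a < r \<Longrightarrow> (\<Sum>i\<in>I. c i * A a i) = 0" by auto
    \<comment> \<open>Subtracting multiples of the dependency c changes no product with A, and the
      factor makes row \<open>i0\<close> vanish.\<close>
    define W' where "W' = (\<lambda>i b. W i b - c i * (W i0 b / c i0))"
    have "(\<Sum>i\<in>I - {i0}. A a i * W' i b) = (if a = b then 1 else 0)" if ab: "a < r" "b < r" for a b
    proof -
      have "(\<Sum>i\<in>I - {i0}. A a i * W' i b) = (\<Sum>i\<in>I. A a i * W' i b)"
        using c fin by (intro sum.mono_neutral_left) (auto simp: W'_def)
      also have "\<dots> = (\<Sum>i\<in>I. A a i * W i b) - (\<Sum>i\<in>I. c i * A a i) * (W i0 b / c i0)"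
        by (simp add: W'_def right_diff_distrib sum_subtractf sum_distrib_left sum_divide_distrib mult_ac)
      finally show ?thesis using W[OF ab] c(3)[OF ab(1)] by simp
    qed
    then have "good (I - {i0})" unfolding good_def using In by blast
    from I(2)[OF this] have "card I \<le> card I - 1" using c(1) by simp
    moreover have "0 < card I" using c(1) fin by (auto simp: card_gt_0_iff)
    ultimately show False by linarith
  qed
  moreover have "r \<le> card I"
  proof (rule ccontr)
    assume "\<not> r \<le> card I"
    then have "card I < card {..<r}" by simp
    from homogeneous_solution[OF fin _ this, of "\<lambda>b i. W i b"]
    obtain d b0 where d: "b0 < r" "d b0 \<noteq> 0" "\<And>i. i \<in> I \<Longrightarrow> (\<Sum>b<r. d b * W i b) = 0" by auto
    have "d b0 = (\<Sum>b<r. d b * (if b0 = b then 1 else 0))"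
      using d(1) by (simp add: if_distrib[of "\<lambda>z. _ * z"] cong: if_cong)
    also have "\<dots> = (\<Sum>b<r. d b * (\<Sum>i\<in>I. A b0 i * W i b))"
      using W[OF d(1)] by (intro sum.cong) auto
    also have "\<dots> = (\<Sum>i\<in>I. A b0 i * (\<Sum>b<r. d b * W i b))"
      unfolding sum_distrib_left by (subst sum.swap) (simp add: mult_ac)
    also have "\<dots> = 0" by (simp add: d(3))
    finally show False using d(2) by simp
  qed
  ultimately have "card I = r" by simp
  then obtain \<sigma> where \<sigma>: "bij_betw \<sigma> {0..<r} I" using ex_bij_betw_nat_finite[OF fin] by auto
  define MA where "MA = mat r r (\<lambda>(a, b). A a (\<sigma> b))"
  define MW where "MW = mat r r (\<lambda>(b, c). W (\<sigma> b) c)"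
  have "MA * MW = 1\<^sub>m r"
  proof (rule eq_matI)
    fix a b assume "a < dim_row (1\<^sub>m r :: 'a mat)" "b < dim_col (1\<^sub>m r :: 'a mat)"
    then have ab: "a < r" "b < r" by auto
    then have "(MA * MW) $$ (a, b) = (\<Sum>s\<in>{0..<r}. A a (\<sigma> s) * W (\<sigma> s) b)"
      by (simp add: MA_def MW_def scalar_prod_def)
    also have "\<dots> = (\<Sum>i\<in>I. A a i * W i b)" by (rule sum.reindex_bij_betw[OF \<sigma>])
    finally show "(MA * MW) $$ (a, b) = 1\<^sub>m r $$ (a, b)" using W[OF ab] ab by simp
  qed (simp_all add: MA_def MW_def)
  then have MW: "MW * MA = 1\<^sub>m r"
    by (rule mat_mult_left_right_inverse[rotated 2]) (simp_all add: MA_def MW_def)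
  have "(\<Sum>s<r. W (\<sigma> a) s * A s (\<sigma> b)) = (if a = b then 1 else 0)" if "a < r" "b < r" for a b
  proof -
    have "(\<Sum>s<r. W (\<sigma> a) s * A s (\<sigma> b)) = (MW * MA) $$ (a, b)"
      using that by (simp add: MA_def MW_def scalar_prod_def atLeast0LessThan)
    then show ?thesis using that by (simp add: MW)
  qed
  then show ?thesis
    using \<sigma> In by (intro exI[of _ \<sigma>] exI[of _ "\<lambda>a s. W (\<sigma> a) s"])
      (auto simp: bij_betw_def atLeast0LessThan)
qed

section \<open>Restrictions in coordinates\<close>

definition cube :: "nat \<Rightarrow> (nat \<times> nat \<times> nat) set" where
  "cube n = {..<n} \<times> {..<n} \<times> {..<n}"

lemma cube: "finite (cube n)" "card (cube n) = n ^ 3" "(i, j, k) \<in> cube n \<longleftrightarrow> i < n \<and> j < n \<and> k < n"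
  by (auto simp: cube_def card_cartesian_product power3_eq_cube)

lemma sum_cube: "(\<Sum>(i, j, k)\<in>cube n. f i j k) = (\<Sum>i<n. \<Sum>j<n. \<Sum>k<n. f i j k)"
  by (simp add: cube_def sum.cartesian_product)

lemma sum_triple_product:
  fixes f g h :: "'b \<Rightarrow> 'a::comm_ring_1"
  shows "(\<Sum>s\<in>A. f s) * (\<Sum>s\<in>B. g s) * (\<Sum>s\<in>C. h s) = (\<Sum>s\<in>A. \<Sum>s'\<in>B. \<Sum>s''\<in>C. f s * g s' * h s'')"
  by (simp only: sum_distrib_left[symmetric] sum_distrib_right[symmetric])

definition multilinear :: "(nat \<Rightarrow> nat \<Rightarrow> nat \<Rightarrow> 'a::comm_ring_1) \<Rightarrow> nat \<Rightarrow> nat \<Rightarrow> nat \<Rightarrow> nat \<times> nat \<times> nat \<Rightarrow> 'a" where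
  "multilinear X a b c = (\<lambda>(i, j, k). X 0 a i * X 1 b j * X 2 c k)"

text \<open>The three linear maps are collected in one family \<open>X m\<close>, \<open>m < 3\<close>.\<close>

lemma mem_restrictions_iff:
  "S \<in> restrictions n n n r T \<longleftrightarrow>
     (\<forall>q. q \<notin> cube r \<longrightarrow> S q = 0) \<and>
     (\<exists>X. \<forall>(a, b, c)\<in>cube r. S (a, b, c) = (\<Sum>p\<in>cube n. multilinear X a b c p * T p))"
proof
  assume "S \<in> restrictions n n n r T"
  then obtain A B C where ABC: "A \<in> carrier_mat r n" "B \<in> carrier_mat r n" "C \<in> carrier_mat r n"
    and S: "S = tensor_map A B C T" by (auto simp: restrictions_def)
  define X where "X = (\<lambda>m a i. if m = (0::nat) then A $$ (a, i) else if m = 1 then B $$ (a, i) else C $$ (a, i))"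
  have "S (a, b, c) = (\<Sum>p\<in>cube n. multilinear X a b c p * T p)" if "(a, b, c) \<in> cube r" for a b c
  proof -
    have "(\<Sum>p\<in>cube n. multilinear X a b c p * T p) =
        (\<Sum>(i, j, k)\<in>cube n. A $$ (a, i) * B $$ (b, j) * C $$ (c, k) * T (i, j, k))"
      by (intro sum.cong) (auto simp: multilinear_def X_def)
    then show ?thesis using that ABC by (simp add: S tensor_map_def sum_cube cube)
  qed
  moreover have "S q = 0" if "q \<notin> cube r" for q
    using that ABC by (auto simp: S tensor_map_def cube split: prod.splits)
  ultimately show "(\<forall>q. q \<notin> cube r \<longrightarrow> S q = 0) \<and>
     (\<exists>X. \<forall>(a, b, c)\<in>cube r. S (a, b, c) = (\<Sum>p\<in>cube n. multilinear X a b c p * T p))" by blast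
next
  assume *: "(\<forall>q. q \<notin> cube r \<longrightarrow> S q = 0) \<and>
     (\<exists>X. \<forall>(a, b, c)\<in>cube r. S (a, b, c) = (\<Sum>p\<in>cube n. multilinear X a b c p * T p))"
  then obtain X where X: "\<And>a b c. (a, b, c) \<in> cube r \<Longrightarrow>
    S (a, b, c) = (\<Sum>p\<in>cube n. multilinear X a b c p * T p)" by blast
  have "S = tensor_map (mat r n (\<lambda>(a, i). X 0 a i)) (mat r n (\<lambda>(a, i). X 1 a i)) (mat r n (\<lambda>(a, i). X 2 a i)) T"
  proof
    fix q :: "nat \<times> nat \<times> nat"
    obtain a b c where q: "q = (a, b, c)" using prod_cases3 by blast
    show "S q = tensor_map (mat r n (\<lambda>(a, i). X 0 a i)) (mat r n (\<lambda>(a, i). X 1 a i)) (mat r n (\<lambda>(a, i). X 2 a i)) T q"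
    proof (cases "(a, b, c) \<in> cube r")
      case True
      have "(\<Sum>p\<in>cube n. multilinear X a b c p * T p) =
        (\<Sum>(i, j, k)\<in>cube n. X 0 a i * X 1 b j * X 2 c k * T (i, j, k))"
        by (intro sum.cong) (auto simp: multilinear_def)
      then show ?thesis using X[OF True] True by (simp add: q tensor_map_def sum_cube cube)
    next
      case False
      then show ?thesis using * by (auto simp: q tensor_map_def cube)
    qed
  qed
  then show "S \<in> restrictions n n n r T"
    unfolding restrictions_def by (intro CollectI exI conjI) auto
qed

lemma restrictions_cong:
  fixes T T' :: "'a::comm_ring_1 tensor"
  assumes "\<And>p. p \<in> cube n \<Longrightarrow> T p = T' p"
  shows "restrictions n n n r T = restrictions n n n r T'"
proof -
  have "(\<Sum>p\<in>cube n. multilinear X a b c p * T p) = (\<Sum>p\<in>cube n. multilinear X a b c p * T' p)" for X a b c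
    using assms by (intro sum.cong) auto
  then show ?thesis by (auto simp: mem_restrictions_iff)
qed

type_synonym parameter = "(nat \<times> nat \<times> nat) + (nat \<times> nat \<times> nat)"

text \<open>
  If \<open>T\<close> restricts to the unit tensor, then after selecting columns in which the three maps are
  invertible, and inverting these minors, the entries of \<open>T\<close> in the selected block are determined
  by the remaining entries and by the coefficients \<open>x (Inr (m, a, i))\<close> of the maps. For a selected
  column \<open>i\<close> the normalized map is known, and \<open>x (Inr (m, a, i))\<close> stores the inverted minor instead.
\<close>

definition block :: "(nat \<Rightarrow> nat \<Rightarrow> nat) \<Rightarrow> nat \<Rightarrow> (nat \<times> nat \<times> nat) set" where
  "block \<sigma> r = \<sigma> 0 ` {..<r} \<times> \<sigma> 1 ` {..<r} \<times> \<sigma> 2 ` {..<r}"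

definition normalized :: "(nat \<Rightarrow> nat \<Rightarrow> nat) \<Rightarrow> nat \<Rightarrow> ('b + nat \<times> nat \<times> nat \<Rightarrow> 'a::comm_ring_1) \<Rightarrow>
    nat \<Rightarrow> nat \<Rightarrow> nat \<Rightarrow> 'a" where
  "normalized \<sigma> r x m a i =
     (if i \<in> \<sigma> m ` {..<r} then if i = \<sigma> m a then 1 else 0 else x (Inr (m, a, i)))"

text \<open>Multiplying the three maps by the inverted minors turns the unit tensor into the first
  sum. On the other side the normalized maps are the identity on the selected columns, so inside the
  block only the entry q contributes to position (a, b, c). The formula is this equation solved for
  that entry.\<close>

definition parametrization :: "(nat \<Rightarrow> nat \<Rightarrow> nat) \<Rightarrow> nat \<Rightarrow> nat \<Rightarrow> nat \<times> nat \<times> nat \<Rightarrow>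
    (parameter \<Rightarrow> 'a::comm_ring_1) \<Rightarrow> 'a" where
  "parametrization \<sigma> r n q x = (if q \<in> block \<sigma> r then
     (case q of (i, j, k) \<Rightarrow>
       let a = inv_into {..<r} (\<sigma> 0) i; b = inv_into {..<r} (\<sigma> 1) j; c = inv_into {..<r} (\<sigma> 2) k in
       (\<Sum>s<r. multilinear (\<lambda>m a s. x (Inr (m, a, \<sigma> m s))) a b c (s, s, s)) -
       (\<Sum>p\<in>cube n - block \<sigma> r. multilinear (normalized \<sigma> r x) a b c p * x (Inl p)))
     else x (Inl q))"

lemma polynomial_fun_parametrization: "polynomial_fun (parametrization \<sigma> r n q)"
proof -
  have norm: "polynomial_fun (\<lambda>x :: parameter \<Rightarrow> 'a. normalized \<sigma> r x m a i)" for m a i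
    by (cases "i \<in> \<sigma> m ` {..<r}"; cases "i = \<sigma> m a")
      (simp_all add: normalized_def polynomial_fun.const polynomial_fun.coord)
  obtain i j k where q: "q = (i, j, k)" using prod_cases3 by blast
  have mult: "polynomial_fun (\<lambda>x :: parameter \<Rightarrow> 'a. multilinear (normalized \<sigma> r x) a b c p)"
    "polynomial_fun (\<lambda>x :: parameter \<Rightarrow> 'a. multilinear (\<lambda>m a s. x (Inr (m, a, \<sigma> m s))) a b c p)"
    for a b c p
    by (cases p; simp add: multilinear_def; intro polynomial_fun_intros norm)+
  have "polynomial_fun (\<lambda>x :: parameter \<Rightarrow> 'a. parametrization \<sigma> r n q x)"
    unfolding parametrization_def Let_def q prod.case by (intro polynomial_fun_intros mult)
  then show ?thesis by simp
qed

lemma normalized_tensor: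
  fixes T :: "'a::field tensor"
  assumes \<sigma>: "\<And>m. m < 3 \<Longrightarrow> inj_on (\<sigma> m) {..<r} \<and> \<sigma> m ` {..<r} \<subseteq> {..<n}"
    and U: "\<And>m a b. m < 3 \<Longrightarrow> a < r \<Longrightarrow> b < r \<Longrightarrow> (\<Sum>s<r. U m a s * X m s (\<sigma> m b)) = (if a = b then 1 else 0)"
    and X: "\<And>a b c. (a, b, c) \<in> cube r \<Longrightarrow>
      (\<Sum>p\<in>cube n. multilinear X a b c p * T p) = unit_tensor r (a, b, c)"
  defines "x \<equiv> case_sum T (\<lambda>(m, a, i). if i \<in> \<sigma> m ` {..<r} then U m a (inv_into {..<r} (\<sigma> m) i)
      else \<Sum>s<r. U m a s * X m s i)"
  assumes q: "q \<in> cube n"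
  shows "T q = parametrization \<sigma> r n q x"
proof (cases "q \<in> block \<sigma> r")
  case False
  then show ?thesis by (simp add: parametrization_def x_def)
next
  case True
  then obtain a b c where abc: "a < r" "b < r" "c < r" and q_abc: "q = (\<sigma> 0 a, \<sigma> 1 b, \<sigma> 2 c)"
    by (auto simp: block_def)
  have inj: "inj_on (\<sigma> 0) {..<r}" "inj_on (\<sigma> 1) {..<r}" "inj_on (\<sigma> 2) {..<r}" using \<sigma> by auto
  have inv: "inv_into {..<r} (\<sigma> m) (\<sigma> m s) = s" if "m < 3" "s < r" for m s
    using that \<sigma> by (auto intro: inv_into_f_f)
  define G where "G = (\<lambda>m a i. \<Sum>s<r. U m a s * X m s i)"
  have G: "normalized \<sigma> r x m a i = G m a i" if "m < 3" "a < r" for m a i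
  proof (cases "i \<in> \<sigma> m ` {..<r}")
    case True
    then obtain s where s: "s < r" "i = \<sigma> m s" by auto
    have "G m a i = (if a = s then 1 else 0)" using U[OF that s(1)] by (simp add: G_def s)
    moreover have "\<sigma> m s = \<sigma> m a \<longleftrightarrow> a = s" using \<sigma>[OF that(1)] that(2) s(1) by (auto dest: inj_onD)
    ultimately show ?thesis using True by (simp add: normalized_def s)
  next
    case False
    then show ?thesis by (simp add: normalized_def x_def G_def)
  qed
  have "multilinear G a b c p * T p =
      (\<Sum>(s, s', s'')\<in>cube r. U 0 a s * U 1 b s' * U 2 c s'' * (multilinear X s s' s'' p * T p))" for p
  proof -
    obtain i j k where p: "p = (i, j, k)" using prod_cases3 by blast
    have "multilinear G a b c p = (\<Sum>s<r. \<Sum>s'<r. \<Sum>s''<r.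
        (U 0 a s * X 0 s i) * (U 1 b s' * X 1 s' j) * (U 2 c s'' * X 2 s'' k))"
      by (simp add: p multilinear_def G_def sum_triple_product)
    then show ?thesis by (simp add: p sum_cube multilinear_def sum_distrib_left mult_ac)
  qed
  then have "(\<Sum>p\<in>cube n. multilinear G a b c p * T p) =
      (\<Sum>p\<in>cube n. \<Sum>(s, s', s'')\<in>cube r. U 0 a s * U 1 b s' * U 2 c s'' * (multilinear X s s' s'' p * T p))"
    by (rule sum.cong[OF refl])
  also have "\<dots> = (\<Sum>(s, s', s'')\<in>cube r. U 0 a s * U 1 b s' * U 2 c s'' * (\<Sum>p\<in>cube n. multilinear X s s' s'' p * T p))"
    by (subst sum.swap) (simp add: sum_distrib_left split_beta)
  also have "\<dots> = (\<Sum>(s, s', s'')\<in>cube r. if s'' = s then if s' = s then U 0 a s * U 1 b s * U 2 c s else 0 else 0)"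
    by (intro sum.cong refl) (auto simp: X unit_tensor_def cube)
  also have "\<dots> = (\<Sum>s<r. U 0 a s * U 1 b s * U 2 c s)"
    unfolding sum_cube by (simp add: sum.delta)
  finally have total: "(\<Sum>p\<in>cube n. multilinear G a b c p * T p) = (\<Sum>s<r. U 0 a s * U 1 b s * U 2 c s)" .
  have sub: "block \<sigma> r \<subseteq> cube n"
    using \<sigma>[of 0] \<sigma>[of 1] \<sigma>[of 2] unfolding block_def cube_def by (intro Sigma_mono) auto
  have "(\<Sum>p\<in>block \<sigma> r. multilinear G a b c p * T p) = (\<Sum>p\<in>{q}. multilinear G a b c p * T p)"
  proof (rule sum.mono_neutral_right)
    show "finite (block \<sigma> r)" using sub cube(1) by (rule finite_subset)
    show "{q} \<subseteq> block \<sigma> r" using True by simp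
    show "\<forall>p\<in>block \<sigma> r - {q}. multilinear G a b c p * T p = 0"
    proof
      fix p assume "p \<in> block \<sigma> r - {q}"
      then obtain a' b' c' where p: "p = (\<sigma> 0 a', \<sigma> 1 b', \<sigma> 2 c')" "a' < r" "b' < r" "c' < r"
        "\<not> (a' = a \<and> b' = b \<and> c' = c)" by (auto simp: block_def q_abc)
      then show "multilinear G a b c p * T p = 0"
        using U[of 0 a a'] U[of 1 b b'] U[of 2 c c'] abc by (auto simp: multilinear_def G_def)
    qed
  qed
  also have "\<dots> = T q"
    using U[of 0 a a] U[of 1 b b] U[of 2 c c] abc by (simp add: q_abc multilinear_def G_def)
  finally have "T q = (\<Sum>p\<in>cube n. multilinear G a b c p * T p) - (\<Sum>p\<in>cube n - block \<sigma> r. multilinear G a b c p * T p)"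
    using sum.subset_diff[OF sub cube(1), of "\<lambda>p. multilinear G a b c p * T p"] by simp
  moreover have "(\<Sum>p\<in>cube n - block \<sigma> r. multilinear G a b c p * T p) =
      (\<Sum>p\<in>cube n - block \<sigma> r. multilinear (normalized \<sigma> r x) a b c p * x (Inl p))"
  proof (rule sum.cong[OF refl])
    fix p
    have "multilinear (normalized \<sigma> r x) a b c p = multilinear G a b c p"
      using abc by (cases p) (simp add: multilinear_def G)
    then show "multilinear G a b c p * T p = multilinear (normalized \<sigma> r x) a b c p * x (Inl p)"
      by (simp add: x_def)
  qed
  moreover have "(\<Sum>s<r. U 0 a s * U 1 b s * U 2 c s) =
      (\<Sum>s<r. multilinear (\<lambda>m a s. x (Inr (m, a, \<sigma> m s))) a b c (s, s, s))"
    by (intro sum.cong refl) (auto simp: multilinear_def x_def inv)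
  ultimately show ?thesis
    using True inv abc by (simp add: parametrization_def q_abc total)
qed

text \<open>Every tensor restricting to the unit tensor lies in the image of the parametrization for
  some selection of columns. There are finitely many selections, and a generic tensor avoids each
  image by the parameter count.\<close>

lemma generically_subrank_less:
  assumes inf: "infinite (UNIV :: 'a::field set)" and r: "3 * n < r\<^sup>2"
  shows "generically (\<lambda>T :: 'a tensor. unit_tensor r \<notin> restrictions n n n r T)"
proof -
  \<comment> \<open>Selections are extensional functions, which makes their set finite.\<close>
  define Inj where "Inj = {\<tau> \<in> {..<r} \<rightarrow>\<^sub>E {..<n}. inj_on \<tau> {..<r}}"
  define Sel where "Sel = ({..<3::nat} \<rightarrow>\<^sub>E Inj)"
  have "finite Inj" unfolding Inj_def by (intro finite_subset[OF _ finite_PiE[of "{..<r}" "\<lambda>_. {..<n}"]]) auto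
  then have "finite Sel" unfolding Sel_def by (intro finite_PiE) auto
  define P where "P = (\<lambda>\<sigma>. Inl ` (cube n - block \<sigma> r) \<union> Inr ` ({..<3} \<times> {..<r} \<times> {..<n}) ::
    parameter set)"
  define cut where "cut = (\<lambda>\<sigma> x p. if p \<in> P \<sigma> then x p else (0::'a))"
  have inj: "inj_on (\<sigma> m) {..<r} \<and> \<sigma> m ` {..<r} \<subseteq> {..<n}" if "\<sigma> \<in> Sel" "m < 3" for \<sigma> m
    using that by (auto simp: Sel_def Inj_def PiE_iff)
  have sub: "block \<sigma> r \<subseteq> cube n" if "\<sigma> \<in> Sel" for \<sigma>
    using inj[OF that, of 0] inj[OF that, of 1] inj[OF that, of 2]
    unfolding block_def cube_def by (intro Sigma_mono) auto
  have "generically (\<lambda>T. \<not> (\<exists>x. \<forall>q\<in>cube n. T q = parametrization \<sigma> r n q (cut \<sigma> x)))"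
    if sel: "\<sigma> \<in> Sel" for \<sigma>
  proof (rule generically_not_image[OF inf _ cube(1), of "P \<sigma>"])
    show "finite (P \<sigma>)" using cube(1) by (auto simp: P_def)
    have card_block: "card (block \<sigma> r) = r ^ 3"
      using inj[OF sel, of 0] inj[OF sel, of 1] inj[OF sel, of 2]
      by (simp add: block_def card_cartesian_product card_image power3_eq_cube)
    have fin: "finite (block \<sigma> r)" using sub[OF sel] cube(1) by (rule finite_subset)
    have "card (P \<sigma>) = card (Inl ` (cube n - block \<sigma> r) :: parameter set) +
        card (Inr ` ({..<3} \<times> {..<r} \<times> {..<n}) :: parameter set)"
      unfolding P_def using cube(1) by (intro card_Un_disjoint) auto
    also have "\<dots> = (n ^ 3 - r ^ 3) + 3 * (r * n)"
      using card_Diff_subset[OF fin sub[OF sel]]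
      by (simp add: card_image card_cartesian_product card_block cube(2))
    finally have "card (P \<sigma>) = (n ^ 3 - r ^ 3) + 3 * (r * n)" .
    moreover have "r ^ 3 \<le> n ^ 3"
      using card_mono[OF cube(1) sub[OF sel]] by (simp add: card_block cube(2))
    moreover have "3 * (r * n) < r ^ 3"
    proof -
      have "0 < r" using r by (cases r) auto
      then have "r * (3 * n) < r * r\<^sup>2" using r by simp
      then show ?thesis by (simp add: power3_eq_cube power2_eq_square mult_ac)
    qed
    ultimately show "card (P \<sigma>) < card (cube n)" unfolding cube(2) by linarith
    show "polynomial_fun (\<lambda>x. parametrization \<sigma> r n q (cut \<sigma> x))" for q
      unfolding cut_def
      by (intro polynomial_fun_compose[OF polynomial_fun_parametrization] polynomial_fun_intros)
    show "parametrization \<sigma> r n q (cut \<sigma> x) = parametrization \<sigma> r n q (cut \<sigma> (\<lambda>p. if p \<in> P \<sigma> then x p else 0))" for q x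
      by (simp add: cut_def cong: if_cong)
  qed
  then have "generically (\<lambda>T. \<forall>\<sigma>\<in>Sel. \<not> (\<exists>x. \<forall>q\<in>cube n. T q = parametrization \<sigma> r n q (cut \<sigma> x)))"
    by (intro generically_ball[OF inf \<open>finite Sel\<close>])
  then show ?thesis
  proof (rule generically_mono)
    fix T :: "'a tensor"
    assume T: "\<forall>\<sigma>\<in>Sel. \<not> (\<exists>x. \<forall>q\<in>cube n. T q = parametrization \<sigma> r n q (cut \<sigma> x))"
    show "unit_tensor r \<notin> restrictions n n n r T"
    proof
      assume "unit_tensor r \<in> restrictions n n n r T"
      then obtain X where X: "\<And>a b c. (a, b, c) \<in> cube r \<Longrightarrow>
        (\<Sum>p\<in>cube n. multilinear X a b c p * T p) = unit_tensor r (a, b, c)"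
        unfolding mem_restrictions_iff by fastforce
      \<comment> \<open>Each map has a right inverse: setting the other two target indices equal to
        b and contracting T with the other two maps gives its column b, because the entry of the
        unit tensor is then 1 exactly if a = b.\<close>
      have W: "\<exists>W. \<forall>a<r. \<forall>b<r. (\<Sum>i<n. X m a i * W i b) = (if a = b then 1 else 0)" if m: "m < 3" for m
      proof -
        consider "m = 0" | "m = 1" | "m = 2" using m by linarith
        then show ?thesis
        proof cases
          case 1
          have "(\<Sum>i<n. X 0 a i * (\<Sum>j<n. \<Sum>k<n. X 1 b j * X 2 b k * T (i, j, k))) = (if a = b then 1 else 0)"
            if "a < r" "b < r" for a b
          proof -
            have "(\<Sum>p\<in>cube n. multilinear X a b b p * T p) =
                (\<Sum>i<n. X 0 a i * (\<Sum>j<n. \<Sum>k<n. X 1 b j * X 2 b k * T (i, j, k)))"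
              by (simp add: cube_def sum.cartesian_product' multilinear_def sum_distrib_left mult.assoc)
            then show ?thesis using X[of a b b] that by (simp add: cube unit_tensor_def)
          qed
          then show ?thesis using 1
            by (intro exI[of _ "\<lambda>i b. \<Sum>j<n. \<Sum>k<n. X 1 b j * X 2 b k * T (i, j, k)"]) auto
        next
          case 2
          have "(\<Sum>j<n. X 1 a j * (\<Sum>i<n. \<Sum>k<n. X 0 b i * X 2 b k * T (i, j, k))) = (if a = b then 1 else 0)"
            if "a < r" "b < r" for a b
          proof -
            have "(\<Sum>p\<in>cube n. multilinear X b a b p * T p) =
                (\<Sum>i<n. \<Sum>j<n. \<Sum>k<n. X 1 a j * (X 0 b i * X 2 b k * T (i, j, k)))"
              by (simp add: cube_def sum.cartesian_product' multilinear_def mult_ac)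
            also have "\<dots> = (\<Sum>j<n. X 1 a j * (\<Sum>i<n. \<Sum>k<n. X 0 b i * X 2 b k * T (i, j, k)))"
              by (subst sum.swap) (simp add: sum_distrib_left)
            finally show ?thesis using X[of b a b] that by (auto simp: cube unit_tensor_def)
          qed
          then show ?thesis using 2
            by (intro exI[of _ "\<lambda>j b. \<Sum>i<n. \<Sum>k<n. X 0 b i * X 2 b k * T (i, j, k)"]) auto
        next
          case 3
          have "(\<Sum>k<n. X 2 a k * (\<Sum>i<n. \<Sum>j<n. X 0 b i * X 1 b j * T (i, j, k))) = (if a = b then 1 else 0)"
            if "a < r" "b < r" for a b
          proof -
            have "(\<Sum>k<n. X 2 a k * (\<Sum>i<n. \<Sum>j<n. X 0 b i * X 1 b j * T (i, j, k))) =
                (\<Sum>k<n. \<Sum>i<n. \<Sum>j<n. X 2 a k * (X 0 b i * X 1 b j * T (i, j, k)))"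
              by (simp add: sum_distrib_left)
            also have "\<dots> = (\<Sum>i<n. \<Sum>k<n. \<Sum>j<n. X 2 a k * (X 0 b i * X 1 b j * T (i, j, k)))"
              by (rule sum.swap)
            also have "\<dots> = (\<Sum>i<n. \<Sum>j<n. \<Sum>k<n. X 2 a k * (X 0 b i * X 1 b j * T (i, j, k)))"
              by (intro sum.cong refl sum.swap)
            also have "\<dots> = (\<Sum>p\<in>cube n. multilinear X b b a p * T p)"
              by (simp add: cube_def sum.cartesian_product' multilinear_def mult_ac)
            finally show ?thesis using X[of b b a] that by (auto simp: cube unit_tensor_def)
          qed
          then show ?thesis using 3
            by (intro exI[of _ "\<lambda>k b. \<Sum>i<n. \<Sum>j<n. X 0 b i * X 1 b j * T (i, j, k)"]) auto
        qed
      qed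
      define selects where "selects = (\<lambda>m \<tau> U. inj_on \<tau> {..<r} \<and> \<tau> ` {..<r} \<subseteq> {..<n} \<and>
          (\<forall>a<r. \<forall>b<r. (\<Sum>s<r. U a s * X m s (\<tau> b)) = (if a = b then 1 else 0)))"
      have "\<exists>\<tau> U. selects m \<tau> U" if m: "m \<in> {..<3}" for m
      proof -
        have "m < 3" using m by simp
        from W[OF this] obtain W where "\<forall>a<r. \<forall>b<r. (\<Sum>i<n. X m a i * W i b) = (if a = b then 1 else 0)" ..
        then show ?thesis unfolding selects_def by (intro column_selection[where W = W]) blast
      qed
      then have "\<forall>m\<in>{..<3}. \<exists>\<tau>. \<exists>U. selects m \<tau> U" by blast
      from bchoice[OF this] obtain \<tau> where "\<forall>m\<in>{..<3}. \<exists>U. selects m (\<tau> m) U" ..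
      from bchoice[OF this] obtain U where "\<forall>m\<in>{..<3}. selects m (\<tau> m) (U m)" ..
      then have \<tau>: "inj_on (\<tau> m) {..<r} \<and> \<tau> m ` {..<r} \<subseteq> {..<n} \<and>
          (\<forall>a<r. \<forall>b<r. (\<Sum>s<r. U m a s * X m s (\<tau> m b)) = (if a = b then 1 else 0))" if "m < 3" for m
        using that unfolding selects_def by blast
      define \<sigma> where "\<sigma> = (\<lambda>m\<in>{..<3}. restrict (\<tau> m) {..<r})"
      have \<sigma>: "\<sigma> m s = \<tau> m s" if "m < 3" "s < r" for m s using that by (simp add: \<sigma>_def)
      have sel: "\<sigma> \<in> Sel"
        unfolding Sel_def Inj_def \<sigma>_def using \<tau>
        by (auto simp: inj_on_def image_subset_iff)
      have "(\<Sum>s<r. U m a s * X m s (\<sigma> m b)) = (if a = b then 1 else 0)" if "m < 3" "a < r" "b < r" for m a b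
        using \<tau>[OF that(1)] that by (simp add: \<sigma>)
      from normalized_tensor[OF inj[OF sel] this X]
      obtain x where x: "\<And>q. q \<in> cube n \<Longrightarrow> T q = parametrization \<sigma> r n q x" by blast
      have "parametrization \<sigma> r n q (cut \<sigma> x) = parametrization \<sigma> r n q x" if q: "q \<in> cube n" for q
      proof -
        have Inr: "cut \<sigma> x (Inr (m, a, i)) = x (Inr (m, a, i))" if "m < 3" "a < r" "i < n" for m a i
          using that by (auto simp: cut_def P_def)
        have Inl: "cut \<sigma> x (Inl p) = x (Inl p)" if "p \<in> cube n - block \<sigma> r" for p
          using that by (auto simp: cut_def P_def)
        obtain i j k where ijk: "q = (i, j, k)" using prod_cases3 by blast
        show ?thesis
        proof (cases "q \<in> block \<sigma> r")
          case False
          then show ?thesis using q Inl[of q] by (simp add: parametrization_def)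
        next
          case True
          define a where "a = inv_into {..<r} (\<sigma> 0) i"
          define b where "b = inv_into {..<r} (\<sigma> 1) j"
          define c where "c = inv_into {..<r} (\<sigma> 2) k"
          have abc: "a < r" "b < r" "c < r"
            using True inv_into_into[of i "\<sigma> 0" "{..<r}"] inv_into_into[of j "\<sigma> 1" "{..<r}"]
              inv_into_into[of k "\<sigma> 2" "{..<r}"]
            by (auto simp: ijk block_def a_def b_def c_def)
          have im: "\<sigma> m s < n" if "m < 3" "s < r" for m s using inj[OF sel that(1)] that(2) by auto
          have prods: "multilinear (normalized \<sigma> r (cut \<sigma> x)) a b c p * cut \<sigma> x (Inl p) =
              multilinear (normalized \<sigma> r x) a b c p * x (Inl p)" if p: "p \<in> cube n - block \<sigma> r" for p
          proof -
            obtain i' j' k' where ijk': "p = (i', j', k')" using prod_cases3 by blast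
            then have lt: "i' < n" "j' < n" "k' < n" using p by (auto simp: cube)
            show ?thesis
              using Inl[OF p] Inr[of 0 a i'] Inr[of 1 b j'] Inr[of 2 c k'] abc lt
              by (simp add: ijk' multilinear_def normalized_def)
          qed
          have minors: "multilinear (\<lambda>m a s. cut \<sigma> x (Inr (m, a, \<sigma> m s))) a b c (s, s, s) =
              multilinear (\<lambda>m a s. x (Inr (m, a, \<sigma> m s))) a b c (s, s, s)" if "s < r" for s
            using that abc im by (simp add: multilinear_def Inr)
          have "(\<Sum>s<r. multilinear (\<lambda>m a s. cut \<sigma> x (Inr (m, a, \<sigma> m s))) a b c (s, s, s)) =
              (\<Sum>s<r. multilinear (\<lambda>m a s. x (Inr (m, a, \<sigma> m s))) a b c (s, s, s))"
            by (rule sum.cong[OF refl], rule minors) simp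
          moreover have "(\<Sum>p\<in>cube n - block \<sigma> r. multilinear (normalized \<sigma> r (cut \<sigma> x)) a b c p * cut \<sigma> x (Inl p)) =
              (\<Sum>p\<in>cube n - block \<sigma> r. multilinear (normalized \<sigma> r x) a b c p * x (Inl p))"
            by (rule sum.cong[OF refl prods])
          ultimately show ?thesis
            using True by (simp only: parametrization_def ijk Let_def prod.case if_True
              a_def[symmetric] b_def[symmetric] c_def[symmetric])
        qed
      qed
      then show False using T sel x by metis
    qed
  qed
qed

section \<open>Generic values\<close>

lemma sum_multilinear_polynomial:
  assumes "\<And>m a i. polynomial_fun (\<lambda>z. X z m a i)" "\<And>p. polynomial_fun (\<lambda>z. T z p)"
  shows "polynomial_fun (\<lambda>z. \<Sum>p\<in>cube n. multilinear (X z) a b c p * T z p)"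
proof (intro polynomial_fun_intros assms(2))
  show "polynomial_fun (\<lambda>z. multilinear (X z) a b c p)" for p
    by (cases p) (simp add: multilinear_def, intro polynomial_fun_intros assms(1))
qed

lemma multilinear_cong:
  "p \<in> cube n \<Longrightarrow> (\<And>m i. m < 3 \<Longrightarrow> i < n \<Longrightarrow> X m a i = X' m a i \<and> X m b i = X' m b i \<and> X m c i = X' m c i) \<Longrightarrow>
    multilinear X a b c p = multilinear X' a b c p"
  by (cases p) (simp add: multilinear_def cube)

text \<open>The coordinates of T and the entries of the maps are put side by side as one family,
  indexed by \<open>Inl\<close> and \<open>Inr\<close>. The restriction equations are polynomial in
  it, and the finitely many relevant matrix entries are quantified away.\<close>

lemma decided_subrank_ge:
  "decided (\<lambda>T :: 'a::alg_closed_field tensor. unit_tensor r \<in> restrictions n n n r T)"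
proof -
  define sys where "sys = (\<lambda>z :: parameter \<Rightarrow> 'a. \<forall>q\<in>cube r.
    (case q of (a, b, c) \<Rightarrow> \<Sum>p\<in>cube n. multilinear (\<lambda>m a i. z (Inr (m, a, i))) a b c p * z (Inl p)) - unit_tensor r q = 0)"
  define I where "I = (Inr ` ({..<3} \<times> {..<r} \<times> {..<n}) :: parameter set)"
  have "constructible sys"
    unfolding sys_def
  proof (intro constructible_ball cube constructible.zero)
    fix q :: "nat \<times> nat \<times> nat"
    obtain a b c where q: "q = (a, b, c)" using prod_cases3 by blast
    show "polynomial_fun (\<lambda>z :: parameter \<Rightarrow> 'a.
        (case q of (a, b, c) \<Rightarrow> \<Sum>p\<in>cube n. multilinear (\<lambda>m a i. z (Inr (m, a, i))) a b c p * z (Inl p)) - unit_tensor r q)"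
      unfolding q prod.case
      by (intro polynomial_fun_diff polynomial_fun.const sum_multilinear_polynomial polynomial_fun.coord)
  qed
  moreover have "finite I" by (simp add: I_def)
  ultimately have "constructible (\<lambda>z. \<exists>y. sys (\<lambda>i. if i \<in> I then y i else z i))"
    by (intro constructible_ex_finite)
  then have "constructible (\<lambda>T. \<exists>y. sys (\<lambda>i. if i \<in> I then y i else (case i of Inl p \<Rightarrow> T p | Inr _ \<Rightarrow> 0)))"
  proof (rule constructible_compose)
    show "polynomial_fun (\<lambda>T. case i of Inl p \<Rightarrow> T p | Inr _ \<Rightarrow> 0)" for i :: "parameter"
      by (cases i) (simp_all add: polynomial_fun.const polynomial_fun.coord)
  qed
  moreover have "(\<exists>y. sys (\<lambda>i. if i \<in> I then y i else (case i of Inl p \<Rightarrow> T p | Inr _ \<Rightarrow> 0))) \<longleftrightarrow>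
      unit_tensor r \<in> restrictions n n n r T" for T
  proof -
    have cut: "(\<Sum>p\<in>cube n. multilinear (\<lambda>m a i. if Inr (m, a, i) \<in> I then X m a i else 0) a b c p * T p) =
        (\<Sum>p\<in>cube n. multilinear X a b c p * T p)" if "(a, b, c) \<in> cube r" for X a b c
    proof (rule sum.cong[OF refl])
      fix p assume p: "p \<in> cube n"
      have "multilinear (\<lambda>m a i. if Inr (m, a, i) \<in> I then X m a i else 0) a b c p = multilinear X a b c p"
        by (rule multilinear_cong[OF p]) (use that in \<open>simp add: I_def image_iff cube\<close>)
      then show "multilinear (\<lambda>m a i. if Inr (m, a, i) \<in> I then X m a i else 0) a b c p * T p = multilinear X a b c p * T p"
        by simp
    qed
    have sys: "sys (\<lambda>i. if i \<in> I then y i else (case i of Inl p \<Rightarrow> T p | Inr _ \<Rightarrow> 0)) \<longleftrightarrow>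
        (\<forall>(a, b, c)\<in>cube r. unit_tensor r (a, b, c) = (\<Sum>p\<in>cube n. multilinear (\<lambda>m a i. y (Inr (m, a, i))) a b c p * T p))" for y
    proof -
      define z where "z = (\<lambda>i. if i \<in> I then y i else (case i of Inl p \<Rightarrow> T p | Inr _ \<Rightarrow> 0))"
      have z: "z (Inl p) = T p" "z (Inr u) = (if Inr u \<in> I then y (Inr u) else 0)" for p u
        by (auto simp: z_def I_def)
      have eqs: "(\<forall>q\<in>cube r. (case q of (a, b, c) \<Rightarrow> S a b c) - unit_tensor r q = 0) \<longleftrightarrow>
          (\<forall>(a, b, c)\<in>cube r. unit_tensor r (a, b, c) = S a b c)" for S :: "nat \<Rightarrow> nat \<Rightarrow> nat \<Rightarrow> 'a"
        by (intro ball_cong) auto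
      have "sys z \<longleftrightarrow> (\<forall>(a, b, c)\<in>cube r. unit_tensor r (a, b, c) =
          (\<Sum>p\<in>cube n. multilinear (\<lambda>m a i. if Inr (m, a, i) \<in> I then y (Inr (m, a, i)) else 0) a b c p * T p))"
        unfolding sys_def z by (rule eqs)
      also have "\<dots> \<longleftrightarrow> (\<forall>(a, b, c)\<in>cube r. unit_tensor r (a, b, c) =
          (\<Sum>p\<in>cube n. multilinear (\<lambda>m a i. y (Inr (m, a, i))) a b c p * T p))"
        by (intro ball_cong refl) (auto simp: cut)
      finally show ?thesis unfolding z_def .
    qed
    have "(\<exists>y :: parameter \<Rightarrow> 'a. \<forall>(a, b, c)\<in>cube r.
          unit_tensor r (a, b, c) = (\<Sum>p\<in>cube n. multilinear (\<lambda>m a i. y (Inr (m, a, i))) a b c p * T p)) \<longleftrightarrow>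
        (\<exists>X. \<forall>(a, b, c)\<in>cube r. unit_tensor r (a, b, c) = (\<Sum>p\<in>cube n. multilinear X a b c p * T p))"
      (is "(\<exists>y. ?L y) \<longleftrightarrow> (\<exists>X. ?R X)")
    proof
      assume "\<exists>X. ?R X"
      then obtain X where "?R X" by blast
      then show "\<exists>y. ?L y" by (intro exI[of _ "case_sum (\<lambda>_. 0) (\<lambda>(m, a, i). X m a i)"]) simp
    qed blast
    moreover have "unit_tensor r q = (0::'a)" if "q \<notin> cube r" for q
      using that by (auto simp: unit_tensor_def cube split: prod.splits)
    ultimately show ?thesis by (auto simp only: sys mem_restrictions_iff)
  qed
  ultimately have "constructible (\<lambda>T :: 'a tensor. unit_tensor r \<in> restrictions n n n r T)" by simp
  then show ?thesis by (rule constructible_decided[OF infinite_UNIV_alg_closed])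
qed

lemma decided_border_subrank_ge:
  assumes inf: "infinite (UNIV :: 'a::field set)"
  shows "decided (\<lambda>T :: 'a tensor. unit_tensor r \<in> zariski_closure (restrictions n n n r T))"
proof -
  \<comment> \<open>In \<open>image_family\<close> the source variables are numbered by naturals.
    The entries (m, a, i) are encoded, and N exceeds the finitely many codes that occur, so that the
    target variables come after them.\<close>
  define enc :: "nat \<times> nat \<times> nat \<Rightarrow> nat" where "enc = to_nat"
  define \<phi> where "\<phi> = (\<lambda>q (z :: (nat \<times> nat \<times> nat) + nat \<Rightarrow> 'a). if q \<in> cube r then
    (case q of (a, b, c) \<Rightarrow> \<Sum>p\<in>cube n. multilinear (\<lambda>m a i. z (Inr (enc (m, a, i)))) a b c p * z (Inl p)) else 0)"
  have "\<exists>N. \<forall>x\<in>enc ` ({..<3} \<times> {..<r} \<times> {..<n}). x < N"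
    using finite_nat_set_iff_bounded by blast
  then obtain N where "\<forall>x\<in>enc ` ({..<3} \<times> {..<r} \<times> {..<n}). x < N" ..
  then have N: "enc (m, a, i) < N" if "m < 3" "a < r" "i < n" for m a i using that by simp
  obtain e where e: "bij_betw e {..<card (cube r)} (cube r)"
    using ex_bij_betw_nat_finite[OF cube(1)] by (auto simp: atLeast0LessThan)
  interpret image_family \<phi> N "card (cube r)" "cube r" e "unit_tensor r"
  proof
    show "infinite (UNIV :: 'a set)" by (rule inf)
    show "polynomial_fun (\<phi> q)" for q
    proof -
      obtain a b c where q: "q = (a, b, c)" using prod_cases3 by blast
      have "polynomial_fun (\<lambda>z. \<phi> q z)"
        unfolding \<phi>_def q prod.case
        by (intro polynomial_fun_if polynomial_fun.const sum_multilinear_polynomial polynomial_fun.coord)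
      then show ?thesis by simp
    qed
    show "\<phi> q (case_sum T x) = \<phi> q (case_sum T (\<lambda>p. if p < N then x p else 0))" for q T x
    proof -
      obtain a b c where q: "q = (a, b, c)" using prod_cases3 by blast
      show ?thesis
        unfolding \<phi>_def q prod.case
      proof (intro if_cong refl sum.cong)
        fix p assume abc: "(a, b, c) \<in> cube r" and p: "p \<in> cube n"
        have "multilinear (\<lambda>m a i. case_sum T x (Inr (enc (m, a, i)))) a b c p =
            multilinear (\<lambda>m a i. case_sum T (\<lambda>p. if p < N then x p else 0) (Inr (enc (m, a, i)))) a b c p"
          by (rule multilinear_cong[OF p]) (use abc in \<open>simp add: cube N\<close>)
        then show "multilinear (\<lambda>m a i. case_sum T x (Inr (enc (m, a, i)))) a b c p * case_sum T x (Inl p) =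
            multilinear (\<lambda>m a i. case_sum T (\<lambda>p. if p < N then x p else 0) (Inr (enc (m, a, i)))) a b c p *
              case_sum T (\<lambda>p. if p < N then x p else 0) (Inl p)" by simp
      qed
    qed
    show "unit_tensor r q = (0::'a)" if "q \<notin> cube r" for q
      using that by (auto simp: unit_tensor_def cube split: prod.splits)
    show "bij_betw e {..<card (cube r)} (cube r)" by (rule e)
    show "\<phi> q z = 0" if "q \<notin> cube r" for q z using that by (simp add: \<phi>_def)
  qed
  have "im T = restrictions n n n r T" for T
  proof (intro Set.set_eqI iffI)
    fix S assume "S \<in> im T"
    then obtain x where S: "S = (\<lambda>q. \<phi> q (case_sum T x))" by (auto simp: im_def)
    show "S \<in> restrictions n n n r T"
      unfolding mem_restrictions_iff S
      by (intro conjI exI[of _ "\<lambda>m a i. x (enc (m, a, i))"]) (auto simp: \<phi>_def)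
  next
    fix S assume S: "S \<in> restrictions n n n r T"
    then obtain X where X: "\<And>a b c. (a, b, c) \<in> cube r \<Longrightarrow> S (a, b, c) = (\<Sum>p\<in>cube n. multilinear X a b c p * T p)"
      unfolding mem_restrictions_iff by blast
    define x where "x = (\<lambda>u. case from_nat u of (m, a, i) \<Rightarrow> X m a i)"
    have x: "x (enc (m, a, i)) = X m a i" for m a i by (simp add: x_def enc_def)
    have "S q = \<phi> q (case_sum T x)" for q
    proof (cases "q \<in> cube r")
      case True
      obtain a b c where q: "q = (a, b, c)" using prod_cases3 by blast
      then show ?thesis using X True by (simp add: \<phi>_def x)
    next
      case False
      then have "S q = 0" using S unfolding mem_restrictions_iff by blast
      then show ?thesis using False by (simp add: \<phi>_def)
    qed
    then have "S = (\<lambda>q. \<phi> q (case_sum T x))" by (rule ext)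
    then show "S \<in> im T" unfolding im_def by blast
  qed
  then show ?thesis using decided_closure by simp
qed

section \<open>Range of the admissible values\<close>

lemma restrictions_0:
  fixes T :: "'a::comm_ring_1 tensor"
  shows "unit_tensor 0 \<in> restrictions n n n 0 T"
  by (simp add: mem_restrictions_iff cube_def unit_tensor_def split_beta)

text \<open>
  The matrix with entries \<open>S (a, b, b)\<close> factors through dimension \<open>n\<close> if \<open>S\<close> is a restriction of a
  tensor of size \<open>n\<close>, and is the identity if \<open>S\<close> is the unit tensor.
\<close>

lemma border_subrank_le:
  fixes T :: "'a::field tensor"
  assumes "unit_tensor r \<in> zariski_closure (restrictions n n n r T)"
  shows "r \<le> n"
proof (rule ccontr)
  assume "\<not> r \<le> n"
  define f where "f = (\<lambda>S :: 'a tensor. det (mat r r (\<lambda>(a, b). S (a, b, b))))"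
  have f: "f S = (\<Sum>p\<in>{p. p permutes {0..<r}}. signof p * (\<Prod>a = 0..<r. S (a, p a, p a)))" for S
  proof -
    have "mat r r (\<lambda>(a, b). S (a, b, b)) $$ (a, p a) = S (a, p a, p a)"
      if "p permutes {0..<r}" "a \<in> {0..<r}" for p a
      using that permutes_in_image[OF that(1), of a] by auto
    then show ?thesis
      unfolding f_def by (subst det_def'[of _ r]) (auto intro!: sum.cong prod.cong)
  qed
  have "polynomial_fun f"
    unfolding f by (intro polynomial_fun_intros)
  moreover have "f S = 0" if S: "S \<in> restrictions n n n r T" for S
  proof -
    obtain X where X: "\<And>a b c. (a, b, c) \<in> cube r \<Longrightarrow> S (a, b, c) = (\<Sum>p\<in>cube n. multilinear X a b c p * T p)"
      using S unfolding mem_restrictions_iff by blast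
    define W where "W = (\<lambda>b i. \<Sum>j<n. \<Sum>k<n. X 1 b j * X 2 b k * T (i, j, k))"
    have Sab: "S (a, b, b) = (\<Sum>i<n. X 0 a i * W b i)" if "a < r" "b < r" for a b
      using X[of a b b] that
      by (simp add: cube cube_def sum.cartesian_product' multilinear_def W_def sum_distrib_left mult.assoc)
    \<comment> \<open>The r vectors \<open>W b\<close> live in dimension n < r, so they are
      dependent. The dependency d is a kernel vector of the matrix.\<close>
    have "card {..<n} < card {..<r}" using \<open>\<not> r \<le> n\<close> by simp
    from homogeneous_solution[OF _ _ this, of W]
    obtain d b0 where d: "b0 < r" "d b0 \<noteq> 0" "\<And>i. i < n \<Longrightarrow> (\<Sum>b<r. d b * W b i) = 0" by auto
    have "(mat r r (\<lambda>(a, b). S (a, b, b))) *\<^sub>v vec r d = 0\<^sub>v r"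
    proof (rule eq_vecI)
      fix a assume "a < dim_vec (0\<^sub>v r :: 'a vec)"
      then have a: "a < r" by simp
      have "(mat r r (\<lambda>(a, b). S (a, b, b)) *\<^sub>v vec r d) $ a = (\<Sum>b<r. (\<Sum>i<n. X 0 a i * W b i) * d b)"
        using a by (simp add: scalar_prod_def atLeast0LessThan Sab)
      also have "\<dots> = (\<Sum>i<n. X 0 a i * (\<Sum>b<r. d b * W b i))"
        unfolding sum_distrib_left sum_distrib_right by (subst sum.swap) (simp add: mult_ac)
      also have "\<dots> = 0" by (simp add: d(3))
      finally show "(mat r r (\<lambda>(a, b). S (a, b, b)) *\<^sub>v vec r d) $ a = 0\<^sub>v r $ a" using a by simp
    qed simp
    moreover have "vec r d \<noteq> 0\<^sub>v r" using d(1,2) by (metis index_vec index_zero_vec(1))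
    ultimately show "f S = 0"
      unfolding f_def by (subst det_0_iff_vec_prod_zero_field[of _ r]) (auto intro: exI[of _ "vec r d"])
  qed
  ultimately have "f (unit_tensor r) = 0" using assms unfolding mem_zariski_closure_iff by blast
  moreover have "mat r r (\<lambda>(a, b). unit_tensor r (a, b, b)) = (1\<^sub>m r :: 'a mat)"
    by (rule eq_matI) (auto simp: unit_tensor_def)
  ultimately show False by (simp add: f_def)
qed

lemma subrank_le:
  fixes T :: "'a::field tensor"
  assumes "unit_tensor r \<in> restrictions n n n r T"
  shows "r \<le> n"
proof (rule border_subrank_le)
  show "unit_tensor r \<in> zariski_closure (restrictions n n n r T)"
    by (rule subsetD[OF hull_subset assms])
qed

section \<open>From the space of all families to the tensors of size n\<close>

definition depends_on_cube :: "nat \<Rightarrow> ('a tensor \<Rightarrow> bool) \<Rightarrow> bool" where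
  "depends_on_cube n P \<longleftrightarrow> (\<forall>T T'. (\<forall>p\<in>cube n. T p = T' p) \<longrightarrow> P T = P T')"

text \<open>The polynomial h might vanish on all tensors, through coordinates outside the cube.
  Freezing those coordinates at the values of a point where h is nonzero cures this, and P does not
  notice the change.\<close>

lemma generically_on_tensors:
  fixes P :: "'a::field tensor \<Rightarrow> bool"
  assumes "generically P" and inv: "depends_on_cube n P"
  shows "\<exists>h. polynomial_fun h \<and> (\<exists>T\<in>tensors n n n. h T \<noteq> 0) \<and> (\<forall>T\<in>tensors n n n. h T \<noteq> 0 \<longrightarrow> P T)"
proof -
  obtain h T0 where h: "polynomial_fun h" "h T0 \<noteq> 0" "\<And>T. h T \<noteq> 0 \<Longrightarrow> P T"
    using assms(1) unfolding generically_def by blast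
  define h' where "h' = (\<lambda>T. h (\<lambda>p. if p \<in> cube n then T p else T0 p))"
  have "polynomial_fun h'"
    unfolding h'_def by (intro polynomial_fun_compose[OF h(1)] polynomial_fun_intros)
  moreover have "h' (\<lambda>p. if p \<in> cube n then T0 p else 0) \<noteq> 0"
    using h(2) by (simp add: h'_def cong: if_cong)
  moreover have "(\<lambda>p. if p \<in> cube n then T0 p else 0) \<in> tensors n n n"
    by (auto simp: tensors_def cube)
  moreover have "P T" if "h' T \<noteq> 0" for T
  proof -
    have "P (\<lambda>p. if p \<in> cube n then T p else T0 p)" using that by (intro h(3)) (simp add: h'_def)
    moreover have "P (\<lambda>p. if p \<in> cube n then T p else T0 p) = P T"
      using inv[unfolded depends_on_cube_def, rule_format, of "\<lambda>p. if p \<in> cube n then T p else T0 p" T] by simp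
    ultimately show ?thesis by simp
  qed
  ultimately show ?thesis by blast
qed

lemma tensors_line:
  fixes T0 :: "'a::field tensor"
  assumes "T0 \<in> tensors n1 n2 n3" "T1 \<in> tensors n1 n2 n3"
  shows "(\<lambda>i. T0 i + t * (T1 i - T0 i)) \<in> tensors n1 n2 n3"
  using assms unfolding tensors_def by (intro CollectI allI impI, elim CollectE, simp)

text \<open>If f were nonzero at some tensor T0, the line to a tensor T1 with h nonzero would
  contain a tensor where f and h are both nonzero; it has property P, so f should vanish
  there.\<close>

lemma zariski_dense_generically:
  fixes P :: "'a::field tensor \<Rightarrow> bool"
  assumes inf: "infinite (UNIV :: 'a set)" and "generically P"
    and inv: "depends_on_cube n P"
  shows "zariski_dense_in (tensors n n n) {T \<in> tensors n n n. P T}"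
proof -
  obtain h T1 where h: "polynomial_fun h" "T1 \<in> tensors n n n" "h T1 \<noteq> 0"
    "\<And>T. T \<in> tensors n n n \<Longrightarrow> h T \<noteq> 0 \<Longrightarrow> P T"
    using generically_on_tensors[OF assms(2) inv] by blast
  have "T0 \<in> zariski_closure {T \<in> tensors n n n. P T}" if T0: "T0 \<in> tensors n n n" for T0
    unfolding mem_zariski_closure_iff
  proof (intro allI impI, rule ccontr)
    fix f assume f: "polynomial_fun f" "\<forall>T\<in>{T \<in> tensors n n n. P T}. f T = 0" "f T0 \<noteq> 0"
    from polynomial_fun_common_nonzero[where p = f and q = h and x = T0 and y = T1, OF inf f(1,3) h(1,3)]
    obtain t where t: "f (\<lambda>i. T0 i + t * (T1 i - T0 i)) \<noteq> 0 \<and> h (\<lambda>i. T0 i + t * (T1 i - T0 i)) \<noteq> 0" ..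
    define T where "T = (\<lambda>i. T0 i + t * (T1 i - T0 i))"
    have T: "T \<in> tensors n n n" unfolding T_def by (rule tensors_line[OF T0 h(2)])
    moreover have "P T" using h(4)[OF T] t by (simp only: T_def simp_thms)
    ultimately have "f T = 0" using f(2) by simp
    then show False using t by (simp only: T_def simp_thms)
  qed
  then show ?thesis unfolding zariski_dense_in_def by blast
qed

lemma not_zariski_dense_generically:
  fixes P :: "'a::field tensor \<Rightarrow> bool"
  assumes "generically (\<lambda>T. \<not> P T)" and inv: "depends_on_cube n P"
  shows "\<not> zariski_dense_in (tensors n n n) {T \<in> tensors n n n. P T}"
proof -
  obtain h T1 where h: "polynomial_fun h" "T1 \<in> tensors n n n" "h T1 \<noteq> 0"
    "\<And>T. T \<in> tensors n n n \<Longrightarrow> h T \<noteq> 0 \<Longrightarrow> \<not> P T"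
    using generically_on_tensors[OF assms(1), of n] inv by (auto simp: depends_on_cube_def)
  then have "\<forall>T\<in>{T \<in> tensors n n n. P T}. h T = 0" by blast
  then have "T1 \<notin> zariski_closure {T \<in> tensors n n n. P T}"
    using h(1,3) unfolding mem_zariski_closure_iff by blast
  then show ?thesis using h(2) unfolding zariski_dense_in_def by blast
qed

text \<open>The equation R T = g is a Boolean combination of admissibility for the finitely many
  values between g and n, so it is decided; the admissible r need not form an initial segment. Were
  R T different from g generically for each g up to n, some T would avoid all values. Once one value
  is generic, every other level set fails to be dense.\<close>

lemma generic_greatest:
  fixes adm :: "nat \<Rightarrow> 'a::field tensor \<Rightarrow> bool"
  assumes inf: "infinite (UNIV :: 'a set)"
    and dec: "\<And>r. decided (adm r)"
    and bound: "\<And>r T. adm r T \<Longrightarrow> r \<le> n" and zero: "\<And>T. adm 0 T"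
    and inv: "\<And>r. depends_on_cube n (adm r)"
  defines "R \<equiv> \<lambda>T. GREATEST r. adm r T"
  shows "\<exists>g. (THE r. zariski_dense_in (tensors n n n) {T \<in> tensors n n n. R T = r}) = g \<and>
    generically (\<lambda>T. adm g T \<and> (\<forall>r. adm r T \<longrightarrow> r \<le> g))"
proof -
  have R_adm: "adm (R T) T" for T
    unfolding R_def using zero bound by (rule GreatestI_nat[where P = "\<lambda>r. adm r T"])
  have R_ge: "r \<le> R T" if "adm r T" for r T
    unfolding R_def using that bound by (rule Greatest_le_nat[where P = "\<lambda>r. adm r T"])
  have R_inv: "depends_on_cube n (\<lambda>T. R T = g)" for g
  proof -
    have "adm r T = adm r T'" if "\<forall>p\<in>cube n. T p = T' p" for r T T'
      using inv[of r] that unfolding depends_on_cube_def by blast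
    then have "R T = R T'" if "\<forall>p\<in>cube n. T p = T' p" for T T'
      using that unfolding R_def by presburger
    then show ?thesis by (auto simp: depends_on_cube_def)
  qed
  have R_iff: "R T = g \<longleftrightarrow> adm g T \<and> (\<forall>s\<in>{g<..n}. \<not> adm s T)" for T g
  proof
    assume "R T = g"
    then show "adm g T \<and> (\<forall>s\<in>{g<..n}. \<not> adm s T)" using R_adm R_ge by (metis greaterThanAtMost_iff not_le)
  next
    assume *: "adm g T \<and> (\<forall>s\<in>{g<..n}. \<not> adm s T)"
    then have "g \<le> R T" "R T \<notin> {g<..n}" using R_ge R_adm by blast+
    moreover have "R T \<le> n" using bound R_adm by blast
    ultimately show "R T = g" by simp
  qed
  have dec_R: "decided (\<lambda>T. R T = g)" for g
    unfolding R_iff by (intro decided_conj[OF inf] decided_ball[OF inf] decided_not dec) auto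
  have "\<exists>g\<le>n. generically (\<lambda>T. R T = g)"
  proof (rule ccontr)
    assume "\<not> (\<exists>g\<le>n. generically (\<lambda>T. R T = g))"
    then have "generically (\<lambda>T. R T \<noteq> g)" if "g \<in> {..n}" for g
      using dec_R[of g] that by (auto simp: decided_def)
    then have "generically (\<lambda>T. \<forall>g\<in>{..n}. R T \<noteq> g)" by (intro generically_ball[OF inf]) auto
    then obtain T where "\<forall>g\<in>{..n}. R T \<noteq> g" using generically_witness by blast
    moreover have "R T \<le> n" using bound R_adm by blast
    ultimately show False by auto
  qed
  then obtain g where g: "generically (\<lambda>T. R T = g)" by blast
  have "(THE r. zariski_dense_in (tensors n n n) {T \<in> tensors n n n. R T = r}) = g"
  proof (rule the_equality)
    show "zariski_dense_in (tensors n n n) {T \<in> tensors n n n. R T = g}"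
      by (rule zariski_dense_generically[OF inf g R_inv])
    fix r assume dense: "zariski_dense_in (tensors n n n) {T \<in> tensors n n n. R T = r}"
    show "r = g"
    proof (rule ccontr)
      assume "r \<noteq> g"
      then have "generically (\<lambda>T. R T \<noteq> r)" by (auto intro: generically_mono[OF g])
      then have "\<not> zariski_dense_in (tensors n n n) {T \<in> tensors n n n. R T = r}"
        by (rule not_zariski_dense_generically[OF _ R_inv])
      then show False using dense by blast
    qed
  qed
  moreover have "generically (\<lambda>T. adm g T \<and> (\<forall>r. adm r T \<longrightarrow> r \<le> g))"
    by (rule generically_mono[OF g]) (use R_adm R_ge in blast)
  ultimately show ?thesis by blast
qed

text \<open>Compared at the generic value g itself: generically g is admissible, whereas 3 n < g^2
  would make it generically inadmissible.\<close>

lemma generic_subrank_le: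
  "(generic_subrank TYPE('a::alg_closed_field) n n n)\<^sup>2 \<le> 3 * n"
proof (rule ccontr)
  assume less: "\<not> (generic_subrank TYPE('a) n n n)\<^sup>2 \<le> 3 * n"
  define g where "g = generic_subrank TYPE('a) n n n"
  have "\<exists>g. (THE r. zariski_dense_in (tensors n n n) {T \<in> tensors n n n.
      (GREATEST r. unit_tensor r \<in> restrictions n n n r (T :: 'a tensor)) = r}) = g \<and>
    generically (\<lambda>T :: 'a tensor. unit_tensor g \<in> restrictions n n n g T \<and>
      (\<forall>r. unit_tensor r \<in> restrictions n n n r T \<longrightarrow> r \<le> g))"
  proof (rule generic_greatest[where adm = "\<lambda>r T. unit_tensor r \<in> restrictions n n n r T"])
    show "depends_on_cube n (\<lambda>T :: 'a tensor. unit_tensor r \<in> restrictions n n n r T)" for r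
      unfolding depends_on_cube_def using restrictions_cong by metis
    show "infinite (UNIV :: 'a set)" by (rule infinite_UNIV_alg_closed)
    show "decided (\<lambda>T :: 'a tensor. unit_tensor r \<in> restrictions n n n r T)" for r
      by (rule decided_subrank_ge)
    show "r \<le> n" if "unit_tensor r \<in> restrictions n n n r T" for r and T :: "'a tensor"
      using that by (rule subrank_le)
    show "unit_tensor 0 \<in> restrictions n n n 0 T" for T :: "'a tensor"
      by (rule restrictions_0)
  qed
  then have "generically (\<lambda>T :: 'a tensor. unit_tensor g \<in> restrictions n n n g T)"
    unfolding g_def generic_subrank_def subrank_def by (auto elim: generically_mono)
  moreover have "generically (\<lambda>T :: 'a tensor. unit_tensor g \<notin> restrictions n n n g T)"
    using less by (intro generically_subrank_less infinite_UNIV_alg_closed) (simp add: g_def)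
  ultimately have "generically (\<lambda>T :: 'a tensor. unit_tensor g \<in> restrictions n n n g T \<and>
      unit_tensor g \<notin> restrictions n n n g T)"
    by (rule generically_conj[OF infinite_UNIV_alg_closed])
  then show False using generically_witness by blast
qed

lemma generic_border_subrank_ge:
  assumes "r \<le> n" "(r + 1)\<^sup>2 \<le> 4 * (n - r)"
  shows "r \<le> generic_border_subrank TYPE('a::alg_closed_field) n n n"
proof -
  define g where "g = generic_border_subrank TYPE('a) n n n"
  have "\<exists>g. (THE r. zariski_dense_in (tensors n n n) {T \<in> tensors n n n.
      (GREATEST r. unit_tensor r \<in> zariski_closure (restrictions n n n r (T :: 'a tensor))) = r}) = g \<and>
    generically (\<lambda>T :: 'a tensor. unit_tensor g \<in> zariski_closure (restrictions n n n g T) \<and>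
      (\<forall>r. unit_tensor r \<in> zariski_closure (restrictions n n n r T) \<longrightarrow> r \<le> g))"
  proof (rule generic_greatest[where adm = "\<lambda>r T. unit_tensor r \<in> zariski_closure (restrictions n n n r T)"])
    show "unit_tensor 0 \<in> zariski_closure (restrictions n n n 0 T)" for T :: "'a tensor"
      by (rule subsetD[OF hull_subset restrictions_0])
    show "depends_on_cube n (\<lambda>T :: 'a tensor. unit_tensor r \<in> zariski_closure (restrictions n n n r T))" for r
      unfolding depends_on_cube_def using restrictions_cong by metis
    show "infinite (UNIV :: 'a set)" by (rule infinite_UNIV_alg_closed)
    show "decided (\<lambda>T :: 'a tensor. unit_tensor r \<in> zariski_closure (restrictions n n n r T))" for r
      by (rule decided_border_subrank_ge[OF infinite_UNIV_alg_closed])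
    show "r \<le> n" if "unit_tensor r \<in> zariski_closure (restrictions n n n r T)" for r and T :: "'a tensor"
      using that by (rule border_subrank_le)
  qed
  then have "generically (\<lambda>T :: 'a tensor. \<forall>r. unit_tensor r \<in> zariski_closure (restrictions n n n r T) \<longrightarrow> r \<le> g)"
    unfolding g_def generic_border_subrank_def border_subrank_def by (auto elim: generically_mono)
  then have "generically (\<lambda>T :: 'a tensor.
      (\<forall>r. unit_tensor r \<in> zariski_closure (restrictions n n n r T) \<longrightarrow> r \<le> g) \<and>
      unit_tensor r \<in> zariski_closure (restrictions n n n r T))"
    by (intro generically_conj generically_border_subrank_ge infinite_UNIV_alg_closed assms)
  then have "r \<le> g" using generically_witness by blast
  then show ?thesis by (simp add: g_def)
qed

lemma generic_border_subrank_ge_sqrt: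
  "\<lfloor>sqrt (4 * real n)\<rfloor> - 3 \<le> int (generic_border_subrank TYPE('a::alg_closed_field) n n n)"
proof (cases "\<lfloor>sqrt (4 * real n)\<rfloor> \<le> 3")
  case False
  define r where "r = nat (\<lfloor>sqrt (4 * real n)\<rfloor> - 3)"
  have r: "\<lfloor>sqrt (4 * real n)\<rfloor> = int r + 3" using False by (simp add: r_def)
  then have "real r + 3 \<le> sqrt (4 * real n)" by linarith
  then have "(real r + 3)\<^sup>2 \<le> (sqrt (4 * real n))\<^sup>2" by (intro power_mono) auto
  then have "(real r + 3)\<^sup>2 \<le> 4 * real n" by simp
  then have "real ((r + 3)\<^sup>2) \<le> real (4 * n)" by simp
  then have sq: "(r + 3)\<^sup>2 \<le> 4 * n" by (simp only: of_nat_le_iff)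
  then have "r \<le> n" by (simp add: power2_eq_square algebra_simps)
  \<comment> \<open>Here (r + 3)^2 = (r + 1)^2 + 4 r + 8, so the shift by 3 pays for the r reserved
    coordinates.\<close>
  moreover have "(r + 1)\<^sup>2 \<le> 4 * (n - r)"
    using sq by (simp add: power2_eq_square algebra_simps)
  ultimately have "r \<le> generic_border_subrank TYPE('a) n n n" by (rule generic_border_subrank_ge)
  then show ?thesis using r by simp
qed linarith

theorem theorem1p4:
  shows "(\<forall>n. int (generic_border_subrank TYPE('a::alg_closed_field) n n n) \<ge> \<lfloor>sqrt (4 * real n)\<rfloor> - 3) \<and>
    (\<exists>N. \<forall>n\<ge>N. generic_border_subrank TYPE('a) n n n > generic_subrank TYPE('a) n n n)"
proof (intro conjI allI exI[of _ 400] impI)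
  show "int (generic_border_subrank TYPE('a) n n n) \<ge> \<lfloor>sqrt (4 * real n)\<rfloor> - 3" for n
    by (rule generic_border_subrank_ge_sqrt)
  fix n :: nat assume n: "400 \<le> n"
  define s where "s = sqrt (real n)"
  have "sqrt 400 \<le> s" using n unfolding s_def by (intro real_sqrt_le_mono) simp
  then have s: "20 \<le> s" by (simp add: real_sqrt_unique)
  define b where "b = real (generic_border_subrank TYPE('a) n n n)"
  define g where "g = real (generic_subrank TYPE('a) n n n)"
  have "sqrt (4 * real n) = 2 * s" by (simp add: s_def real_sqrt_mult)
  then have "2 * s - 4 < b" using generic_border_subrank_ge_sqrt[of n, where 'a = 'a] unfolding b_def by linarith
  \<comment> \<open>The constant 9/5 is a rational number between sqrt 3 and 2. From s >= 20 one
    gets 2 s - 4 >= 9/5 s, whence the threshold 400 = 20^2.\<close>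
  then have b: "9 / 5 * s < b" using s by simp
  have "real ((generic_subrank TYPE('a) n n n)\<^sup>2) \<le> real (3 * n)"
    using generic_subrank_le by (simp only: of_nat_le_iff)
  then have "g\<^sup>2 \<le> 3 * s\<^sup>2" by (simp add: g_def s_def)
  also have "\<dots> \<le> (9 / 5 * s)\<^sup>2" by (simp add: power_mult_distrib power_divide)
  finally have "g \<le> 9 / 5 * s" by (rule power2_le_imp_le) (use s in simp)
  then show "generic_border_subrank TYPE('a) n n n > generic_subrank TYPE('a) n n n"
    using b by (simp add: b_def g_def)
qed

end
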